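(* Let $\gamma=(\gamma_1,\dots,\gamma_N)$ be a self-similar map on a compact metric space $K$ satisfying Assumption A. Let $\sigma$ be a tracial state on the core $\mathcal{F}^{(\infty)}$. If the Borel measure $\mu_0$ on $K$ given by the restriction of $\sigma$ to $A=C(K)$ has no positive point mass, then $\sigma=\tau^{(\infty)}$.
   Context: Self-similar maps. $(K,d)$ is a compact metric space, $N\ge 2$, and $\gamma=(\gamma_1,\dots,\gamma_N)$ is a self-similar map on $K$: each $\gamma_j:K\to K$ is a proper contraction (there are constants $0<c'\le c<1$ with $c'd(x,y)\le d(\gamma_j(x),\gamma_j(y))\le c\,d(x,y)$ for all $x,y\in K$) and $K=\bigcup_{j=1}^N\gamma_j(K)$. Put $\Sigma=\{1,\dots,N\}$, $B_\gamma=\{b\in K: b=\gamma_i(a)=\gamma_j(a)\text{ for some }a\in K,\ i\ne j\}$ (branch set), $P_\gamma=\{a\in K:\gamma_{j_1}\circ\cdots\circ\gamma_{j_k}(a)\in B_\gamma\text{ for some }k\ge1,\ (j_1,\dots,j_k)\in\Sigma^k\}$, and $O_{b,k}=\{\gamma_{j_1}\circ\cdots\circ\gamma_{j_k}(b):(j_1,\dots,j_k)\in\Sigma^k\}$ for $k\ge 1$. Assumption A: (1) there is a continuous map $h:K\to K$ with $h(\gamma_j(y))=y$ for all $y\in K$, $j=1,\dots,N$, and $h^{-1}(y)=\{\gamma_1(y),\dots,\gamma_N(y)\}$; (2) $B_\gamma$ and $P_\gamma$ are finite; (3) $B_\gamma\cap\bigcup_{b\in B_\gamma}\bigcup_{k\ge1}O_{b,k}=\emptyset$.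 The correspondence and the core. $A=C(K)$, $\mathcal{C}=\bigcup_{j=1}^N\{(\gamma_j(y),y):y\in K\}$, $X=C(\mathcal{C})$, with $(a\cdot f\cdot b)(\gamma_j(y),y)=a(\gamma_j(y))f(\gamma_j(y),y)b(y)$, $(f|g)_A(y)=\sum_{j=1}^N\overline{f(\gamma_j(y),y)}g(\gamma_j(y),y)$, and left action $\phi(a)f=a\cdot f$; this is a $C^*$-correspondence over $A$. For a Hilbert module $Y$, $\mathcal{L}(Y)$ is the algebra of adjointable operators, $\theta_{x,y}(z)=x(y|z)_A$, and $\mathcal{K}(Y)$ is the $C^*$-algebra generated by the $\theta_{x,y}$. $X^{\otimes n}$ is the $n$-fold inner tensor product, $X^{\otimes 0}=A$. Put $\mathcal{F}^{(n)}=A\otimes I+\mathcal{K}(X)\otimes I+\cdots+\mathcal{K}(X^{\otimes n})\subset\mathcal{L}(X^{\otimes n})$, embedded in $\mathcal{F}^{(n+1)}$ by $T\mapsto T\otimes I$, and $\mathcal{F}^{(\infty)}=\overline{\bigcup_n\mathcal{F}^{(n)}}$ (the core of the Cuntz-Pimsner algebra of $X$). The trace $\tau^{(\infty)}$. The Hutchinson measure $\mu_H$ is the unique Borel probability measure on $K$ with $\int a\,d\mu_H=\frac1N\sum_{j=1}^N\int a\circ\gamma_j\,d\mu_H$ for all $a\in C(K)$; $\tau^{(\infty)}$ is the unique finite trace (bounded positive tracial functional) on $\mathcal{F}^{(\infty)}$ with $\tau^{(\infty)}(a)=\int a\,d\mu_H$ for $a\in A$ and $\tau^{(\infty)}(\theta_{x,y})=N^{-i}\int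 (y|x)_A\,d\mu_H$ for $x,y\in X^{\otimes i}$, $i\ge1$. *)

theory Defs
  imports "HOL-Analysis.Analysis"
begin

section \<open>Self-similar maps\<close>

text \<open>The compact space is the whole of a metric type (compactness of \<open>UNIV\<close> is assumed where it is
  needed), and a system of maps is a function \<open>\<gamma>\<close> of which only \<open>\<gamma> 1, \<dots>, \<gamma> N\<close> matter.
  Note that \<open>foldr \<gamma> [j\<^sub>1, \<dots>, j\<^sub>k] x = \<gamma> j\<^sub>1 (\<dots> (\<gamma> j\<^sub>k x))\<close>.\<close>

definition proper_contraction :: "('k::metric_space \<Rightarrow> 'k) \<Rightarrow> bool" where
  "proper_contraction f \<longleftrightarrow>
     (\<exists>c' c. 0 < c' \<and> c' \<le> c \<and> c < 1 \<and>
        (\<forall>x y. c' * dist x y \<le> dist (f x) (f y) \<and> dist (f x) (f y) \<le> c * dist x y))"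

definition self_similar_map :: "nat \<Rightarrow> (nat \<Rightarrow> 'k::metric_space \<Rightarrow> 'k) \<Rightarrow> bool" where
  "self_similar_map N \<gamma> \<longleftrightarrow>
     (\<forall>j\<in>{1..N}. proper_contraction (\<gamma> j)) \<and> (\<Union>j\<in>{1..N}. range (\<gamma> j)) = UNIV"

definition branch_set :: "nat \<Rightarrow> (nat \<Rightarrow> 'k \<Rightarrow> 'k) \<Rightarrow> 'k set" where
  "branch_set N \<gamma> =
     {b. \<exists>a. \<exists>i\<in>{1..N}. \<exists>j\<in>{1..N}. i \<noteq> j \<and> b = \<gamma> i a \<and> b = \<gamma> j a}"

definition postcritical_set :: "nat \<Rightarrow> (nat \<Rightarrow> 'k \<Rightarrow> 'k) \<Rightarrow> 'k set" where
  "postcritical_set N \<gamma> =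
     {a. \<exists>js. length js \<ge> 1 \<and> set js \<subseteq> {1..N} \<and> foldr \<gamma> js a \<in> branch_set N \<gamma>}"

definition orbit_level :: "nat \<Rightarrow> (nat \<Rightarrow> 'k \<Rightarrow> 'k) \<Rightarrow> 'k \<Rightarrow> nat \<Rightarrow> 'k set" where
  "orbit_level N \<gamma> b k = {foldr \<gamma> js b | js. length js = k \<and> set js \<subseteq> {1..N}}"

definition assumption_A :: "nat \<Rightarrow> (nat \<Rightarrow> 'k::metric_space \<Rightarrow> 'k) \<Rightarrow> bool" where
  "assumption_A N \<gamma> \<longleftrightarrow>
     (\<exists>h. continuous_on UNIV h \<and> (\<forall>y. \<forall>j\<in>{1..N}. h (\<gamma> j y) = y) \<and>
          (\<forall>y. h -` {y} = (\<lambda>j. \<gamma> j y) ` {1..N})) \<and>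
     finite (branch_set N \<gamma>) \<and> finite (postcritical_set N \<gamma>) \<and>
     branch_set N \<gamma> \<inter> (\<Union>b\<in>branch_set N \<gamma>. \<Union>k\<in>{1..}. orbit_level N \<gamma> b k) = {}"


section \<open>Completion of a pseudometric\<close>

text \<open>Points of the completion are equivalence classes of Cauchy sequences, so that points of \<open>V\<close>
  at distance \<open>0\<close> become equal. Operations are lifted by applying them termwise to
  representatives.\<close>

definition cauchy_seqs :: "'v set \<Rightarrow> ('v \<Rightarrow> 'v \<Rightarrow> real) \<Rightarrow> (nat \<Rightarrow> 'v) set" where
  "cauchy_seqs V d =
     {s. range s \<subseteq> V \<and> (\<forall>e>0. \<exists>M. \<forall>m\<ge>M. \<forall>n\<ge>M. d (s m) (s n) < e)}"

definition seq_class :: "'v set \<Rightarrow> ('v \<Rightarrow> 'v \<Rightarrow> real) \<Rightarrow> (nat \<Rightarrow> 'v) \<Rightarrow> (nat \<Rightarrow> 'v) set" where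
  "seq_class V d s = {t \<in> cauchy_seqs V d. (\<lambda>m. d (s m) (t m)) \<longlonglongrightarrow> 0}"

definition completion :: "'v set \<Rightarrow> ('v \<Rightarrow> 'v \<Rightarrow> real) \<Rightarrow> (nat \<Rightarrow> 'v) set set" where
  "completion V d = seq_class V d ` cauchy_seqs V d"

definition rep :: "(nat \<Rightarrow> 'v) set \<Rightarrow> nat \<Rightarrow> 'v" where
  "rep P = (SOME s. s \<in> P)"


section \<open>C*-algebras of operators on Hilbert modules over C(K)\<close>

definition cont_fun :: "('k::topological_space \<Rightarrow> complex) set" where
  "cont_fun = {a. continuous_on UNIV a}"

text \<open>A Hilbert module over \<open>C(K)\<close> together with a left action of \<open>C(K)\<close>;
  the inner product is linear in its second argument.\<close>

record ('k, 'y) hmod =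
  carr :: "'y set"
  add :: "'y \<Rightarrow> 'y \<Rightarrow> 'y"
  scale :: "complex \<Rightarrow> 'y \<Rightarrow> 'y"
  lact :: "('k \<Rightarrow> complex) \<Rightarrow> 'y \<Rightarrow> 'y"
  ract :: "'y \<Rightarrow> ('k \<Rightarrow> complex) \<Rightarrow> 'y"
  inner_A :: "'y \<Rightarrow> 'y \<Rightarrow> 'k \<Rightarrow> complex"

definition hnorm :: "('k, 'y) hmod \<Rightarrow> 'y \<Rightarrow> real" where
  "hnorm Y x = sqrt (SUP k. cmod (inner_A Y x x k))"

record 'b cstar =
  acarr :: "'b set"
  aadd :: "'b \<Rightarrow> 'b \<Rightarrow> 'b"
  ascale :: "complex \<Rightarrow> 'b \<Rightarrow> 'b"
  amult :: "'b \<Rightarrow> 'b \<Rightarrow> 'b"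
  astar :: "'b \<Rightarrow> 'b"
  anorm :: "'b \<Rightarrow> real"

definition adiff :: "'b cstar \<Rightarrow> 'b \<Rightarrow> 'b \<Rightarrow> 'b" where
  "adiff B S T = aadd B S (ascale B (- 1) T)"

definition is_adjoint :: "('k, 'y) hmod \<Rightarrow> ('y \<Rightarrow> 'y) \<Rightarrow> ('y \<Rightarrow> 'y) \<Rightarrow> bool" where
  "is_adjoint Y T S \<longleftrightarrow>
     S \<in> carr Y \<rightarrow>\<^sub>E carr Y \<and>
     (\<forall>x\<in>carr Y. \<forall>y\<in>carr Y. inner_A Y (T x) y = inner_A Y x (S y))"

definition adjointables :: "('k, 'y) hmod \<Rightarrow> ('y \<Rightarrow> 'y) cstar" where
  "adjointables Y =
     \<lparr> acarr = {T \<in> carr Y \<rightarrow>\<^sub>E carr Y. \<exists>S. is_adjoint Y T S},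
       aadd = (\<lambda>S T. \<lambda>x\<in>carr Y. add Y (S x) (T x)),
       ascale = (\<lambda>c T. \<lambda>x\<in>carr Y. scale Y c (T x)),
       amult = (\<lambda>S T. compose (carr Y) S T),
       astar = (\<lambda>T. THE S. is_adjoint Y T S),
       anorm = (\<lambda>T. SUP x\<in>{x \<in> carr Y. hnorm Y x \<le> 1}. hnorm Y (T x)) \<rparr>"

definition closed_star_subalgebra :: "'b cstar \<Rightarrow> 'b set \<Rightarrow> bool" where
  "closed_star_subalgebra B D \<longleftrightarrow>
     D \<subseteq> acarr B \<and> D \<noteq> {} \<and>
     (\<forall>S\<in>D. \<forall>T\<in>D. aadd B S T \<in> D \<and> amult B S T \<in> D) \<and>
     (\<forall>c. \<forall>T\<in>D. ascale B c T \<in> D) \<and> (\<forall>T\<in>D. astar B T \<in> D) \<and>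
     (\<forall>T\<in>acarr B. (\<forall>e>0. \<exists>S\<in>D. anorm B (adiff B T S) < e) \<longrightarrow> T \<in> D)"

definition cstar_generated :: "'b cstar \<Rightarrow> 'b set \<Rightarrow> 'b set" where
  "cstar_generated B G = \<Inter> {D. closed_star_subalgebra B D \<and> G \<subseteq> D}"

definition theta :: "('k, 'y) hmod \<Rightarrow> 'y \<Rightarrow> 'y \<Rightarrow> 'y \<Rightarrow> 'y" where
  "theta Y x y = (\<lambda>z\<in>carr Y. ract Y x (inner_A Y y z))"

definition compacts :: "('k, 'y) hmod \<Rightarrow> ('y \<Rightarrow> 'y) set" where
  "compacts Y = cstar_generated (adjointables Y) {theta Y x y | x y. x \<in> carr Y \<and> y \<in> carr Y}"

definition left_op :: "('k, 'y) hmod \<Rightarrow> ('k \<Rightarrow> complex) \<Rightarrow> 'y \<Rightarrow> 'y" where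
  "left_op Y a = (\<lambda>z\<in>carr Y. lact Y a z)"


section \<open>Tensor powers\<close>

text \<open>A pair \<open>([x\<^sub>1, \<dots>, x\<^sub>n], b)\<close> stands for the elementary tensor
  \<open>x\<^sub>1 \<otimes> \<dots> \<otimes> x\<^sub>n \<cdot> b\<close>, and a list of such pairs for the sum of its entries. The trailing
  coefficient \<open>b\<close> in \<open>C(K)\<close> changes nothing for \<open>n \<ge> 1\<close> and makes the \<open>0\<close>-th power equal to
  \<open>C(K)\<close>, with \<open>([], b)\<close> standing for \<open>b\<close>. The \<open>n\<close>-th tensor power is the completion of the
  space of these sums for the usual inner product, which is given on elementary tensors by
  \<open>(x \<otimes> \<xi> | y \<otimes> \<eta>) = (\<xi> | (x | y) \<cdot> \<eta>)\<close>. The tensor relations (bilinearity and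
  \<open>x \<cdot> a \<otimes> y = x \<otimes> a \<cdot> y\<close>) hold because sums at distance \<open>0\<close> are identified.\<close>

type_synonym ('k, 'x) tsum = "('x list \<times> ('k \<Rightarrow> complex)) list"

definition tsums :: "('k::topological_space, 'x) hmod \<Rightarrow> nat \<Rightarrow> ('k, 'x) tsum set" where
  "tsums X n = {u. \<forall>(xs, b)\<in>set u. length xs = n \<and> set xs \<subseteq> carr X \<and> b \<in> cont_fun}"

text \<open>\<open>list_inner X a [x\<^sub>1, \<dots>, x\<^sub>n] [y\<^sub>1, \<dots>, y\<^sub>n] = (x\<^sub>1 \<otimes> \<dots> \<otimes> x\<^sub>n | a \<cdot> (y\<^sub>1 \<otimes> \<dots> \<otimes> y\<^sub>n))\<close>\<close>

fun list_inner ::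
  "('k, 'x) hmod \<Rightarrow> ('k \<Rightarrow> complex) \<Rightarrow> 'x list \<Rightarrow> 'x list \<Rightarrow> 'k \<Rightarrow> complex" where
  "list_inner X a [] [] = a"
| "list_inner X a (x # xs) (y # ys) = list_inner X (inner_A X x (lact X a y)) xs ys"
| "list_inner X a _ _ = (\<lambda>_. 0)"

definition tsum_inner :: "('k, 'x) hmod \<Rightarrow> ('k, 'x) tsum \<Rightarrow> ('k, 'x) tsum \<Rightarrow> 'k \<Rightarrow> complex" where
  "tsum_inner X u v = (\<lambda>k.
     \<Sum>(xs, b)\<leftarrow>u. \<Sum>(ys, c)\<leftarrow>v. cnj (b k) * list_inner X (\<lambda>_. 1) xs ys k * c k)"

definition tsum_scale :: "complex \<Rightarrow> ('k, 'x) tsum \<Rightarrow> ('k, 'x) tsum" where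
  "tsum_scale c = map (\<lambda>(xs, b). (xs, \<lambda>k. c * b k))"

definition tsum_ract :: "('k, 'x) tsum \<Rightarrow> ('k \<Rightarrow> complex) \<Rightarrow> ('k, 'x) tsum" where
  "tsum_ract u a = map (\<lambda>(xs, b). (xs, \<lambda>k. b k * a k)) u"

definition tsum_lact :: "('k, 'x) hmod \<Rightarrow> ('k \<Rightarrow> complex) \<Rightarrow> ('k, 'x) tsum \<Rightarrow> ('k, 'x) tsum" where
  "tsum_lact X a = map (\<lambda>(xs, b).
     case xs of [] \<Rightarrow> ([], \<lambda>k. a k * b k) | x # xs' \<Rightarrow> (lact X a x # xs', b))"

definition tsum_dist :: "('k, 'x) hmod \<Rightarrow> ('k, 'x) tsum \<Rightarrow> ('k, 'x) tsum \<Rightarrow> real" where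
  "tsum_dist X u v =
     (let w = u @ tsum_scale (- 1) v in sqrt (SUP k. cmod (tsum_inner X w w k)))"

type_synonym ('k, 'x) tensor = "(nat \<Rightarrow> ('k, 'x) tsum) set"

abbreviation tclass ::
  "('k::topological_space, 'x) hmod \<Rightarrow> nat \<Rightarrow> (nat \<Rightarrow> ('k, 'x) tsum) \<Rightarrow> ('k, 'x) tensor" where
  "tclass X n \<equiv> seq_class (tsums X n) (tsum_dist X)"

definition tpower :: "('k::topological_space, 'x) hmod \<Rightarrow> nat \<Rightarrow> ('k, ('k, 'x) tensor) hmod" where
  "tpower X n =
     \<lparr> carr = completion (tsums X n) (tsum_dist X),
       add = (\<lambda>P Q. tclass X n (\<lambda>m. rep P m @ rep Q m)),
       scale = (\<lambda>c P. tclass X n (\<lambda>m. tsum_scale c (rep P m))),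
       lact = (\<lambda>a P. tclass X n (\<lambda>m. tsum_lact X a (rep P m))),
       ract = (\<lambda>P a. tclass X n (\<lambda>m. tsum_ract (rep P m) a)),
       inner_A = (\<lambda>P Q k. lim (\<lambda>m. tsum_inner X (rep P m) (rep Q m) k)) \<rparr>"

text \<open>\<open>(x\<^sub>1 \<otimes> \<dots> \<otimes> x\<^sub>n \<cdot> b) \<otimes> x = x\<^sub>1 \<otimes> \<dots> \<otimes> x\<^sub>n \<otimes> (b \<cdot> x)\<close>\<close>

definition tensor_right ::
  "('k::topological_space, 'x) hmod \<Rightarrow> nat \<Rightarrow> ('k, 'x) tensor \<Rightarrow> 'x \<Rightarrow> ('k, 'x) tensor" where
  "tensor_right X n P x =
     tclass X (Suc n) (\<lambda>m. map (\<lambda>(xs, b). (xs @ [lact X b x], \<lambda>_. 1)) (rep P m))"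

text \<open>\<open>T \<otimes> I\<close> is determined by its values \<open>T P \<otimes> x\<close> at the tensors \<open>P \<otimes> x\<close>, whose span is
  dense in the \<open>(n+1)\<close>-st power.\<close>

definition tensor_id ::
  "('k::topological_space, 'x) hmod \<Rightarrow> nat \<Rightarrow> (('k, 'x) tensor \<Rightarrow> ('k, 'x) tensor) \<Rightarrow>
     ('k, 'x) tensor \<Rightarrow> ('k, 'x) tensor" where
  "tensor_id X n T =
     (THE S. S \<in> acarr (adjointables (tpower X (Suc n))) \<and>
        (\<forall>P\<in>carr (tpower X n). \<forall>x\<in>carr X.
           S (tensor_right X n P x) = tensor_right X n (T P) x))"


section \<open>Inductive limits\<close>

text \<open>For *-homomorphisms \<open>e n\<close> from \<open>B n\<close> to \<open>B (n+1)\<close>, \<open>lift_by e n k\<close> maps \<open>B n\<close> to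
  \<open>B (n+k)\<close>. The union of the \<open>B n\<close> is represented by pairs \<open>(n, T)\<close>; the pseudometric
  identifies \<open>(n, T)\<close> with \<open>(n+1, e n T)\<close> when the \<open>e n\<close> are isometric.\<close>

primrec lift_by :: "(nat \<Rightarrow> 'b \<Rightarrow> 'b) \<Rightarrow> nat \<Rightarrow> nat \<Rightarrow> 'b \<Rightarrow> 'b" where
  "lift_by e n 0 T = T"
| "lift_by e n (Suc k) T = e (n + k) (lift_by e n k T)"

definition level_op ::
  "(nat \<Rightarrow> 'b \<Rightarrow> 'b) \<Rightarrow> (nat \<Rightarrow> 'b \<Rightarrow> 'b \<Rightarrow> 'c) \<Rightarrow> nat \<times> 'b \<Rightarrow> nat \<times> 'b \<Rightarrow> nat \<times> 'c" where
  "level_op e f p q =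
     (let k = max (fst p) (fst q) in
       (k, f k (lift_by e (fst p) (k - fst p) (snd p)) (lift_by e (fst q) (k - fst q) (snd q))))"

definition level_dist ::
  "(nat \<Rightarrow> 'b cstar) \<Rightarrow> (nat \<Rightarrow> 'b \<Rightarrow> 'b) \<Rightarrow> nat \<times> 'b \<Rightarrow> nat \<times> 'b \<Rightarrow> real" where
  "level_dist B e p q = snd (level_op e (\<lambda>k S T. anorm (B k) (adiff (B k) S T)) p q)"

abbreviation limit_class ::
  "(nat \<Rightarrow> 'b cstar) \<Rightarrow> (nat \<Rightarrow> 'b \<Rightarrow> 'b) \<Rightarrow> (nat \<Rightarrow> nat \<times> 'b) \<Rightarrow> (nat \<Rightarrow> nat \<times> 'b) set" where
  "limit_class B e \<equiv> seq_class (SIGMA n:UNIV. acarr (B n)) (level_dist B e)"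

definition cstar_limit ::
  "(nat \<Rightarrow> 'b cstar) \<Rightarrow> (nat \<Rightarrow> 'b \<Rightarrow> 'b) \<Rightarrow> (nat \<Rightarrow> nat \<times> 'b) set cstar" where
  "cstar_limit B e =
     \<lparr> acarr = completion (SIGMA n:UNIV. acarr (B n)) (level_dist B e),
       aadd = (\<lambda>P Q. limit_class B e (\<lambda>m. level_op e (\<lambda>k. aadd (B k)) (rep P m) (rep Q m))),
       ascale = (\<lambda>c P. limit_class B e
          (\<lambda>m. (fst (rep P m), ascale (B (fst (rep P m))) c (snd (rep P m))))),
       amult = (\<lambda>P Q. limit_class B e (\<lambda>m. level_op e (\<lambda>k. amult (B k)) (rep P m) (rep Q m))),
       astar = (\<lambda>P. limit_class B e
          (\<lambda>m. (fst (rep P m), astar (B (fst (rep P m))) (snd (rep P m))))),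
       anorm = (\<lambda>P. lim (\<lambda>m. anorm (B (fst (rep P m))) (snd (rep P m)))) \<rparr>"

definition limit_embed ::
  "(nat \<Rightarrow> 'b cstar) \<Rightarrow> (nat \<Rightarrow> 'b \<Rightarrow> 'b) \<Rightarrow> nat \<Rightarrow> 'b \<Rightarrow> (nat \<Rightarrow> nat \<times> 'b) set" where
  "limit_embed B e n T = limit_class B e (\<lambda>_. (n, T))"


section \<open>The core of the algebra of a self-similar map\<close>

definition cograph :: "nat \<Rightarrow> (nat \<Rightarrow> 'k \<Rightarrow> 'k) \<Rightarrow> ('k \<times> 'k) set" where
  "cograph N \<gamma> = (\<Union>j\<in>{1..N}. {(\<gamma> j y, y) | y. True})"

text \<open>Functions on the cograph are extended by \<open>0\<close> to \<open>K \<times> K\<close>.\<close>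

definition bimodule ::
  "nat \<Rightarrow> (nat \<Rightarrow> 'k::topological_space \<Rightarrow> 'k) \<Rightarrow> ('k, 'k \<times> 'k \<Rightarrow> complex) hmod" where
  "bimodule N \<gamma> =
     \<lparr> carr = {f. continuous_on (cograph N \<gamma>) f \<and> (\<forall>p. p \<notin> cograph N \<gamma> \<longrightarrow> f p = 0)},
       add = (\<lambda>f g p. f p + g p),
       scale = (\<lambda>c f p. c * f p),
       lact = (\<lambda>a f p. a (fst p) * f p),
       ract = (\<lambda>f b p. f p * b (snd p)),
       inner_A = (\<lambda>f g y. \<Sum>j=1..N. cnj (f (\<gamma> j y, y)) * g (\<gamma> j y, y)) \<rparr>"

type_synonym 'k btensor = "('k, 'k \<times> 'k \<Rightarrow> complex) tensor"
type_synonym 'k bop = "'k btensor \<Rightarrow> 'k btensor"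
type_synonym 'k core_elt = "(nat \<Rightarrow> nat \<times> 'k bop) set"

abbreviation bpower ::
  "nat \<Rightarrow> (nat \<Rightarrow> 'k::topological_space \<Rightarrow> 'k) \<Rightarrow> nat \<Rightarrow> ('k, 'k btensor) hmod" where
  "bpower N \<gamma> n \<equiv> tpower (bimodule N \<gamma>) n"

primrec asum :: "'b cstar \<Rightarrow> (nat \<Rightarrow> 'b) \<Rightarrow> nat \<Rightarrow> 'b" where
  "asum B T 0 = T 0"
| "asum B T (Suc n) = aadd B (asum B T n) (T (Suc n))"

definition core_level :: "nat \<Rightarrow> (nat \<Rightarrow> 'k::topological_space \<Rightarrow> 'k) \<Rightarrow> nat \<Rightarrow> 'k bop set" where
  "core_level N \<gamma> n =
     {asum (adjointables (bpower N \<gamma> n))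
        (\<lambda>i. lift_by (tensor_id (bimodule N \<gamma>)) i (n - i) (T i)) n | T.
        T 0 \<in> left_op (bpower N \<gamma> 0) ` cont_fun \<and> (\<forall>i\<in>{1..n}. T i \<in> compacts (bpower N \<gamma> i))}"

definition core_level_alg ::
  "nat \<Rightarrow> (nat \<Rightarrow> 'k::topological_space \<Rightarrow> 'k) \<Rightarrow> nat \<Rightarrow> 'k bop cstar" where
  "core_level_alg N \<gamma> n = (adjointables (bpower N \<gamma> n)) \<lparr> acarr := core_level N \<gamma> n \<rparr>"

definition core :: "nat \<Rightarrow> (nat \<Rightarrow> 'k::topological_space \<Rightarrow> 'k) \<Rightarrow> 'k core_elt cstar" where
  "core N \<gamma> = cstar_limit (core_level_alg N \<gamma>) (tensor_id (bimodule N \<gamma>))"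

definition core_embed ::
  "nat \<Rightarrow> (nat \<Rightarrow> 'k::topological_space \<Rightarrow> 'k) \<Rightarrow> nat \<Rightarrow> 'k bop \<Rightarrow> 'k core_elt" where
  "core_embed N \<gamma> = limit_embed (core_level_alg N \<gamma>) (tensor_id (bimodule N \<gamma>))"

definition core_fun ::
  "nat \<Rightarrow> (nat \<Rightarrow> 'k::topological_space \<Rightarrow> 'k) \<Rightarrow> ('k \<Rightarrow> complex) \<Rightarrow> 'k core_elt" where
  "core_fun N \<gamma> a = core_embed N \<gamma> 0 (left_op (bpower N \<gamma> 0) a)"


section \<open>Traces\<close>

text \<open>Functionals are extensional, so that two of them are equal iff they agree on the algebra.\<close>

definition finite_trace :: "'b cstar \<Rightarrow> ('b \<Rightarrow> complex) \<Rightarrow> bool" where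
  "finite_trace B \<tau> \<longleftrightarrow>
     \<tau> \<in> extensional (acarr B) \<and>
     (\<forall>S\<in>acarr B. \<forall>T\<in>acarr B. \<tau> (aadd B S T) = \<tau> S + \<tau> T) \<and>
     (\<forall>c. \<forall>T\<in>acarr B. \<tau> (ascale B c T) = c * \<tau> T) \<and>
     (\<exists>M. \<forall>T\<in>acarr B. cmod (\<tau> T) \<le> M * anorm B T) \<and>
     (\<forall>T\<in>acarr B. \<tau> (amult B (astar B T) T) \<in> \<real>\<^sub>\<ge>\<^sub>0) \<and>
     (\<forall>S\<in>acarr B. \<forall>T\<in>acarr B. \<tau> (amult B S T) = \<tau> (amult B T S))"

definition tracial_state_on_core ::
  "nat \<Rightarrow> (nat \<Rightarrow> 'k::topological_space \<Rightarrow> 'k) \<Rightarrow> ('k core_elt \<Rightarrow> complex) \<Rightarrow> bool" where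
  "tracial_state_on_core N \<gamma> \<sigma> \<longleftrightarrow>
     finite_trace (core N \<gamma>) \<sigma> \<and> \<sigma> (core_fun N \<gamma> (\<lambda>_. 1)) = 1"

definition is_hutchinson_measure ::
  "nat \<Rightarrow> (nat \<Rightarrow> 'k::topological_space \<Rightarrow> 'k) \<Rightarrow> 'k measure \<Rightarrow> bool" where
  "is_hutchinson_measure N \<gamma> \<mu> \<longleftrightarrow>
     sets \<mu> = sets borel \<and> emeasure \<mu> (space \<mu>) = 1 \<and>
     (\<forall>a\<in>cont_fun. (\<integral>x. a x \<partial>\<mu>) = (1 / of_nat N) * (\<Sum>j=1..N. \<integral>x. a (\<gamma> j x) \<partial>\<mu>))"

definition hutchinson_measure :: "nat \<Rightarrow> (nat \<Rightarrow> 'k::topological_space \<Rightarrow> 'k) \<Rightarrow> 'k measure" where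
  "hutchinson_measure N \<gamma> = (THE \<mu>. is_hutchinson_measure N \<gamma> \<mu>)"

definition tau_infinity ::
  "nat \<Rightarrow> (nat \<Rightarrow> 'k::topological_space \<Rightarrow> 'k) \<Rightarrow> 'k core_elt \<Rightarrow> complex" where
  "tau_infinity N \<gamma> =
     (THE \<tau>. finite_trace (core N \<gamma>) \<tau> \<and>
        (\<forall>a\<in>cont_fun. \<tau> (core_fun N \<gamma> a) = (\<integral>k. a k \<partial>hutchinson_measure N \<gamma>)) \<and>
        (\<forall>i\<ge>1. \<forall>x\<in>carr (bpower N \<gamma> i). \<forall>y\<in>carr (bpower N \<gamma> i).
           \<tau> (core_embed N \<gamma> i (theta (bpower N \<gamma> i) x y)) =
             (1 / of_nat N ^ i) * (\<integral>k. inner_A (bpower N \<gamma> i) y x k \<partial>hutchinson_measure N \<gamma>)))"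

text \<open>\<open>\<mu>\<close> is the Borel measure on \<open>K\<close> given by the restriction of \<open>\<sigma>\<close> to \<open>C(K)\<close>.\<close>

definition restriction_measure ::
  "nat \<Rightarrow> (nat \<Rightarrow> 'k::topological_space \<Rightarrow> 'k) \<Rightarrow> ('k core_elt \<Rightarrow> complex) \<Rightarrow> 'k measure \<Rightarrow> bool" where
  "restriction_measure N \<gamma> \<sigma> \<mu> \<longleftrightarrow>
     sets \<mu> = sets borel \<and> finite_measure \<mu> \<and>
     (\<forall>a\<in>cont_fun. \<sigma> (core_fun N \<gamma> a) = (\<integral>x. a x \<partial>\<mu>))"

end

theory Submission
  imports Defs
begin

text \<open>
  The common left inverse \<open>h\<close> of the branches turns the cograph into the
  graph of \<open>h\<close>, so that \<open>X\<close> is \<open>C(K)\<close> with the right action \<open>f \<cdot> b = f (b \<circ> h)\<close>. In the same way the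
  \<open>n\<close>-th tensor power is \<open>C(K)\<close> with \<open>f \<cdot> b = f (b \<circ> h\<^sup>n)\<close>: the tensor \<open>x\<^sub>1 \<otimes> \<dots> \<otimes> x\<^sub>n \<cdot> b\<close> becomes the
  function \<open>p \<mapsto> x\<^sub>1(p, h p) \<cdots> x\<^sub>n(h\<^sup>n\<^sup>-\<^sup>1 p, h\<^sup>n p) b(h\<^sup>n p)\<close>, and \<open>(f | g)(y)\<close> is the sum of
  \<open>cnj f \<cdot> g\<close> over the fibre of \<open>h\<^sup>n\<close> over \<open>y\<close>, counted by words \<open>w\<close> of length \<open>n\<close>
  (\<open>tsum_inner_eq\<close>, \<open>carr_bpower\<close>). Since \<open>C(K)\<close> is complete for the supremum norm, completing the
  tensor power adds nothing new. In this picture \<open>T \<otimes> I\<close> acts on functions exactly as \<open>T\<close> does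
  (\<open>tensor_id_op\<close>), and the operator norm of \<open>T\<close> is the same at all levels (\<open>opnorm_mono_level\<close>).
  The core is therefore the completion of an increasing union of spaces of operators on \<open>C(K)\<close>, and
  a finite trace is determined by its values at functions and at rank-one operators (\<open>trace_eqI\<close>).

  Let \<open>\<sigma>\<close> be a tracial state whose restriction to \<open>C(K)\<close> is integration against \<open>\<mu>\<close>, and let
  \<open>(L b)(y)\<close> be the sum of the values of \<open>b\<close> at \<open>\<gamma>\<^sub>1 y, \<dots>, \<gamma>\<^sub>N y\<close>. By the trace property, \<open>\<sigma>\<close> of the
  rank-one operator \<open>\<theta>\<^sub>f\<^sub>,\<^sub>g\<close> depends only on \<open>(g | f)\<close>: it is \<open>\<psi>\<^sub>n (g | f)\<close> for a positive functional
  \<open>\<psi>\<^sub>n\<close> on \<open>C(K)\<close>, and \<open>\<psi>\<^sub>0\<close> is integration against \<open>\<mu>\<close> (\<open>trace_rank1\<close>). Two relations link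
  consecutive levels.
  \<^item> For \<open>b \<ge> 0\<close> one has \<open>\<psi>\<^sub>n\<^sub>+\<^sub>1(L b) \<le> N \<psi>\<^sub>n(b)\<close>, because \<open>N\<^sup>-\<^sup>1 \<theta>\<^sub>1\<^sub>,\<^sub>1\<close> is a projection in \<open>K(X)\<close> and lies below
    the identity (\<open>psi_Suc_le\<close>). Iterating this, \<open>\<psi>\<^sub>n(b) \<le> \<integral> b \<circ> h\<^sup>n d\<mu>\<close>.
  \<^item> If \<open>a\<close> vanishes near the branch set, then \<open>\<psi>\<^sub>n(a) = \<psi>\<^sub>n\<^sub>+\<^sub>1(L a)\<close>. Away from the branch set \<open>h\<close> is
    locally injective, so that multiplication by \<open>a\<close> on \<open>X\<close> is a finite sum of rank-one operators
    supported in small sets (\<open>psi_Suc_off_branch\<close>).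

  The set of points that \<open>h\<^sup>n\<close> maps into the branch set is finite, hence null for \<open>\<mu>\<close>, and so the
  first relation shows that \<open>\<psi>\<^sub>n\<close> is small on functions concentrated near the branch set. The
  second relation then extends to all \<open>a \<in> C(K)\<close> (\<open>psi_Suc\<close>), whence \<open>\<psi>\<^sub>n = \<psi>\<^sub>n\<^sub>+\<^sub>k \<circ> L\<^sup>k\<close>. As the
  branches are contractions, \<open>N\<^sup>-\<^sup>k L\<^sup>k a\<close> is almost constant for a large \<open>k\<close>
  (\<open>fibre_sum_oscillation\<close>). Hence \<open>\<psi>\<^sub>n(a) = N\<^sup>-\<^sup>n \<integral> a d\<mu>\<close>, the measure \<open>\<mu>\<close> is the Hutchinson
  measure, and \<open>\<sigma>\<close> has the values that characterise \<open>\<tau>\<^sup>(\<^sup>\<infinity>\<^sup>)\<close>.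
\<close>


section \<open>Preliminaries from analysis\<close>

text \<open>By Baire's theorem one of the closed sets on which the whole family is bounded by \<open>k\<close> contains a
  ball. Linearity turns a bound on a ball into a bound in terms of the norm.\<close>

lemma uniform_boundedness:
  fixes \<phi> :: "'i \<Rightarrow> 'b::{real_normed_vector,complete_space} \<Rightarrow> 'c::real_normed_vector"
  assumes lin: "\<And>i. bounded_linear (\<phi> i)"
    and pointwise: "\<And>x. \<exists>c. \<forall>i. norm (\<phi> i x) \<le> c"
  shows "\<exists>c. \<forall>i x. norm (\<phi> i x) \<le> c * norm x"
proof -
  define F where "F k = {x. \<forall>i. norm (\<phi> i x) \<le> real k}" for k :: nat
  have closed_F: "closed (F k)" for k
  proof -
    have "F k = (\<Inter>i. {x. norm (\<phi> i x) \<le> real k})"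
      by (auto simp: F_def)
    moreover have "closed {x. norm (\<phi> i x) \<le> real k}" for i
      by (intro closed_Collect_le continuous_intros linear_continuous_on lin)
    ultimately show ?thesis by auto
  qed
  have cover: "\<Union> (range F) = UNIV"
  proof -
    have "\<exists>k. x \<in> F k" for x
    proof -
      obtain c where "\<forall>i. norm (\<phi> i x) \<le> c" using pointwise by blast
      moreover obtain k :: nat where "c \<le> real k" using real_arch_simple by blast
      ultimately have "x \<in> F k" unfolding F_def using order_trans by blast
      then show ?thesis ..
    qed
    then show ?thesis by auto
  qed
  have "\<exists>k. interior (F k) \<noteq> {}"
  proof (rule ccontr)
    assume "\<not> ?thesis"
    then have "(euclidean :: 'b topology) interior_of \<Union> (range F) = {}"
      using closed_F
      by (intro Baire_category_alt) (auto simp: completely_metrizable_space_euclidean)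
    then show False using cover by simp
  qed
  then obtain k x\<^sub>0 where "x\<^sub>0 \<in> interior (F k)" by auto
  then obtain e where e: "e > 0" "cball x\<^sub>0 e \<subseteq> F k"
    by (meson mem_interior_cball)
  have small: "norm (\<phi> i x) \<le> 2 * real k" if "norm x \<le> e" for i x
  proof -
    have "x\<^sub>0 + x \<in> F k" "x\<^sub>0 \<in> F k"
      using e that by (auto simp: dist_norm subset_iff)
    then have "norm (\<phi> i (x\<^sub>0 + x)) \<le> real k" "norm (\<phi> i x\<^sub>0) \<le> real k"
      by (auto simp: F_def)
    moreover have "\<phi> i x = \<phi> i (x\<^sub>0 + x) - \<phi> i x\<^sub>0"
      using bounded_linear.axioms(1)[OF lin[of i]] by (simp add: linear_add)
    ultimately show ?thesis
      using norm_triangle_ineq4[of "\<phi> i (x\<^sub>0 + x)" "\<phi> i x\<^sub>0"] by simp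
  qed
  have "norm (\<phi> i x) \<le> (2 * real k / e) * norm x" for i x
  proof (cases "x = 0")
    case True
    then show ?thesis
      using bounded_linear.axioms(1)[OF lin[of i]] by (simp add: linear_0)
  next
    case False
    define t where "t = e / norm x"
    have t: "t > 0" using False e by (simp add: t_def)
    have "norm (\<phi> i (t *\<^sub>R x)) \<le> 2 * real k"
      using False e by (intro small) (simp add: t_def)
    then have "t * norm (\<phi> i x) \<le> 2 * real k"
      using bounded_linear.axioms(1)[OF lin[of i]] t by (simp add: linear_scale)
    then show ?thesis
      using t False e by (simp add: t_def field_simps)
  qed
  then show ?thesis by blast
qed


lemma tendsto_0_upper:
  fixes u v :: "nat \<Rightarrow> real"
  assumes "\<And>m. 0 \<le> u m" "\<And>m. u m \<le> v m" "v \<longlonglongrightarrow> 0"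
  shows "u \<longlonglongrightarrow> 0"
  by (rule tendsto_sandwich[of "\<lambda>_. 0" u _ v]) (use assms in auto)

lemma uniform_limit_diff_0_iff:
  fixes f g :: "nat \<Rightarrow> 'a \<Rightarrow> complex"
  assumes "uniform_limit S f l sequentially"
  shows "uniform_limit S (\<lambda>m p. f m p - g m p) (\<lambda>_. 0) sequentially \<longleftrightarrow> uniform_limit S g l sequentially"
proof
  assume "uniform_limit S (\<lambda>m p. f m p - g m p) (\<lambda>_. 0) sequentially"
  from uniform_limit_minus[OF assms this] show "uniform_limit S g l sequentially" by simp
next
  assume "uniform_limit S g l sequentially"
  from uniform_limit_minus[OF assms this]
  show "uniform_limit S (\<lambda>m p. f m p - g m p) (\<lambda>_. 0) sequentially" by simp
qed

lemma nonneg_complex_cancel: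
  "complex_of_real c * x \<in> \<real>\<^sub>\<ge>\<^sub>0 \<Longrightarrow> c > 0 \<Longrightarrow> x \<in> \<real>\<^sub>\<ge>\<^sub>0"
  by (auto simp: complex_nonneg_Reals_iff zero_le_mult_iff)

lemma sum_atMost_split: "(\<Sum>i\<le>n. F i) = F 0 + (\<Sum>i=1..n. F (i::nat))" for F :: "nat \<Rightarrow> complex"
  by (simp add: atMost_atLeast0 sum.atLeast_Suc_atMost)

text \<open>The squares sum to \<open>1\<close>, and each member of the family is supported in a set of diameter at most
  \<open>\<delta>\<close>: it cannot be nonzero at two points of distance at least \<open>\<delta>\<close>.\<close>

lemma square_partition_of_unity:
  fixes \<delta> :: real
  assumes compact: "compact (UNIV :: 'k::metric_space set)" and \<delta>: "\<delta> > 0"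
  obtains F :: "'k::metric_space set" and v :: "'k::metric_space \<Rightarrow> 'k \<Rightarrow> real" where "finite F"
    "\<And>i. continuous_on UNIV (v i)" "\<And>p. (\<Sum>i\<in>F. (v i p)\<^sup>2) = 1"
    "\<And>i p q. dist p q \<ge> \<delta> \<Longrightarrow> v i p * v i q = 0"
proof -
  have "x \<in> ball x (\<delta> / 2)" for x :: 'k using \<delta> by simp
  then have cov: "UNIV \<subseteq> (\<Union>x\<in>(UNIV :: 'k set). ball x (\<delta> / 2))" by blast
  obtain F :: "'k set" where F: "F \<subseteq> UNIV" "finite F" "UNIV \<subseteq> (\<Union>x\<in>F. ball x (\<delta> / 2))"
    by (rule compactE_image[OF compact open_ball cov])
  define u where "u i p = max 0 (\<delta> / 2 - dist i p)" for i p :: 'k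
  define s where "s p = (\<Sum>i\<in>F. u i p)" for p
  define v where "v i p = sqrt (u i p / s p)" for i p
  have pos: "s p > 0" for p
  proof -
    have "p \<in> (\<Union>x\<in>F. ball x (\<delta> / 2))" using F(3) by blast
    then obtain x where x: "x \<in> F" "dist x p < \<delta> / 2" by auto
    have "0 < u x p" using x by (simp add: u_def)
    also have "\<dots> \<le> s p"
      unfolding s_def using x F(2) by (intro member_le_sum) (auto simp: u_def)
    finally show ?thesis .
  qed
  have "continuous_on UNIV (u i)" for i unfolding u_def by (intro continuous_intros)
  moreover have "continuous_on UNIV s"
    unfolding s_def using \<open>\<And>i. continuous_on UNIV (u i)\<close> by (intro continuous_intros)
  ultimately have "continuous_on UNIV (v i)" for i
    unfolding v_def using pos by (intro continuous_intros) (auto simp: less_imp_neq[symmetric])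
  moreover have "(\<Sum>i\<in>F. (v i p)\<^sup>2) = 1" for p
  proof -
    have "(v i p)\<^sup>2 = u i p / s p" for i
      unfolding v_def using pos[of p] by (intro real_sqrt_pow2) (simp add: u_def)
    then have "(\<Sum>i\<in>F. (v i p)\<^sup>2) = s p / s p"
      by (simp add: s_def flip: sum_divide_distrib)
    then show ?thesis using pos[of p] by simp
  qed
  moreover have "v i p * v i q = 0" if "dist p q \<ge> \<delta>" for i p q
  proof -
    have "dist p q \<le> dist i p + dist i q" by (metis dist_commute dist_triangle)
    then have "u i p = 0 \<or> u i q = 0" using that by (auto simp: u_def)
    then show ?thesis by (auto simp: v_def)
  qed
  ultimately show ?thesis by (rule that[OF F(2)])
qed


section \<open>Sums over the fibres of the iterated shift\<close>

type_synonym 'k fun_op = "('k \<Rightarrow> complex) \<Rightarrow> 'k \<Rightarrow> complex"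

text \<open>The map \<open>h\<close> plays the role of a shift that undoes every branch. Because the images of the
  branches cover \<open>K\<close>, the fibre of \<open>h\<close> over \<open>y\<close> consists of the points \<open>\<gamma> j y\<close>.\<close>

locale self_similar_system =
  fixes N :: nat and \<gamma> :: "nat \<Rightarrow> 'k::metric_space \<Rightarrow> 'k" and h :: "'k \<Rightarrow> 'k"
  assumes compact_space: "compact (UNIV :: 'k set)"
    and self_similar: "self_similar_map N \<gamma>"
    and h_cont: "continuous_on UNIV h"
    and h_inverse: "\<And>j y. j \<in> {1..N} \<Longrightarrow> h (\<gamma> j y) = y"
begin

lemma cover: "\<exists>j\<in>{1..N}. x = \<gamma> j (h x)"
proof -
  have "x \<in> (\<Union>j\<in>{1..N}. range (\<gamma> j))"
    using self_similar by (auto simp: self_similar_map_def)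
  then show ?thesis using h_inverse by auto
qed

lemma N_pos: "N \<ge> 1"
  using cover by fastforce

lemma gamma_contraction:
  assumes "j \<in> {1..N}"
  obtains c where "0 < c" "c < 1" "\<And>x y. dist (\<gamma> j x) (\<gamma> j y) \<le> c * dist x y"
  using self_similar assms
  unfolding self_similar_map_def proper_contraction_def by (meson less_le_trans)

lemma gamma_cont:
  assumes "j \<in> {1..N}"
  shows "continuous_on UNIV (\<gamma> j)"
proof -
  obtain c where "0 < c" "c < 1" "\<And>x y. dist (\<gamma> j x) (\<gamma> j y) \<le> c * dist x y"
    using gamma_contraction[OF assms] by blast
  then have "c-lipschitz_on UNIV (\<gamma> j)"
    by (intro lipschitz_onI) auto
  then show ?thesis by (rule lipschitz_on_continuous_on)
qed

definition words :: "nat \<Rightarrow> nat list set" where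
  "words n = {w. set w \<subseteq> {1..N} \<and> length w = n}"

lemma finite_words [simp, intro]: "finite (words n)"
  unfolding words_def by (rule finite_lists_length_eq) simp

lemma card_words: "card (words n) = N ^ n"
  unfolding words_def by (subst card_lists_length_eq) auto

lemma words_0 [simp]: "words 0 = {[]}"
  by (auto simp: words_def)

lemma words_Suc: "words (Suc n) = (\<lambda>(j, w). j # w) ` ({1..N} \<times> words n)"
  by (auto simp: words_def length_Suc_conv image_iff)

lemma foldr_cont: "w \<in> words n \<Longrightarrow> continuous_on UNIV (foldr \<gamma> w)"
proof (induction n arbitrary: w)
  case (Suc n)
  then obtain j v where w: "w = j # v" "j \<in> {1..N}" "v \<in> words n"
    by (auto simp: words_Suc)
  then have "continuous_on UNIV (\<gamma> j \<circ> foldr \<gamma> v)"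
    using Suc.IH gamma_cont by (intro continuous_on_compose) (auto intro: continuous_on_subset)
  then show ?case using w by simp
qed (simp add: continuous_on_id)

lemma shift_foldr: "w \<in> words n \<Longrightarrow> (h ^^ n) (foldr \<gamma> w y) = y"
proof (induction n arbitrary: w)
  case (Suc n)
  then show ?case by (auto simp: words_Suc funpow_swap1 h_inverse simp del: funpow.simps simp: funpow_Suc_right)
qed simp

text \<open>Together with \<open>shift_foldr\<close> this describes the fibre of \<open>h ^^ n\<close> over \<open>y\<close> as the set of all
  \<open>foldr \<gamma> w y\<close>, with \<open>w\<close> a word of length \<open>n\<close>.\<close>

lemma shift_word: "\<exists>w\<in>words n. foldr \<gamma> w ((h ^^ n) x) = x"
proof (induction n arbitrary: x)
  case (Suc n)
  obtain j where j: "j \<in> {1..N}" "x = \<gamma> j (h x)" using cover by blast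
  obtain w where w: "w \<in> words n" "foldr \<gamma> w ((h ^^ n) (h x)) = h x" using Suc by blast
  have "foldr \<gamma> (j # w) ((h ^^ Suc n) x) = x"
    using j w by (simp add: funpow_Suc_right del: funpow.simps)
  moreover have "j # w \<in> words (Suc n)" using j w by (auto simp: words_Suc)
  ultimately show ?case by blast
qed simp

lemma shift_cont: "continuous_on UNIV (h ^^ n)"
proof (induction n)
  case (Suc n)
  then have "continuous_on UNIV (h \<circ> (h ^^ n))"
    using h_cont by (intro continuous_on_compose) (auto intro: continuous_on_subset)
  then show ?case by simp
qed (simp add: continuous_on_id)

text \<open>The \<open>n\<close>-th power of the transfer operator of the branches. A point of the fibre of \<open>h ^^ n\<close> is
  counted once for every word that leads to it, so branch points count several times.\<close>

definition fibre_sum :: "nat \<Rightarrow> ('k \<Rightarrow> 'a::comm_monoid_add) \<Rightarrow> 'k \<Rightarrow> 'a" where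
  "fibre_sum n f y = (\<Sum>w\<in>words n. f (foldr \<gamma> w y))"

lemma fibre_sum_0 [simp]: "fibre_sum 0 f = f"
  by (rule ext) (simp add: fibre_sum_def)

lemma fibre_sum_1: "fibre_sum (Suc 0) f y = (\<Sum>j=1..N. f (\<gamma> j y))"
proof -
  have "words (Suc 0) = (\<lambda>j. [j]) ` {1..N}" by (auto simp: words_Suc)
  then show ?thesis
    by (simp add: fibre_sum_def sum.reindex inj_on_def)
qed

lemma fibre_sum_Suc: "fibre_sum (Suc n) f = fibre_sum n (fibre_sum (Suc 0) f)"
proof
  fix y
  have "fibre_sum (Suc n) f y = (\<Sum>p\<in>{1..N} \<times> words n. f (foldr \<gamma> (fst p # snd p) y))"
    unfolding fibre_sum_def words_Suc
    by (subst sum.reindex) (auto simp: inj_on_def case_prod_beta)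
  also have "\<dots> = (\<Sum>j\<in>{1..N}. \<Sum>w\<in>words n. f (\<gamma> j (foldr \<gamma> w y)))"
    by (simp add: sum.cartesian_product case_prod_beta)
  also have "\<dots> = (\<Sum>w\<in>words n. \<Sum>j\<in>{1..N}. f (\<gamma> j (foldr \<gamma> w y)))"
    by (rule sum.swap)
  also have "\<dots> = fibre_sum n (fibre_sum (Suc 0) f) y"
    by (simp add: fibre_sum_1 fibre_sum_def[of n])
  finally show "fibre_sum (Suc n) f y = fibre_sum n (fibre_sum (Suc 0) f) y" .
qed

lemma fibre_sum_Suc2: "fibre_sum (Suc n) f = fibre_sum (Suc 0) (fibre_sum n f)"
proof (induction n arbitrary: f)
  case (Suc n)
  show ?case by (metis Suc fibre_sum_Suc)
qed simp

text \<open>A function of \<open>h ^^ n\<close> is constant on the fibres of \<open>h ^^ n\<close>.\<close>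

lemma fibre_sum_shift:
  fixes f g :: "'k \<Rightarrow> 'a::comm_semiring_0"
  shows "fibre_sum n (\<lambda>p. f p * g ((h ^^ n) p)) y = fibre_sum n f y * g y"
  unfolding fibre_sum_def by (auto simp: sum_distrib_right shift_foldr intro!: sum.cong)

lemma fibre_sum_const: "fibre_sum n (\<lambda>_. c) y = of_nat (N ^ n) * (c :: 'a::comm_semiring_1)"
  by (simp add: fibre_sum_def card_words)

lemma fibre_sum_add: "fibre_sum n (\<lambda>p. f p + g p) y = fibre_sum n f y + fibre_sum n g y"
  by (simp add: fibre_sum_def sum.distrib)

lemma fibre_sum_sum: "fibre_sum n (\<lambda>p. \<Sum>i\<in>I. f i p) y = (\<Sum>i\<in>I. fibre_sum n (f i) y)"
  unfolding fibre_sum_def by (rule sum.swap)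

lemma fibre_sum_cmult:
  fixes f :: "'k \<Rightarrow> 'a::semiring_0"
  shows "fibre_sum n (\<lambda>p. c * f p) y = c * fibre_sum n f y"
  by (simp add: fibre_sum_def sum_distrib_left)

lemma fibre_sum_mono:
  fixes f g :: "'k \<Rightarrow> real"
  shows "(\<And>p. f p \<le> g p) \<Longrightarrow> fibre_sum n f y \<le> fibre_sum n g y"
  by (simp add: fibre_sum_def sum_mono)

lemma le_fibre_sum:
  fixes f :: "'k \<Rightarrow> real"
  assumes "\<And>p. 0 \<le> f p"
  shows "f x \<le> fibre_sum n f ((h ^^ n) x)"
proof -
  obtain w where "w \<in> words n" "foldr \<gamma> w ((h ^^ n) x) = x" using shift_word by blast
  then show ?thesis
    using member_le_sum[of w "words n" "\<lambda>w. f (foldr \<gamma> w ((h ^^ n) x))"] assms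
    by (simp add: fibre_sum_def)
qed

lemma fibre_sum_cont:
  fixes f :: "'k \<Rightarrow> 'a::{topological_comm_monoid_add}"
  assumes "continuous_on UNIV f"
  shows "continuous_on UNIV (fibre_sum n f)"
proof -
  have "continuous_on UNIV (\<lambda>y. f (foldr \<gamma> w y))" if "w \<in> words n" for w
    using continuous_on_compose2[OF assms foldr_cont[OF that]] by auto
  then show ?thesis unfolding fibre_sum_def by (intro continuous_on_sum)
qed

end


section \<open>The module C(K) over C(K) with the fibrewise inner product\<close>

lemma cont_funI: "continuous_on UNIV f \<Longrightarrow> f \<in> cont_fun"
  by (simp add: cont_fun_def)

lemma cont_funD: "f \<in> cont_fun \<Longrightarrow> continuous_on UNIV f"
  by (simp add: cont_fun_def)

lemma cont_fun_const: "(\<lambda>_. c) \<in> cont_fun"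
  and cont_fun_add: "f \<in> cont_fun \<Longrightarrow> g \<in> cont_fun \<Longrightarrow> (\<lambda>p. f p + g p) \<in> cont_fun"
  and cont_fun_diff: "f \<in> cont_fun \<Longrightarrow> g \<in> cont_fun \<Longrightarrow> (\<lambda>p. f p - g p) \<in> cont_fun"
  and cont_fun_mult: "f \<in> cont_fun \<Longrightarrow> g \<in> cont_fun \<Longrightarrow> (\<lambda>p. f p * g p) \<in> cont_fun"
  and cont_fun_cnj: "f \<in> cont_fun \<Longrightarrow> (\<lambda>p. cnj (f p)) \<in> cont_fun"
  and cont_fun_of_real: "continuous_on UNIV r \<Longrightarrow> (\<lambda>p. complex_of_real (r p)) \<in> cont_fun"
  by (auto simp: cont_fun_def intro!: continuous_intros)

lemma cont_fun_sum: "(\<And>i. i \<in> I \<Longrightarrow> f i \<in> cont_fun) \<Longrightarrow> (\<lambda>p. \<Sum>i\<in>I. f i p) \<in> cont_fun"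
  by (auto simp: cont_fun_def intro!: continuous_intros)

lemmas cont_fun_intros = cont_fun_const cont_fun_add cont_fun_diff cont_fun_mult cont_fun_cnj
  cont_fun_of_real cont_fun_sum

lemma separating_function:
  fixes z :: "'k::metric_space"
  assumes "finite F" "z \<notin> F"
  obtains b :: "'k \<Rightarrow> complex" where "b \<in> cont_fun" "b z = 1" "\<And>q. q \<in> F \<Longrightarrow> b q = 0"
proof -
  define b where "b x = complex_of_real ((\<Prod>q\<in>F. dist x q) / (\<Prod>q\<in>F. dist z q))" for x
  have nz: "(\<Prod>q\<in>F. dist z q) \<noteq> 0" using assms by auto
  have "b \<in> cont_fun"
    unfolding b_def by (intro cont_fun_of_real continuous_intros) (use nz in blast)
  moreover have "b z = 1" using nz by (simp add: b_def)
  moreover have "b q = 0" if "q \<in> F" for q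
    using that assms(1) by (auto simp: b_def)
  ultimately show ?thesis using that by blast
qed

context self_similar_system
begin

lemma cont_fun_shift: "f \<in> cont_fun \<Longrightarrow> (\<lambda>p. f ((h ^^ n) p)) \<in> cont_fun"
  using continuous_on_compose2[OF _ shift_cont] by (auto simp: cont_fun_def)

lemma bounded_cont:
  fixes f :: "'k \<Rightarrow> 'b::real_normed_vector"
  assumes "continuous_on UNIV f"
  obtains b where "0 \<le> b" "\<And>p. norm (f p) \<le> b"
proof -
  have "bounded (range f)"
    using compact_imp_bounded[OF compact_continuous_image[OF assms compact_space]] .
  then obtain b where b: "\<And>p. norm (f p) \<le> b" by (auto simp: bounded_iff)
  then have "0 \<le> b" using norm_ge_zero order_trans by blast
  then show ?thesis using that b by blast
qed

text \<open>The inner product of the \<open>n\<close>-th tensor power, transported to \<open>C(K)\<close>.\<close>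

definition ip :: "nat \<Rightarrow> ('k \<Rightarrow> complex) \<Rightarrow> ('k \<Rightarrow> complex) \<Rightarrow> 'k \<Rightarrow> complex" where
  "ip n f g = fibre_sum n (\<lambda>p. cnj (f p) * g p)"

text \<open>The norm on the finite-dimensional fibre of the module over the point \<open>y\<close>.\<close>

definition fnorm :: "nat \<Rightarrow> ('k \<Rightarrow> complex) \<Rightarrow> 'k \<Rightarrow> real" where
  "fnorm n f y = L2_set (\<lambda>w. cmod (f (foldr \<gamma> w y))) (words n)"

text \<open>The norm of the Hilbert module, which is the supremum of the fibre norms. It is equivalent to the
  supremum norm of \<open>C(K)\<close>, with a constant that depends on \<open>n\<close> (\<open>cmod_le_mnorm\<close>, \<open>mnorm_le_sup\<close>).\<close>

definition mnorm :: "nat \<Rightarrow> ('k \<Rightarrow> complex) \<Rightarrow> real" where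
  "mnorm n f = sqrt (SUP y. cmod (ip n f f y))"

lemma ip_cont: "f \<in> cont_fun \<Longrightarrow> g \<in> cont_fun \<Longrightarrow> ip n f g \<in> cont_fun"
  unfolding ip_def by (rule cont_funI, rule fibre_sum_cont, rule cont_funD, intro cont_fun_intros)

lemma ip_cnj: "cnj (ip n f g y) = ip n g f y"
  by (simp add: ip_def fibre_sum_def mult.commute)

lemma fibre_sum_Suc_apply: "fibre_sum (Suc n) f y = (\<Sum>j=1..N. fibre_sum n f (\<gamma> j y))"
  by (subst fibre_sum_Suc2) (rule fibre_sum_1)

lemma ip_Suc: "ip (Suc n) f g y = (\<Sum>j=1..N. ip n f g (\<gamma> j y))"
  unfolding ip_def by (rule fibre_sum_Suc_apply)

lemma ip_add_right: "ip n f (\<lambda>p. g p + g' p) y = ip n f g y + ip n f g' y"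
  by (simp add: ip_def distrib_left fibre_sum_add)

lemma ip_add_left: "ip n (\<lambda>p. g p + g' p) f y = ip n g f y + ip n g' f y"
  by (simp add: ip_def distrib_right fibre_sum_add)

lemma ip_scale_right: "ip n f (\<lambda>p. c * g p) y = c * ip n f g y"
  by (simp add: ip_def fibre_sum_cmult[symmetric] ac_simps)

lemma ip_scale_left: "ip n (\<lambda>p. c * f p) g y = cnj c * ip n f g y"
  by (simp add: ip_def fibre_sum_cmult[symmetric] ac_simps)

lemma ip_shift_right: "ip n f (\<lambda>p. g p * b ((h ^^ n) p)) y = ip n f g y * b y"
  using fibre_sum_shift[of n "\<lambda>p. cnj (f p) * g p" b y] by (simp add: ip_def ac_simps)

lemma ip_shift_left: "ip n (\<lambda>p. f p * b ((h ^^ n) p)) g y = ip n f g y * cnj (b y)"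
  using fibre_sum_shift[of n "\<lambda>p. cnj (f p) * g p" "\<lambda>p. cnj (b p)" y] by (simp add: ip_def ac_simps)

lemma fnorm_nonneg [simp]: "0 \<le> fnorm n f y"
  by (simp add: fnorm_def)

lemma fnorm_sq: "(fnorm n f y)\<^sup>2 = fibre_sum n (\<lambda>p. (cmod (f p))\<^sup>2) y"
  by (simp add: fnorm_def L2_set_def fibre_sum_def sum_nonneg)

lemma ip_self: "ip n f f y = of_real ((fnorm n f y)\<^sup>2)"
  unfolding fnorm_sq ip_def fibre_sum_def of_real_sum
  by (intro sum.cong refl) (metis complex_norm_square mult.commute of_real_power)

lemma cmod_ip_self: "cmod (ip n f f y) = (fnorm n f y)\<^sup>2"
  by (simp add: ip_self norm_of_real del: of_real_power)

lemma ip_cauchy_schwarz: "cmod (ip n f g y) \<le> fnorm n f y * fnorm n g y"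
proof -
  have "cmod (ip n f g y) \<le> (\<Sum>w\<in>words n. \<bar>cmod (f (foldr \<gamma> w y))\<bar> * \<bar>cmod (g (foldr \<gamma> w y))\<bar>)"
    unfolding ip_def fibre_sum_def by (rule order_trans[OF norm_sum]) (simp add: norm_mult)
  also have "\<dots> \<le> fnorm n f y * fnorm n g y"
    unfolding fnorm_def by (rule L2_set_mult_ineq)
  finally show ?thesis .
qed

lemma fnorm_triangle: "fnorm n (\<lambda>p. f p + g p) y \<le> fnorm n f y + fnorm n g y"
proof -
  have "fnorm n (\<lambda>p. f p + g p) y \<le>
      L2_set (\<lambda>w. cmod (f (foldr \<gamma> w y)) + cmod (g (foldr \<gamma> w y))) (words n)"
    unfolding fnorm_def by (intro L2_set_mono norm_triangle_ineq) auto
  also have "\<dots> \<le> fnorm n f y + fnorm n g y"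
    unfolding fnorm_def by (rule L2_set_triangle_ineq)
  finally show ?thesis .
qed

lemma fnorm_scale: "fnorm n (\<lambda>p. c * f p) y = cmod c * fnorm n f y"
  by (simp add: fnorm_def norm_mult L2_set_right_distrib)

lemma fnorm_shift: "fnorm n (\<lambda>p. f p * b ((h ^^ n) p)) y = fnorm n f y * cmod (b y)"
proof -
  have "fnorm n (\<lambda>p. f p * b ((h ^^ n) p)) y = 
     L2_set (\<lambda>w. cmod (f (foldr \<gamma> w y)) * cmod (b y)) (words n)"
    unfolding fnorm_def by (intro L2_set_cong refl) (simp add: norm_mult shift_foldr)
  then show ?thesis by (simp add: fnorm_def L2_set_left_distrib)
qed

lemma fnorm_Suc_sq: "(fnorm (Suc n) f y)\<^sup>2 = (\<Sum>j=1..N. (fnorm n f (\<gamma> j y))\<^sup>2)"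
  unfolding fnorm_sq by (rule fibre_sum_Suc_apply)

lemma cmod_le_fnorm: "cmod (f p) \<le> fnorm n f ((h ^^ n) p)"
proof -
  have "(cmod (f p))\<^sup>2 \<le> (fnorm n f ((h ^^ n) p))\<^sup>2"
    unfolding fnorm_sq by (rule le_fibre_sum) simp
  then show ?thesis by (rule power2_le_imp_le) simp
qed

lemma fnorm_le_sup:
  assumes "\<And>p. cmod (f p) \<le> b" "0 \<le> b"
  shows "fnorm n f y \<le> sqrt (real (N ^ n)) * b"
proof -
  have "(fnorm n f y)\<^sup>2 \<le> fibre_sum n (\<lambda>_. b\<^sup>2) y"
    unfolding fnorm_sq using assms by (intro fibre_sum_mono power_mono) auto
  also have "\<dots> = (sqrt (real (N ^ n)) * b)\<^sup>2"
    by (simp only: fibre_sum_const power_mult_distrib) simp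
  finally show ?thesis by (rule power2_le_imp_le) (use assms in simp)
qed

lemma fnorm_cont: "f \<in> cont_fun \<Longrightarrow> continuous_on UNIV (fnorm n f)"
proof -
  assume f: "f \<in> cont_fun"
  have eq: "fnorm n f = (\<lambda>y. sqrt (fibre_sum n (\<lambda>p. (cmod (f p))\<^sup>2) y))"
    by (rule ext) (simp add: fnorm_sq[symmetric])
  show ?thesis
    unfolding eq using cont_funD[OF f] by (intro continuous_intros fibre_sum_cont)
qed

lemma fnorm_bdd: "f \<in> cont_fun \<Longrightarrow> bdd_above (range (\<lambda>y. (fnorm n f y)\<^sup>2))"
proof -
  assume f: "f \<in> cont_fun"
  obtain b where b: "\<And>y. norm (fnorm n f y) \<le> b" using bounded_cont[OF fnorm_cont[OF f]] by blast
  have "(fnorm n f y)\<^sup>2 \<le> b\<^sup>2" for y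
    using b[of y] by (intro power_mono) auto
  then show ?thesis by (intro bdd_aboveI2)
qed

lemma mnorm_eq: "mnorm n f = sqrt (SUP y. (fnorm n f y)\<^sup>2)"
  by (simp add: mnorm_def cmod_ip_self)

lemma fnorm_le_mnorm:
  assumes "f \<in> cont_fun"
  shows "fnorm n f y \<le> mnorm n f"
proof -
  have "(fnorm n f y)\<^sup>2 \<le> (SUP y. (fnorm n f y)\<^sup>2)"
    using fnorm_bdd[OF assms] by (intro cSUP_upper) auto
  then show ?thesis unfolding mnorm_eq by (rule real_le_rsqrt)
qed

lemma mnorm_leI:
  assumes "\<And>y. fnorm n f y \<le> c" 
  shows "mnorm n f \<le> c"
proof -
  have c: "0 \<le> c" using assms fnorm_nonneg order_trans by blast
  have "(SUP y. (fnorm n f y)\<^sup>2) \<le> c\<^sup>2"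
    by (rule cSUP_least) (auto intro: power_mono assms)
  then show ?thesis unfolding mnorm_eq by (rule real_le_lsqrt[OF c])
qed

lemma mnorm_nonneg: "f \<in> cont_fun \<Longrightarrow> 0 \<le> mnorm n f"
  using fnorm_le_mnorm fnorm_nonneg order_trans by blast

lemma cmod_le_mnorm: "f \<in> cont_fun \<Longrightarrow> cmod (f p) \<le> mnorm n f"
  using cmod_le_fnorm fnorm_le_mnorm order_trans by blast

lemma mnorm_le_sup: "(\<And>p. cmod (f p) \<le> b) \<Longrightarrow> 0 \<le> b \<Longrightarrow> mnorm n f \<le> sqrt (real (N ^ n)) * b"
  by (intro mnorm_leI fnorm_le_sup)

lemma ip_nondegenerate:
  assumes "u \<in> cont_fun" "v \<in> cont_fun" "\<And>g. g \<in> cont_fun \<Longrightarrow> ip n u g = ip n v g"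
  shows "u = v"
proof
  fix p
  define d where "d = (\<lambda>p. u p - v p)"
  have d: "d \<in> cont_fun" unfolding d_def by (intro cont_fun_intros assms)
  have "ip n d d y = ip n u d y - ip n v d y" for y
    by (simp add: ip_def d_def left_diff_distrib fibre_sum_def sum_subtractf)
  then have "(fnorm n d y)\<^sup>2 = 0" for y
    using assms(3)[OF d] ip_self[of n d y] by simp
  then have "cmod (d p) \<le> 0"
    using cmod_le_fnorm[of d p n] by simp
  then show "u p = v p" by (simp add: d_def)
qed


section \<open>Adjointable operators on C(K)\<close>

definition adjoint_pair ::
  "nat \<Rightarrow> 'k fun_op \<Rightarrow> 'k fun_op \<Rightarrow> bool" where
  "adjoint_pair n T S \<longleftrightarrow> (\<forall>f\<in>cont_fun. T f \<in> cont_fun \<and> S f \<in> cont_fun) \<and>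
     (\<forall>f\<in>cont_fun. \<forall>g\<in>cont_fun. ip n (T f) g = ip n f (S g))"

definition adjointable :: "nat \<Rightarrow> 'k fun_op \<Rightarrow> bool" where
  "adjointable n T \<longleftrightarrow> (\<exists>S. adjoint_pair n T S)"

lemma adjointableI: "adjoint_pair n T S \<Longrightarrow> adjointable n T"
  by (auto simp: adjointable_def)

lemma adjoint_pair_closed:
  "adjoint_pair n T S \<Longrightarrow> f \<in> cont_fun \<Longrightarrow> T f \<in> cont_fun"
  "adjoint_pair n T S \<Longrightarrow> f \<in> cont_fun \<Longrightarrow> S f \<in> cont_fun"
  by (auto simp: adjoint_pair_def)

lemma adjointable_closed: "adjointable n T \<Longrightarrow> f \<in> cont_fun \<Longrightarrow> T f \<in> cont_fun"
  by (auto simp: adjointable_def adjoint_pair_def)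

lemma adjoint_pair_ip:
  "adjoint_pair n T S \<Longrightarrow> f \<in> cont_fun \<Longrightarrow> g \<in> cont_fun \<Longrightarrow> ip n (T f) g = ip n f (S g)"
  by (auto simp: adjoint_pair_def)

lemma adjoint_pair_sym:
  assumes "adjoint_pair n T S"
  shows "adjoint_pair n S T"
proof -
  have "ip n (S f) g y = ip n f (T g) y" if "f \<in> cont_fun" "g \<in> cont_fun" for f g y
    using adjoint_pair_ip[OF assms that(2,1)] ip_cnj by metis
  then show ?thesis using assms by (auto simp: adjoint_pair_def)
qed

text \<open>The inner product at level \<open>n + 1\<close> is a sum of values of the inner product at level \<open>n\<close>. This is
  why \<open>T \<otimes> I\<close> can be the operator \<open>T\<close> itself.\<close>

lemma adjoint_pair_Suc: "adjoint_pair n T S \<Longrightarrow> adjoint_pair (Suc n) T S"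
  unfolding adjoint_pair_def by (auto simp: fun_eq_iff ip_Suc intro!: sum.cong)

lemma adjointable_mono:
  assumes "adjointable n T" "n \<le> m" 
  shows "adjointable m T"
proof -
  obtain S where "adjoint_pair n T S" using assms by (auto simp: adjointable_def)
  with assms(2) have "adjoint_pair m T S"
    by (induction rule: dec_induct) (auto intro: adjoint_pair_Suc)
  then show ?thesis by (rule adjointableI)
qed

lemma adjoint_pair_mono:
  assumes "adjoint_pair n T S" "n \<le> m" 
  shows "adjoint_pair m T S"
  using assms(2,1) by (induction rule: dec_induct) (auto intro: adjoint_pair_Suc)

lemma adjoint_unique:
  assumes "adjoint_pair n T S" "adjoint_pair n T' S'" "\<And>f. f \<in> cont_fun \<Longrightarrow> T f = T' f" "f \<in> cont_fun"
  shows "S f = S' f"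
proof (rule ip_nondegenerate)
  show "ip n (S f) g = ip n (S' f) g" if "g \<in> cont_fun" for g
    using adjoint_pair_ip[OF adjoint_pair_sym[OF assms(1)] assms(4) that]
      adjoint_pair_ip[OF adjoint_pair_sym[OF assms(2)] assms(4) that] assms(3)[OF that] by simp
qed (rule adjoint_pair_closed(2)[OF assms(1) assms(4)] adjoint_pair_closed(2)[OF assms(2) assms(4)])+

lemma adjointable_add:
  assumes "adjointable n T" "f \<in> cont_fun" "g \<in> cont_fun"
  shows "T (\<lambda>p. f p + g p) = (\<lambda>p. T f p + T g p)"
proof -
  obtain S where S: "adjoint_pair n T S" using assms by (auto simp: adjointable_def)
  show ?thesis
  proof (rule ip_nondegenerate[where n=n])
    show "ip n (T (\<lambda>p. f p + g p)) u = ip n (\<lambda>p. T f p + T g p) u" if "u \<in> cont_fun" for u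
      using that assms
      by (auto simp: fun_eq_iff ip_add_left adjoint_pair_ip[OF S] cont_fun_add)
  qed (intro cont_fun_intros adjointable_closed[OF assms(1)] assms)+
qed

text \<open>Compare inner products with an arbitrary \<open>u\<close>: the coefficient \<open>b\<close> can be moved out of the inner
  product. In particular the values of \<open>T f\<close> on a fibre depend only on \<open>f\<close> on that fibre.\<close>

lemma adjointable_shift:
  assumes "adjointable n T" "f \<in> cont_fun" "b \<in> cont_fun"
  shows "T (\<lambda>p. f p * b ((h ^^ n) p)) = (\<lambda>p. T f p * b ((h ^^ n) p))"
proof -
  obtain S where S: "adjoint_pair n T S" using assms by (auto simp: adjointable_def)
  show ?thesis
  proof (rule ip_nondegenerate[where n=n])
    show "ip n (T (\<lambda>p. f p * b ((h ^^ n) p))) u = ip n (\<lambda>p. T f p * b ((h ^^ n) p)) u"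
      if "u \<in> cont_fun" for u
    proof
      fix y
      have "ip n (T (\<lambda>p. f p * b ((h ^^ n) p))) u y = ip n (\<lambda>p. f p * b ((h ^^ n) p)) (S u) y"
        by (subst adjoint_pair_ip[OF S _ that]) (intro cont_fun_intros cont_fun_shift assms refl)+
      also have "\<dots> = ip n (T f) u y * cnj (b y)"
        by (simp add: ip_shift_left adjoint_pair_ip[OF S assms(2) that])
      also have "\<dots> = ip n (\<lambda>p. T f p * b ((h ^^ n) p)) u y"
        by (simp add: ip_shift_left)
      finally show "ip n (T (\<lambda>p. f p * b ((h ^^ n) p))) u y
        = ip n (\<lambda>p. T f p * b ((h ^^ n) p)) u y" .
    qed
  qed (intro cont_fun_intros cont_fun_shift adjointable_closed[OF assms(1)] assms)+
qed

lemma adjointable_scale: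
  assumes "adjointable n T" "f \<in> cont_fun"
  shows "T (\<lambda>p. c * f p) = (\<lambda>p. c * T f p)"
  using adjointable_shift[OF assms cont_fun_const[of c]] by (simp add: mult.commute)

lemma adjoint_pair_add:
  assumes "adjoint_pair n T S" "adjoint_pair n T' S'"
  shows "adjoint_pair n (\<lambda>f p. T f p + T' f p) (\<lambda>f p. S f p + S' f p)"
  using assms unfolding adjoint_pair_def
  by (auto simp: fun_eq_iff ip_add_left ip_add_right intro: cont_fun_add)

lemma adjoint_pair_scale:
  assumes "adjoint_pair n T S"
  shows "adjoint_pair n (\<lambda>f p. c * T f p) (\<lambda>f p. cnj c * S f p)"
  using assms unfolding adjoint_pair_def
  by (auto simp: fun_eq_iff ip_scale_left ip_scale_right intro: cont_fun_mult cont_fun_const)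

lemma adjoint_pair_comp:
  assumes "adjoint_pair n T S" "adjoint_pair n T' S'"
  shows "adjoint_pair n (\<lambda>f. T (T' f)) (\<lambda>f. S' (S f))"
  using assms unfolding adjoint_pair_def by auto

lemma adjointable_plus:
  "adjointable n T \<Longrightarrow> adjointable n T' \<Longrightarrow> adjointable n (\<lambda>f p. T f p + T' f p)"
  unfolding adjointable_def using adjoint_pair_add by blast

lemma adjointable_cmult: "adjointable n T \<Longrightarrow> adjointable n (\<lambda>f p. c * T f p)"
  unfolding adjointable_def using adjoint_pair_scale by blast

lemma adjointable_comp: "adjointable n T \<Longrightarrow> adjointable n T' \<Longrightarrow> adjointable n (\<lambda>f. T (T' f))"
  unfolding adjointable_def using adjoint_pair_comp by blast

lemma adjoint_pair_zero: "adjoint_pair n (\<lambda>f p. 0) (\<lambda>f p. 0)"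
  by (auto simp: adjoint_pair_def fun_eq_iff ip_def fibre_sum_def intro: cont_fun_intros)

lemma adjointable_zero: "adjointable n (\<lambda>f p. 0)"
  using adjoint_pair_zero by (rule adjointableI)

lemma adjointable_minus:
  assumes "adjointable n T" "adjointable n T'" 
  shows "adjointable n (\<lambda>f p. T f p - T' f p)"
  using adjointable_plus[OF assms(1) adjointable_cmult[OF assms(2), of "-1"]] by simp

lemma adjointable_cong:
  assumes "\<And>f. f \<in> cont_fun \<Longrightarrow> T f = T' f"
  shows "adjointable n T \<longleftrightarrow> adjointable n T'"
  using assms by (simp add: adjointable_def adjoint_pair_def)

text \<open>The operator \<open>\<theta>\<^sub>f\<^sub>,\<^sub>g\<close> of the \<open>n\<close>-th tensor power.\<close>

definition rank1 :: "nat \<Rightarrow> ('k \<Rightarrow> complex) \<Rightarrow> ('k \<Rightarrow> complex) \<Rightarrow> ('k \<Rightarrow> complex) \<Rightarrow> 'k \<Rightarrow> complex" where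
  "rank1 n f g = (\<lambda>z p. f p * ip n g z ((h ^^ n) p))"

lemma adjoint_pair_rank1:
  assumes "f \<in> cont_fun" "g \<in> cont_fun"
  shows "adjoint_pair n (rank1 n f g) (rank1 n g f)"
  unfolding adjoint_pair_def rank1_def
  using assms ip_cnj
  by (auto simp: fun_eq_iff ip_shift_left ip_shift_right intro!: cont_fun_intros cont_fun_shift ip_cont)

lemma adjointable_rank1: "f \<in> cont_fun \<Longrightarrow> g \<in> cont_fun \<Longrightarrow> adjointable n (rank1 n f g)"
  using adjoint_pair_rank1 by (rule adjointableI)


subsection \<open>Adjointable operators are bounded\<close>

text \<open>The constant bounds the norms of the restrictions of \<open>T\<close> to all fibres. This form of boundedness
  can be passed from one level to the next.\<close>

definition bounded_by :: "nat \<Rightarrow> real \<Rightarrow> 'k fun_op \<Rightarrow> bool" where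
  "bounded_by n c T \<longleftrightarrow> (\<forall>f\<in>cont_fun. \<forall>y. fnorm n (T f) y \<le> c * fnorm n f y)"

text \<open>A bound for the module norm holds in every fibre: \<open>T\<close> commutes with the division of \<open>f\<close> by its own
  fibre norm (increased by \<open>e\<close> to be positive), and this brings \<open>f\<close> into the unit ball.\<close>

lemma bounded_byI:
  assumes T: "adjointable n T" and c: "0 \<le> c"
    and unit: "\<And>f. f \<in> cont_fun \<Longrightarrow> mnorm n f \<le> 1 \<Longrightarrow> mnorm n (T f) \<le> c"
  shows "bounded_by n c T"
  unfolding bounded_by_def
proof (intro ballI allI)
  fix f :: "'k \<Rightarrow> complex" and y assume f: "f \<in> cont_fun"
  have eps: "fnorm n (T f) y \<le> c * (fnorm n f y + e)" if e: "e > 0" for e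
  proof -
    define b where "b = (\<lambda>z. complex_of_real (1 / (fnorm n f z + e)))"
    have pos: "fnorm n f z + e > 0" for z using e fnorm_nonneg[of n f z] by linarith
    have b: "b \<in> cont_fun" unfolding b_def
      using pos by (intro cont_fun_of_real continuous_intros fnorm_cont f) (auto simp: less_imp_neq[symmetric])
    have cb: "cmod (b z) = 1 / (fnorm n f z + e)" for z
      using pos[of z] by (simp add: b_def norm_divide del: of_real_add)
    let ?g = "\<lambda>p. f p * b ((h ^^ n) p)"
    have g: "?g \<in> cont_fun" by (intro cont_fun_intros cont_fun_shift f b(1))
    have "mnorm n ?g \<le> 1"
      using pos e by (intro mnorm_leI) (simp add: fnorm_shift cb)
    then have "mnorm n (T ?g) \<le> c" using unit g by blast
    then have "fnorm n (T ?g) y \<le> c"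
      using fnorm_le_mnorm[OF adjointable_closed[OF T g], of n y] by linarith
    then have "fnorm n (T f) y / (fnorm n f y + e) \<le> c"
      by (simp add: adjointable_shift[OF T f b] fnorm_shift cb)
    then show ?thesis using pos[of y] by (simp add: field_simps)
  qed
  show "fnorm n (T f) y \<le> c * fnorm n f y"
  proof (rule field_le_epsilon)
    fix d :: real assume d: "d > 0"
    have "fnorm n (T f) y \<le> c * (fnorm n f y + d / (c + 1))"
      using d c by (intro eps) simp
    also have "\<dots> \<le> c * fnorm n f y + d"
      using d c by (simp add: field_simps)
    finally show "fnorm n (T f) y \<le> c * fnorm n f y + d" .
  qed
qed

text \<open>The functionals \<open>f \<mapsto> (g | T f)(y) = (S g | f)(y)\<close>, for \<open>g\<close> in the unit ball and \<open>y\<close> in \<open>K\<close>, are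
  bounded because of the right-hand side, and bounded at every \<open>f\<close> because of the left-hand side.
  So they are uniformly bounded, and the choice of a multiple of \<open>T f\<close> for \<open>g\<close> bounds \<open>T f\<close>.\<close>

lemma adjointable_bounded:
  assumes T: "adjointable n T"
  shows "\<exists>c\<ge>0. bounded_by n c T"
proof -
  obtain S where S: "adjoint_pair n T S" using T by (auto simp: adjointable_def)
  define G :: "('k \<Rightarrow> complex) set" where "G = {g \<in> cont_fun. \<forall>p. cmod (g p) \<le> 1}"
  define \<phi> :: "('k \<Rightarrow> complex) \<times> 'k \<Rightarrow> ('k \<Rightarrow>\<^sub>C complex) \<Rightarrow> complex"
    where "\<phi> = (\<lambda>(g, y) F. if g \<in> G then ip n g (T (apply_bcontfun F)) y else 0)"
  have F: "apply_bcontfun F \<in> cont_fun" for F :: "'k \<Rightarrow>\<^sub>C complex"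
    by (intro cont_funI) simp
  have ip_bound: "cmod (ip n u v y) \<le> real (N ^ n) * (a * b)"
    if "\<And>p. cmod (u p) \<le> a" "\<And>p. cmod (v p) \<le> b" "0 \<le> a" "0 \<le> b" for u v y a b
  proof -
    have "cmod (ip n u v y) \<le> fnorm n u y * fnorm n v y" by (rule ip_cauchy_schwarz)
    also have "\<dots> \<le> (sqrt (real (N ^ n)) * a) * (sqrt (real (N ^ n)) * b)"
      using that by (intro mult_mono fnorm_le_sup) auto
    also have "\<dots> = (sqrt (real (N ^ n)))\<^sup>2 * (a * b)"
      by (simp only: power2_eq_square ac_simps)
    finally show ?thesis by simp
  qed
  have lin: "bounded_linear (\<phi> i)" for i
  proof -
    obtain g y where i: "i = (g, y)" by (cases i)
    show ?thesis
    proof (cases "g \<in> G")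
      case g: True
      then have gC: "g \<in> cont_fun" by (simp add: G_def)
      obtain b where b: "0 \<le> b" "\<And>p. cmod (S g p) \<le> b"
        using bounded_cont[OF cont_funD[OF adjoint_pair_closed(2)[OF S gC]]] by blast
      have eq: "\<phi> i F = ip n (S g) (apply_bcontfun F) y" for F
        using g gC F adjoint_pair_ip[OF adjoint_pair_sym[OF S]] by (simp add: \<phi>_def i)
      show ?thesis
      proof (rule bounded_linear_intro[where K = "real (N ^ n) * b"])
        show "\<phi> i (F + F') = \<phi> i F + \<phi> i F'" for F F'
          by (simp add: eq ip_add_right flip: plus_bcontfun.rep_eq)
             (simp add: ip_add_right)
        show "\<phi> i (r *\<^sub>R F) = r *\<^sub>R \<phi> i F" for r F
          by (simp add: eq scaleR_conv_of_real ip_scale_right)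
        show "norm (\<phi> i F) \<le> norm F * (real (N ^ n) * b)" for F
          using ip_bound[of "S g" b "apply_bcontfun F" "norm F" y]
            b norm_bounded[of F] by (simp add: eq ac_simps)
      qed
    qed (simp add: \<phi>_def i)
  qed
  have pw: "\<exists>c. \<forall>i. norm (\<phi> i F) \<le> c" for F
  proof -
    obtain b where b: "0 \<le> b" "\<And>p. cmod (T (apply_bcontfun F) p) \<le> b"
      using bounded_cont[OF cont_funD[OF adjointable_closed[OF T F]]] by blast
    have "norm (\<phi> i F) \<le> real (N ^ n) * b" for i
    proof (cases i)
      case (Pair g y)
      then show ?thesis
        using ip_bound[of g 1 "T (apply_bcontfun F)" b y] b by (simp add: \<phi>_def G_def)
    qed
    then show ?thesis by blast
  qed
  obtain c where c: "\<And>i F. norm (\<phi> i F) \<le> c * norm F"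
    using uniform_boundedness[OF lin pw] by blast
  define K where "K = sqrt (real (N ^ n)) * \<bar>c\<bar>"
  have K: "0 \<le> K" by (simp add: K_def)
  have unit: "mnorm n (T f) \<le> K" if f: "f \<in> cont_fun" and 1: "mnorm n f \<le> 1" for f
  proof -
    have f1: "cmod (f p) \<le> 1" for p using cmod_le_mnorm[OF f, of p n] 1 by linarith
    then have "f \<in> bcontfun"
      using f by (intro bcontfun_normI) (auto simp: cont_fun_def)
    then obtain F where F: "f = apply_bcontfun F" by (rule bcontfunE)
    have nF: "norm F \<le> 1" using f1 by (intro norm_bound) (simp add: F)
    have Tf: "T f \<in> cont_fun" by (rule adjointable_closed[OF T f])
    \<comment> \<open>Test against \<open>T f\<close> scaled to the unit ball for the supremum norm.\<close>
    have sq: "fnorm n (T f) y ^ 2 \<le> \<bar>c\<bar> * b" if b: "\<And>p. cmod (T f p) \<le> b" "0 < b" for b y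
    proof -
      define g where "g = (\<lambda>p. of_real (1 / b) * T f p)"
      have "g \<in> cont_fun" unfolding g_def by (intro cont_fun_intros Tf)
      then have g: "g \<in> G"
        using b by (auto simp: g_def G_def norm_mult norm_divide)
      have "cmod (\<phi> (g, y) F) \<le> c * norm F" by (rule c)
      also have "\<dots> \<le> \<bar>c\<bar> * 1" using nF by (intro mult_mono) auto
      finally have "cmod (of_real (1 / b) * ip n (T f) (T f) y) \<le> \<bar>c\<bar>"
        using g unfolding \<phi>_def F[symmetric] by (simp only: prod.case if_True F[symmetric]) (simp add: g_def ip_scale_left del: of_real_divide)
      then show ?thesis
        using b by (simp add: norm_mult norm_divide cmod_ip_self field_simps)
    qed
    have sup: "cmod (T f p) \<le> \<bar>c\<bar>" for p
    proof -
      obtain b where b: "0 \<le> b" "\<And>p. cmod (T f p) \<le> b"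
        using bounded_cont[OF cont_funD[OF Tf]] by blast
      obtain q where q: "\<And>p. cmod (T f p) \<le> cmod (T f q)"
        using continuous_attains_sup[OF compact_space, of "\<lambda>p. cmod (T f p)"] cont_funD[OF Tf]
        by (auto intro: continuous_intros)
      have "cmod (T f q) \<le> \<bar>c\<bar>"
      proof (cases "cmod (T f q) = 0")
        case False
        then have pos: "0 < cmod (T f q)" by simp
        have "(cmod (T f q))\<^sup>2 \<le> (fnorm n (T f) ((h ^^ n) q))\<^sup>2"
          using cmod_le_fnorm by (intro power_mono) auto
        also have "\<dots> \<le> \<bar>c\<bar> * cmod (T f q)" by (rule sq[OF q pos])
        finally show ?thesis using pos by (simp add: power2_eq_square)
      qed simp
      then show ?thesis using q[of p] by linarith
    qed
    show ?thesis unfolding K_def by (rule mnorm_le_sup[OF sup]) simp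
  qed
  have "bounded_by n K T"
    by (rule bounded_byI[OF T K unit])
  then show ?thesis using K by blast
qed


subsection \<open>The operator norm does not depend on the level\<close>

text \<open>The square of the norm in the fibre over \<open>y\<close> at level \<open>n + 1\<close> is the sum over \<open>j\<close> of those in the
  fibres over \<open>\<gamma> j y\<close> at level \<open>n\<close>.\<close>

lemma bounded_by_Suc:
  assumes "bounded_by n c T" "0 \<le> c"
  shows "bounded_by (Suc n) c T"
  unfolding bounded_by_def
proof (intro ballI allI)
  fix f :: "'k \<Rightarrow> complex" and y assume f: "f \<in> cont_fun"
  have "(fnorm (Suc n) (T f) y)\<^sup>2 \<le> (\<Sum>j=1..N. (c * fnorm n f (\<gamma> j y))\<^sup>2)"
    unfolding fnorm_Suc_sq using assms f by (intro sum_mono power_mono) (auto simp: bounded_by_def)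
  also have "\<dots> = (c * fnorm (Suc n) f y)\<^sup>2"
    by (simp add: power_mult_distrib fnorm_Suc_sq sum_distrib_left)
  finally show "fnorm (Suc n) (T f) y \<le> c * fnorm (Suc n) f y"
    by (rule power2_le_imp_le) (use assms in simp)
qed

text \<open>Multiplying by a function of \<open>h ^^ n\<close> that is \<open>1\<close> at \<open>z\<close> and \<open>0\<close> at the other points of the fibre
  of \<open>h\<close> through \<open>z\<close> isolates the part of the level \<open>n + 1\<close> fibre that lies over \<open>z\<close>. So no norm is lost in
  the passage from \<open>T\<close> to \<open>T \<otimes> I\<close>.\<close>

lemma bounded_by_Suc_D:
  assumes T: "adjointable n T" and B: "bounded_by (Suc n) c T" and c: "0 \<le> c"
  shows "bounded_by n c T"
  unfolding bounded_by_def
proof (intro ballI allI)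
  fix f :: "'k \<Rightarrow> complex" and z assume f: "f \<in> cont_fun"
  define y where "y = h z"
  obtain j\<^sub>0 where j0: "j\<^sub>0 \<in> {1..N}" "z = \<gamma> j\<^sub>0 y" using cover[of z] by (auto simp: y_def)
  obtain b :: "'k \<Rightarrow> complex" where b: "b \<in> cont_fun" "b z = 1"
      "\<And>q. q \<in> (\<lambda>j. \<gamma> j y) ` {1..N} - {z} \<Longrightarrow> b q = 0"
    using separating_function[of "(\<lambda>j. \<gamma> j y) ` {1..N} - {z}" z] by blast
  define m where "m = card {j \<in> {1..N}. \<gamma> j y = z}"
  have m: "m > 0" unfolding m_def using j0 by (subst card_gt_0_iff) auto
  have loc: "(fnorm (Suc n) (\<lambda>p. u p * b ((h ^^ n) p)) y)\<^sup>2 = real m * (fnorm n u z)\<^sup>2" for u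
  proof -
    have "(fnorm (Suc n) (\<lambda>p. u p * b ((h ^^ n) p)) y)\<^sup>2
        = (\<Sum>j=1..N. (fnorm n u (\<gamma> j y) * cmod (b (\<gamma> j y)))\<^sup>2)"
      by (simp add: fnorm_Suc_sq fnorm_shift)
    also have "\<dots> = (\<Sum>j=1..N. if \<gamma> j y = z then (fnorm n u z)\<^sup>2 else 0)"
      using b by (intro sum.cong) auto
    also have "\<dots> = real m * (fnorm n u z)\<^sup>2"
      by (subst sum.inter_filter[symmetric]) (auto simp: m_def)
    finally show ?thesis .
  qed
  let ?g = "\<lambda>p. f p * b ((h ^^ n) p)"
  have g: "?g \<in> cont_fun" by (intro cont_fun_intros cont_fun_shift f b(1))
  have "fnorm (Suc n) (T ?g) y \<le> c * fnorm (Suc n) ?g y"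
    using B g by (simp add: bounded_by_def)
  then have "(fnorm (Suc n) (T ?g) y)\<^sup>2 \<le> (c * fnorm (Suc n) ?g y)\<^sup>2"
    by (rule power_mono) simp
  then have "real m * (fnorm n (T f) z)\<^sup>2 \<le> c\<^sup>2 * (real m * (fnorm n f z)\<^sup>2)"
    by (simp add: adjointable_shift[OF T f b(1)] loc power_mult_distrib)
  then have "(fnorm n (T f) z)\<^sup>2 \<le> (c * fnorm n f z)\<^sup>2"
    using m by (simp add: power_mult_distrib)
  then show "fnorm n (T f) z \<le> c * fnorm n f z"
    by (rule power2_le_imp_le) (use c in simp)
qed

definition opnorm :: "nat \<Rightarrow> 'k fun_op \<Rightarrow> real" where
  "opnorm n T = (SUP f\<in>{f \<in> cont_fun. mnorm n f \<le> 1}. mnorm n (T f))"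

lemma zero_unit: "(\<lambda>_. 0) \<in> {f \<in> cont_fun. mnorm n f \<le> 1}"
proof -
  have "mnorm n (\<lambda>_. 0) \<le> 1"
    by (rule mnorm_leI) (simp add: fnorm_def L2_set_def)
  then show ?thesis by (simp add: cont_fun_const)
qed

lemma opnorm_le:
  assumes "bounded_by n c T" "0 \<le> c"
  shows "opnorm n T \<le> c"
  unfolding opnorm_def
proof (rule cSUP_least)
  show "{f \<in> cont_fun. mnorm n f \<le> 1} \<noteq> {}" using zero_unit by blast
  fix f assume f: "f \<in> {f \<in> cont_fun. mnorm n f \<le> 1}"
  have "fnorm n (T f) y \<le> c" for y
  proof -
    have "fnorm n (T f) y \<le> c * fnorm n f y" using assms f by (simp add: bounded_by_def)
    also have "\<dots> \<le> c * 1"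
      using fnorm_le_mnorm[of f n y] f assms by (intro mult_left_mono) auto
    finally show ?thesis by simp
  qed
  then show "mnorm n (T f) \<le> c" by (rule mnorm_leI)
qed

lemma opnorm:
  assumes T: "adjointable n T"
  shows "0 \<le> opnorm n T" "bounded_by n (opnorm n T) T"
proof -
  obtain c where c: "0 \<le> c" "bounded_by n c T" using adjointable_bounded[OF T] by blast
  have bdd: "bdd_above ((\<lambda>f. mnorm n (T f)) ` {f \<in> cont_fun. mnorm n f \<le> 1})"
  proof (rule bdd_aboveI2)
    fix f assume f: "f \<in> {f \<in> cont_fun. mnorm n f \<le> 1}"
    have "fnorm n (T f) y \<le> c" for y
    proof -
      have "fnorm n (T f) y \<le> c * fnorm n f y" using c f by (simp add: bounded_by_def)
      also have "\<dots> \<le> c * 1"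
        using fnorm_le_mnorm[of f n y] f c by (intro mult_left_mono) auto
      finally show ?thesis by simp
    qed
    then show "mnorm n (T f) \<le> c" by (rule mnorm_leI)
  qed
  have le: "mnorm n (T f) \<le> opnorm n T" if "f \<in> cont_fun" "mnorm n f \<le> 1" for f
    unfolding opnorm_def using bdd that by (intro cSUP_upper) auto
  show nonneg: "0 \<le> opnorm n T"
    using le[of "\<lambda>_. 0"] zero_unit[of n] mnorm_nonneg[OF adjointable_closed[OF T, of "\<lambda>_. 0"], of n]
    by (auto simp: cont_fun_const)
  show "bounded_by n (opnorm n T) T"
    by (rule bounded_byI[OF T nonneg le])
qed

lemma opnorm_mono_level:
  assumes "adjointable n T" "n \<le> m"
  shows "opnorm m T = opnorm n T"
  using assms(2)
proof (induction rule: dec_induct)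
  case (step m)
  have m: "adjointable m T" "adjointable (Suc m) T"
    using adjointable_mono[OF assms(1)] step by auto
  have "opnorm (Suc m) T = opnorm m T"
  proof (rule antisym)
    show "opnorm (Suc m) T \<le> opnorm m T"
      by (rule opnorm_le[OF bounded_by_Suc[OF opnorm(2)[OF m(1)] opnorm(1)[OF m(1)]] opnorm(1)[OF m(1)]])
    show "opnorm m T \<le> opnorm (Suc m) T"
      by (rule opnorm_le[OF bounded_by_Suc_D[OF m(1) opnorm(2)[OF m(2)] opnorm(1)[OF m(2)]] opnorm(1)[OF m(2)]])
  qed
  then show ?case using step by simp
qed simp

text \<open>The operator norm at any level at which \<open>T\<close> is adjointable; by \<open>opnorm_mono_level\<close> the choice of
  the level does not matter.\<close>

definition unorm :: "'k fun_op \<Rightarrow> real" where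
  "unorm T = opnorm (LEAST n. adjointable n T) T"

lemma opnorm_eq_unorm: "adjointable n T \<Longrightarrow> opnorm n T = unorm T"
  unfolding unorm_def by (rule opnorm_mono_level) (auto intro: LeastI Least_le)

lemma unorm_nonneg: "adjointable n T \<Longrightarrow> 0 \<le> unorm T"
  using opnorm opnorm_eq_unorm by metis

lemma unorm_bound: "adjointable n T \<Longrightarrow> f \<in> cont_fun \<Longrightarrow> fnorm n (T f) y \<le> unorm T * fnorm n f y"
  using opnorm(2) opnorm_eq_unorm by (auto simp: bounded_by_def)

lemma unorm_leI:
  assumes "adjointable n T" "0 \<le> c" "\<And>f y. f \<in> cont_fun \<Longrightarrow> fnorm n (T f) y \<le> c * fnorm n f y"
  shows "unorm T \<le> c"
  using opnorm_le[of n c T] opnorm_eq_unorm[OF assms(1)] assms by (auto simp: bounded_by_def)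

lemma unorm_cong:
  assumes "\<And>f. f \<in> cont_fun \<Longrightarrow> T f = T' f"
  shows "unorm T = unorm T'"
proof -
  have "adjointable n T \<longleftrightarrow> adjointable n T'" for n using adjointable_cong assms by blast
  then show ?thesis unfolding unorm_def opnorm_def using assms by (auto intro!: SUP_cong)
qed

lemma unorm_zero: "unorm (\<lambda>f p. 0) = 0"
proof (rule antisym)
  show "unorm (\<lambda>f p. 0) \<le> 0"
    by (rule unorm_leI[OF adjointable_zero[of 0]]) (auto simp: fnorm_def L2_set_def)
qed (rule unorm_nonneg[OF adjointable_zero[of 0]])

lemma unorm_triangle:
  assumes "adjointable n T" "adjointable n T'" 
  shows "unorm (\<lambda>f p. T f p + T' f p) \<le> unorm T + unorm T'"
proof (rule unorm_leI)
  show "adjointable n (\<lambda>f p. T f p + T' f p)" using assms by (rule adjointable_plus)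
  show "0 \<le> unorm T + unorm T'" using assms unorm_nonneg by (metis add_nonneg_nonneg)
  fix f :: "'k \<Rightarrow> complex" and y assume f: "f \<in> cont_fun"
  have "fnorm n (\<lambda>p. T f p + T' f p) y \<le> fnorm n (T f) y + fnorm n (T' f) y"
    by (rule fnorm_triangle)
  also have "\<dots> \<le> unorm T * fnorm n f y + unorm T' * fnorm n f y"
    by (rule add_mono[OF unorm_bound[OF assms(1) f] unorm_bound[OF assms(2) f]])
  finally show "fnorm n (\<lambda>p. T f p + T' f p) y \<le> (unorm T + unorm T') * fnorm n f y"
    by (simp add: distrib_right)
qed

lemma unorm_cmult_le:
  assumes "adjointable n T"
  shows "unorm (\<lambda>f p. c * T f p) \<le> cmod c * unorm T"
proof (rule unorm_leI)
  show "adjointable n (\<lambda>f p. c * T f p)" using assms by (rule adjointable_cmult)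
  fix f :: "'k \<Rightarrow> complex" and y assume f: "f \<in> cont_fun"
  show "fnorm n (\<lambda>p. c * T f p) y \<le> cmod c * unorm T * fnorm n f y"
    using mult_left_mono[OF unorm_bound[OF assms f, of y], of "cmod c"] by (simp add: fnorm_scale mult.assoc)
qed (use assms unorm_nonneg in \<open>metis mult_nonneg_nonneg norm_ge_zero\<close>)

lemma unorm_comp:
  assumes "adjointable n T" "adjointable n T'" 
  shows "unorm (\<lambda>f. T (T' f)) \<le> unorm T * unorm T'"
proof (rule unorm_leI)
  show "adjointable n (\<lambda>f. T (T' f))" using assms by (rule adjointable_comp)
  show "0 \<le> unorm T * unorm T'" using assms unorm_nonneg by (metis mult_nonneg_nonneg)
  fix f :: "'k \<Rightarrow> complex" and y assume f: "f \<in> cont_fun"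
  have "fnorm n (T (T' f)) y \<le> unorm T * fnorm n (T' f) y"
    by (rule unorm_bound[OF assms(1) adjointable_closed[OF assms(2) f]])
  also have "\<dots> \<le> unorm T * (unorm T' * fnorm n f y)"
    by (rule mult_left_mono[OF unorm_bound[OF assms(2) f] unorm_nonneg[OF assms(1)]])
  finally show "fnorm n (T (T' f)) y \<le> unorm T * unorm T' * fnorm n f y"
    by (simp add: mult.assoc)
qed

text \<open>The C*-identity: \<open>\<parallel>T f\<parallel>\<^sup>2 = (f | S (T f)) \<le> \<parallel>f\<parallel> \<parallel>S\<parallel> \<parallel>T f\<parallel>\<close> in every fibre.\<close>

lemma unorm_adjoint_le:
  assumes "adjoint_pair n T S"
  shows "unorm T \<le> unorm S"
proof (rule unorm_leI)
  show T: "adjointable n T" using assms by (rule adjointableI)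
  have S: "adjointable n S" using assms adjoint_pair_sym adjointableI by blast
  show "0 \<le> unorm S" using S unorm_nonneg by blast
  fix f :: "'k \<Rightarrow> complex" and y assume f: "f \<in> cont_fun"
  have Tf: "T f \<in> cont_fun" by (rule adjointable_closed[OF T f])
  have "(fnorm n (T f) y)\<^sup>2 = cmod (ip n f (S (T f)) y)"
    using adjoint_pair_ip[OF assms f Tf] by (simp flip: cmod_ip_self)
  also have "\<dots> \<le> fnorm n f y * fnorm n (S (T f)) y" by (rule ip_cauchy_schwarz)
  also have "\<dots> \<le> fnorm n f y * (unorm S * fnorm n (T f) y)"
    by (rule mult_left_mono[OF unorm_bound[OF S Tf] fnorm_nonneg])
  finally have "fnorm n (T f) y * fnorm n (T f) y \<le> (unorm S * fnorm n f y) * fnorm n (T f) y"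
    by (simp add: power2_eq_square ac_simps)
  then show "fnorm n (T f) y \<le> unorm S * fnorm n f y"
    by (metis S fnorm_nonneg mult_nonneg_nonneg mult_right_le_imp_le order_le_less unorm_nonneg)
qed

lemma unorm_adjoint: "adjoint_pair n T S \<Longrightarrow> unorm T = unorm S"
  using unorm_adjoint_le adjoint_pair_sym antisym by metis


section \<open>Tensor powers as function spaces\<close>

abbreviation X :: "('k, 'k \<times> 'k \<Rightarrow> complex) hmod" where
  "X \<equiv> bimodule N \<gamma>"

text \<open>The function on \<open>K\<close> that represents the elementary tensor \<open>x\<^sub>1 \<otimes> \<dots> \<otimes> x\<^sub>n \<cdot> b\<close>.\<close>

fun tensor_fun :: "('k \<times> 'k \<Rightarrow> complex) list \<Rightarrow> ('k \<Rightarrow> complex) \<Rightarrow> 'k \<Rightarrow> complex" where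
  "tensor_fun [] b p = b p"
| "tensor_fun (x # xs) b p = x (p, h p) * tensor_fun xs b (h p)"

definition tsum_fun :: "('k, 'k \<times> 'k \<Rightarrow> complex) tsum \<Rightarrow> 'k \<Rightarrow> complex" where
  "tsum_fun u p = (\<Sum>(xs, b)\<leftarrow>u. tensor_fun xs b p)"

lemma tsum_fun_simps [simp]:
  "tsum_fun [] p = 0"
  "tsum_fun ((xs, b) # u) p = tensor_fun xs b p + tsum_fun u p"
  "tsum_fun (u @ v) p = tsum_fun u p + tsum_fun v p"
  by (simp_all add: tsum_fun_def)

lemma bimodule_simps [simp]:
  "lact X a x p = a (fst p) * x p"
  "inner_A X x y q = (\<Sum>j=1..N. cnj (x (\<gamma> j q, q)) * y (\<gamma> j q, q))"
  by (simp_all add: bimodule_def)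

lemma graph_in_cograph: "(p, h p) \<in> cograph N \<gamma>"
  using cover[of p] by (auto simp: cograph_def)

lemma carr_bimodule_cont:
  assumes "x \<in> carr X"
  shows "(\<lambda>p. x (p, h p)) \<in> cont_fun"
proof -
  have x: "continuous_on (cograph N \<gamma>) x" using assms by (simp add: bimodule_def)
  show ?thesis
    by (rule cont_funI, rule continuous_on_compose2[OF x])
       (auto intro!: continuous_intros h_cont graph_in_cograph)
qed

lemma lact_carr:
  assumes "x \<in> carr X" "a \<in> cont_fun"
  shows "lact X a x \<in> carr X"
proof -
  have "continuous_on (cograph N \<gamma>) (\<lambda>p. a (fst p))"
    by (rule continuous_on_compose2[OF cont_funD[OF assms(2)]]) (auto intro!: continuous_intros)
  then show ?thesis using assms by (auto simp: bimodule_def intro!: continuous_intros)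
qed

lemma tensor_fun_coeff:
  "tensor_fun xs b p = tensor_fun xs (\<lambda>_. 1) p * b ((h ^^ length xs) p)"
  by (induction xs arbitrary: p) (simp_all add: funpow_swap1)

lemma tensor_fun_snoc:
  "tensor_fun (xs @ [x]) b p = tensor_fun xs (\<lambda>q. x (q, h q) * b (h q)) p"
  by (induction xs arbitrary: p) auto

lemma tensor_fun_cont:
  "set xs \<subseteq> carr X \<Longrightarrow> b \<in> cont_fun \<Longrightarrow> tensor_fun xs b \<in> cont_fun"
proof (induction xs)
  case Nil
  have "tensor_fun [] b = b" by (rule ext) simp
  then show ?case using Nil by simp
next
  case (Cons x xs)
  have "tensor_fun (x # xs) b = (\<lambda>p. x (p, h p) * tensor_fun xs b ((h ^^ Suc 0) p))"
    by (rule ext) simp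
  moreover have "(\<lambda>p. x (p, h p)) \<in> cont_fun" using Cons by (intro carr_bimodule_cont) auto
  moreover have "(\<lambda>p. tensor_fun xs b ((h ^^ Suc 0) p)) \<in> cont_fun"
    using Cons by (intro cont_fun_shift) auto
  ultimately show ?case using cont_fun_mult by metis
qed

lemma tsumsD:
  "(xs, b) # u \<in> tsums X n \<Longrightarrow> length xs = n \<and> set xs \<subseteq> carr X \<and> b \<in> cont_fun \<and> u \<in> tsums X n"
  by (auto simp: tsums_def)

lemma tsum_fun_cont: "u \<in> tsums X n \<Longrightarrow> tsum_fun u \<in> cont_fun"
proof (induction u)
  case Nil
  have "tsum_fun [] = (\<lambda>_. 0)" by (rule ext) simp
  then show ?case by (simp add: cont_fun_const)
next
  case (Cons t u)
  obtain xs b where t: "t = (xs, b)" by (cases t)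
  have "tsum_fun (t # u) = (\<lambda>p. tensor_fun xs b p + tsum_fun u p)"
    by (rule ext) (simp add: t)
  then show ?case
    using Cons tsumsD[of xs b u n] tensor_fun_cont[of xs b] cont_fun_add t by auto
qed

text \<open>One step of the recursion for the inner product of tensors is one application of the transfer
  operator; the remaining factors are functions of \<open>h\<close> and move out of it.\<close>

lemma list_inner_eq:
  assumes "length xs = n" "length ys = n"
  shows "list_inner X a xs ys =
    fibre_sum n (\<lambda>p. a p * (cnj (tensor_fun xs (\<lambda>_. 1) p) * tensor_fun ys (\<lambda>_. 1) p))"
  using assms
proof (induction xs arbitrary: ys a n)
  case Nil
  then show ?case by simp
next
  case (Cons x xs)
  then obtain y ys' m where ys: "ys = y # ys'" "n = Suc m" "length xs = m" "length ys' = m"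
    by (cases ys) auto
  show ?case
    unfolding ys(1,2) fibre_sum_Suc[of m] list_inner.simps Cons.IH[OF ys(3,4)]
    by (rule arg_cong[where f = "fibre_sum m"])
       (auto simp: fun_eq_iff fibre_sum_1 h_inverse sum_distrib_left sum_distrib_right ac_simps intro!: sum.cong)
qed

lemma ip_tensor_fun:
  assumes "length xs = n" "length ys = n"
  shows "ip n (tensor_fun xs b) (tensor_fun ys c) k
    = cnj (b k) * list_inner X (\<lambda>_. 1) xs ys k * c k"
proof -
  have "tensor_fun xs b = (\<lambda>p. tensor_fun xs (\<lambda>_. 1) p * b ((h ^^ n) p))"
    and "tensor_fun ys c = (\<lambda>p. tensor_fun ys (\<lambda>_. 1) p * c ((h ^^ n) p))"
    using tensor_fun_coeff[of xs b] tensor_fun_coeff[of ys c] assms by (auto simp: fun_eq_iff)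
  then have "ip n (tensor_fun xs b) (tensor_fun ys c) k
      = ip n (tensor_fun xs (\<lambda>_. 1)) (tensor_fun ys (\<lambda>_. 1)) k * cnj (b k) * c k"
    by (simp only: ip_shift_left ip_shift_right) (simp only: ac_simps)
  then show ?thesis
    unfolding list_inner_eq[OF assms] by (simp add: ip_def ac_simps)
qed

lemma tsum_inner_eq:
  assumes "u \<in> tsums X n" "v \<in> tsums X n"
  shows "tsum_inner X u v k = ip n (tsum_fun u) (tsum_fun v) k"
proof -
  have zero: "ip n (\<lambda>_. 0) g k = 0" "ip n g (\<lambda>_. 0) k = 0" for g
    by (simp_all add: ip_def fibre_sum_def)
  have fun_nil: "tsum_fun [] = (\<lambda>_. 0)" by (rule ext) simp
  have fun_cons: "tsum_fun ((xs, b) # w) = (\<lambda>p. tensor_fun xs b p + tsum_fun w p)" for xs b w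
    by (rule ext) simp
  have right: "(\<Sum>(ys, c)\<leftarrow>v. cnj (b k) * list_inner X (\<lambda>_. 1) xs ys k * c k)
      = ip n (tensor_fun xs b) (tsum_fun v) k" if "length xs = n" for xs b
    using assms(2)
  proof (induction v)
    case (Cons t v)
    then show ?case
      using that by (cases t) (auto simp: fun_cons ip_add_right ip_tensor_fun dest!: tsumsD)
  qed (simp add: fun_nil zero)
  have "(\<Sum>(xs, b)\<leftarrow>u. ip n (tensor_fun xs b) (tsum_fun v) k) = ip n (tsum_fun u) (tsum_fun v) k"
    by (induction u) (auto simp: fun_nil fun_cons zero ip_add_left)
  moreover have "tsum_inner X u v k = (\<Sum>(xs, b)\<leftarrow>u. ip n (tensor_fun xs b) (tsum_fun v) k)"
    unfolding tsum_inner_def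
    by (rule arg_cong[where f = sum_list], rule map_cong[OF refl])
       (use right assms(1) in \<open>auto simp: tsums_def\<close>)
  ultimately show ?thesis by simp
qed

lemma tsums_append: "u \<in> tsums X n \<Longrightarrow> v \<in> tsums X n \<Longrightarrow> u @ v \<in> tsums X n"
  by (auto simp: tsums_def)

lemma tsums_scale: "u \<in> tsums X n \<Longrightarrow> tsum_scale c u \<in> tsums X n"
  by (auto simp: tsums_def tsum_scale_def intro!: cont_fun_intros)

lemma tsums_ract: "u \<in> tsums X n \<Longrightarrow> a \<in> cont_fun \<Longrightarrow> tsum_ract u a \<in> tsums X n"
  by (auto simp: tsums_def tsum_ract_def intro!: cont_fun_intros)

lemma tsums_lact_0: "u \<in> tsums X 0 \<Longrightarrow> a \<in> cont_fun \<Longrightarrow> tsum_lact X a u \<in> tsums X 0"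
  by (force simp: tsums_def tsum_lact_def intro!: cont_fun_intros)

lemma tsum_fun_scale: "tsum_fun (tsum_scale c u) p = c * tsum_fun u p"
proof (induction u)
  case (Cons t u)
  obtain xs b where t: "t = (xs, b)" by (cases t)
  have "tensor_fun xs (\<lambda>k. c * b k) p = c * tensor_fun xs b p"
    using tensor_fun_coeff[of xs b p] tensor_fun_coeff[of xs "\<lambda>k. c * b k" p] by simp
  then show ?case using Cons by (simp add: t tsum_scale_def distrib_left)
qed (simp add: tsum_scale_def)

lemma tsum_fun_ract:
  "u \<in> tsums X n \<Longrightarrow> tsum_fun (tsum_ract u a) p = tsum_fun u p * a ((h ^^ n) p)"
proof (induction u)
  case (Cons t u)
  obtain xs b where t: "t = (xs, b)" by (cases t)
  have "tensor_fun xs (\<lambda>k. b k * a k) p = tensor_fun xs b p * a ((h ^^ length xs) p)"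
    using tensor_fun_coeff[of xs b p] tensor_fun_coeff[of xs "\<lambda>k. b k * a k" p] by simp
  then show ?case
    using Cons tsumsD[of xs b u n] by (simp add: t tsum_ract_def distrib_right)
qed (simp add: tsum_ract_def)

lemma tsum_fun_lact_0:
  "u \<in> tsums X 0 \<Longrightarrow> tsum_fun (tsum_lact X a u) p = a p * tsum_fun u p"
proof (induction u)
  case (Cons t u)
  obtain xs b where t: "t = (xs, b)" by (cases t)
  then show ?case
    using Cons tsumsD[of xs b u 0] by (simp add: tsum_lact_def distrib_left)
qed (simp add: tsum_lact_def)

definition tsum_tensor_right ::
  "('k, 'k \<times> 'k \<Rightarrow> complex) tsum \<Rightarrow> ('k \<times> 'k \<Rightarrow> complex) \<Rightarrow> ('k, 'k \<times> 'k \<Rightarrow> complex) tsum" where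
  "tsum_tensor_right u x = map (\<lambda>(xs, b). (xs @ [lact X b x], \<lambda>_. 1)) u"

lemma tsums_tensor_right:
  assumes "u \<in> tsums X n" "x \<in> carr X"
  shows "tsum_tensor_right u x \<in> tsums X (Suc n)"
proof -
  have "lact X b x \<in> carr X" if "b \<in> cont_fun" for b by (rule lact_carr[OF assms(2) that])
  then show ?thesis
    using assms(1) unfolding tsums_def tsum_tensor_right_def by (fastforce simp: cont_fun_const)
qed

lemma tsum_fun_tensor_right:
  "u \<in> tsums X n \<Longrightarrow>
    tsum_fun (tsum_tensor_right u x) p = tsum_fun u p * x ((h ^^ n) p, (h ^^ Suc n) p)"
proof (induction u)
  case (Cons t u)
  obtain xs b where t: "t = (xs, b)" by (cases t)
  have n: "length xs = n" using tsumsD Cons t by blast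
  have "tensor_fun (xs @ [lact X b x]) (\<lambda>_. 1) p = tensor_fun xs b p * x ((h ^^ n) p, (h ^^ Suc n) p)"
    using tensor_fun_coeff[of xs b p] tensor_fun_coeff[of xs "\<lambda>q. lact X b x (q, h q) * 1" p]
    by (simp add: tensor_fun_snoc n)
  then show ?case
    using Cons tsumsD[of xs b u n] by (simp add: t tsum_tensor_right_def distrib_right)
qed (simp add: tsum_tensor_right_def)

text \<open>Every continuous function is represented by a single elementary tensor whose first factor carries
  the function, so no limits are needed to reach it.\<close>

definition elementary :: "nat \<Rightarrow> ('k \<Rightarrow> complex) \<Rightarrow> ('k, 'k \<times> 'k \<Rightarrow> complex) tsum" where
  "elementary n f = (case n of 0 \<Rightarrow> [([], f)]
     | Suc m \<Rightarrow> [((\<lambda>p. if p \<in> cograph N \<gamma> then f (fst p) else 0) #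
                   replicate m (indicator (cograph N \<gamma>)), \<lambda>_. 1)])"

lemma fst_in_carr:
  assumes "f \<in> cont_fun"
  shows "(\<lambda>p. if p \<in> cograph N \<gamma> then f (fst p) else 0) \<in> carr X"
proof -
  have "continuous_on (cograph N \<gamma>) (\<lambda>p. f (fst p))"
    by (rule continuous_on_compose2[OF cont_funD[OF assms]]) (auto intro!: continuous_intros)
  then have "continuous_on (cograph N \<gamma>) (\<lambda>p. if p \<in> cograph N \<gamma> then f (fst p) else 0)"
    by (rule continuous_on_eq) simp
  then show ?thesis by (simp add: bimodule_def)
qed

lemma indicator_in_carr: "indicator (cograph N \<gamma>) \<in> carr X"
proof -
  have "continuous_on (cograph N \<gamma>) (indicator (cograph N \<gamma>) :: 'k \<times> 'k \<Rightarrow> complex)"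
    by (rule continuous_on_eq[OF continuous_on_const[of _ 1]]) simp
  then show ?thesis by (simp add: bimodule_def)
qed

lemma elementary_tsums: "f \<in> cont_fun \<Longrightarrow> elementary n f \<in> tsums X n"
  using fst_in_carr[of f] indicator_in_carr
  by (cases n) (auto simp: elementary_def tsums_def cont_fun_const)

lemma tsum_fun_elementary: "tsum_fun (elementary n f) = f"
proof -
  have "tensor_fun (replicate m (indicator (cograph N \<gamma>))) (\<lambda>_. 1) p = 1" for m p
    by (induction m arbitrary: p) (simp_all add: graph_in_cograph)
  then show ?thesis
    by (cases n) (auto simp: elementary_def fun_eq_iff graph_in_cograph)
qed

lemma tsum_dist_eq:
  assumes "u \<in> tsums X n" "v \<in> tsums X n"
  shows "tsum_dist X u v = mnorm n (\<lambda>p. tsum_fun u p - tsum_fun v p)"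
proof -
  let ?w = "u @ tsum_scale (- 1) v"
  have w: "?w \<in> tsums X n" by (intro tsums_append tsums_scale assms)
  have "tsum_fun ?w = (\<lambda>p. tsum_fun u p - tsum_fun v p)"
    by (rule ext) (simp add: tsum_fun_scale)
  then show ?thesis
    using tsum_inner_eq[OF w w] by (simp add: tsum_dist_def Let_def mnorm_def)
qed


subsection \<open>The completion\<close>

text \<open>The class of the completed tensor power that corresponds to the function \<open>f\<close>.\<close>

definition cls :: "nat \<Rightarrow> ('k \<Rightarrow> complex) \<Rightarrow> 'k btensor" where
  "cls n f = {s. (\<forall>m. s m \<in> tsums X n) \<and> uniform_limit UNIV (\<lambda>m. tsum_fun (s m)) f sequentially}"

lemma clsD:
  assumes "s \<in> cls n f"
  shows "s m \<in> tsums X n" "uniform_limit UNIV (\<lambda>m. tsum_fun (s m)) f sequentially"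
  using assms by (auto simp: cls_def)

text \<open>The module norms are equivalent to the supremum norm.\<close>

lemma mnorm_tendsto_0_iff:
  assumes "\<And>m. g m \<in> cont_fun"
  shows "(\<lambda>m. mnorm n (g m)) \<longlonglongrightarrow> 0 \<longleftrightarrow> uniform_limit UNIV g (\<lambda>_. 0) sequentially"
proof
  assume L: "(\<lambda>m. mnorm n (g m)) \<longlonglongrightarrow> 0"
  show "uniform_limit UNIV g (\<lambda>_. 0) sequentially"
  proof (rule uniform_limitI)
    fix e :: real assume "e > 0"
    with L have "\<forall>\<^sub>F m in sequentially. mnorm n (g m) < e" by (rule order_tendstoD)
    then show "\<forall>\<^sub>F m in sequentially. \<forall>x\<in>UNIV. dist (g m x) 0 < e"
      by eventually_elim (use cmod_le_mnorm[OF assms] in \<open>auto intro: le_less_trans\<close>)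
  qed
next
  assume L: "uniform_limit UNIV g (\<lambda>_. 0) sequentially"
  show "(\<lambda>m. mnorm n (g m)) \<longlonglongrightarrow> 0"
  proof (rule LIMSEQ_I)
    fix r :: real assume r: "r > 0"
    define e where "e = r / (2 * (sqrt (real (N ^ n)) + 1))"
    \<comment> \<open>The factor \<open>2\<close> makes the final estimate strict, the summand \<open>1\<close> keeps the denominator positive.\<close>
    have D: "0 < 2 * (sqrt (real (N ^ n)) + 1)" by (simp add: add_nonneg_pos)
    have e: "e > 0" unfolding e_def using r D by (rule divide_pos_pos)
    from uniform_limitD[OF L e] obtain M where M: "\<And>m x. m \<ge> M \<Longrightarrow> dist (g m x) 0 < e"
      by (auto simp: eventually_sequentially)
    have "norm (mnorm n (g m) - 0) < r" if "m \<ge> M" for m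
    proof -
      have "mnorm n (g m) \<le> sqrt (real (N ^ n)) * e"
        using M[OF that] e by (intro mnorm_le_sup) (auto simp: less_imp_le)
      also have "\<dots> \<le> (sqrt (real (N ^ n)) + 1) * e"
        using e by (intro mult_right_mono) auto
      also have "\<dots> = r / 2" unfolding e_def using D by (simp add: field_simps)
      also have "\<dots> < r" using r by simp
      finally show ?thesis using mnorm_nonneg[OF assms] by simp
    qed
    then show "\<exists>M. \<forall>m\<ge>M. norm (mnorm n (g m) - 0) < r" by blast
  qed
qed

lemma cauchy_seqs_cls:
  assumes s: "s \<in> cauchy_seqs (tsums X n) (tsum_dist X)"
  obtains f where "f \<in> cont_fun" "s \<in> cls n f"
proof -
  have sm: "s m \<in> tsums X n" for m using s by (auto simp: cauchy_seqs_def)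
  have C: "tsum_fun (s m) \<in> cont_fun" for m using tsum_fun_cont[OF sm] .
  have "uniformly_Cauchy_on UNIV (\<lambda>m. tsum_fun (s m))"
    unfolding uniformly_Cauchy_on_def
  proof (intro allI impI)
    fix e :: real assume "e > 0"
    then have "\<exists>M. \<forall>m\<ge>M. \<forall>k\<ge>M. tsum_dist X (s m) (s k) < e"
      using s by (simp add: cauchy_seqs_def)
    then obtain M where M: "\<And>m k. m \<ge> M \<Longrightarrow> k \<ge> M \<Longrightarrow> tsum_dist X (s m) (s k) < e"
      by blast
    have "dist (tsum_fun (s m) x) (tsum_fun (s k) x) < e" if "m \<ge> M" "k \<ge> M" for m k x
      using M[OF that] cmod_le_mnorm[OF cont_fun_diff[OF C[of m] C[of k]], of x n]
      by (simp add: tsum_dist_eq[OF sm sm] dist_norm)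
    then show "\<exists>M. \<forall>x\<in>UNIV. \<forall>m\<ge>M. \<forall>k\<ge>M. dist (tsum_fun (s m) x) (tsum_fun (s k) x) < e"
      by blast
  qed
  then have "uniformly_convergent_on UNIV (\<lambda>m. tsum_fun (s m))"
    by (rule Cauchy_uniformly_convergent)
  then obtain f where f: "uniform_limit UNIV (\<lambda>m. tsum_fun (s m)) f sequentially"
    by (auto simp: uniformly_convergent_on_def)
  have "f \<in> cont_fun"
    by (rule cont_funI, rule uniform_limit_theorem[OF _ f]) (use cont_funD[OF C] in auto)
  moreover have "s \<in> cls n f" using f sm by (simp add: cls_def)
  ultimately show ?thesis using that by blast
qed

lemma cls_cauchy_seqs:
  assumes s: "s \<in> cls n f" and f: "f \<in> cont_fun"
  shows "s \<in> cauchy_seqs (tsums X n) (tsum_dist X)"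
proof -
  have sm: "s m \<in> tsums X n" for m using clsD[OF s] by simp
  have C: "tsum_fun (s m) \<in> cont_fun" for m using tsum_fun_cont[OF sm] .
  have D: "(\<lambda>p. f p - tsum_fun (s m) p) \<in> cont_fun" for m by (intro cont_fun_intros f C)
  have "uniform_limit UNIV (\<lambda>m p. f p - tsum_fun (s m) p) (\<lambda>_. 0) sequentially"
    using uniform_limit_minus[OF uniform_limit_const clsD(2)[OF s], of f] by simp
  then have lim: "(\<lambda>m. mnorm n (\<lambda>p. f p - tsum_fun (s m) p)) \<longlonglongrightarrow> 0"
    by (rule iffD2[OF mnorm_tendsto_0_iff[of "\<lambda>m p. f p - tsum_fun (s m) p", OF D]])
  have tri: "tsum_dist X (s m) (s k)
      \<le> mnorm n (\<lambda>p. f p - tsum_fun (s m) p) + mnorm n (\<lambda>p. f p - tsum_fun (s k) p)" for m k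
    unfolding tsum_dist_eq[OF sm sm]
  proof (rule mnorm_leI)
    fix y
    have "fnorm n (\<lambda>p. (- 1) * (f p - tsum_fun (s m) p) + (f p - tsum_fun (s k) p)) y
      \<le> fnorm n (\<lambda>p. f p - tsum_fun (s m) p) y + fnorm n (\<lambda>p. f p - tsum_fun (s k) p) y"
      by (rule order_trans[OF fnorm_triangle]) (simp only: fnorm_scale, simp)
    also have "\<dots> \<le> mnorm n (\<lambda>p. f p - tsum_fun (s m) p) + mnorm n (\<lambda>p. f p - tsum_fun (s k) p)"
      by (intro add_mono fnorm_le_mnorm D)
    finally show "fnorm n (\<lambda>p. tsum_fun (s m) p - tsum_fun (s k) p) y \<le> \<dots>" by simp
  qed
  have "\<exists>M. \<forall>m\<ge>M. \<forall>k\<ge>M. tsum_dist X (s m) (s k) < e" if "e > 0" for e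
  proof -
    have "\<forall>\<^sub>F m in sequentially. mnorm n (\<lambda>p. f p - tsum_fun (s m) p) < e / 2"
      using lim by (rule order_tendstoD) (use that in simp)
    then obtain M where M: "\<And>m. m \<ge> M \<Longrightarrow> mnorm n (\<lambda>p. f p - tsum_fun (s m) p) < e / 2"
      by (auto simp: eventually_sequentially)
    have "tsum_dist X (s m) (s k) < e" if "m \<ge> M" "k \<ge> M" for m k
      using tri[of m k] M[OF that(1)] M[OF that(2)] by linarith
    then show ?thesis by blast
  qed
  then show ?thesis using sm by (auto simp: cauchy_seqs_def)
qed

text \<open>Two sequences of tensor sums have distances tending to \<open>0\<close> if and only if their functions have the
  same uniform limit.\<close>

lemma tclass_eq:
  assumes s: "s \<in> cls n f" and f: "f \<in> cont_fun"
  shows "tclass X n s = cls n f"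
proof -
  have "(\<lambda>m. tsum_dist X (s m) (t m)) \<longlonglongrightarrow> 0 \<longleftrightarrow> t \<in> cls n f" if t: "\<And>m. t m \<in> tsums X n" for t
  proof -
    have "(\<lambda>m. tsum_dist X (s m) (t m)) \<longlonglongrightarrow> 0 \<longleftrightarrow>
        uniform_limit UNIV (\<lambda>m p. tsum_fun (s m) p - tsum_fun (t m) p) (\<lambda>_. 0) sequentially"
      unfolding tsum_dist_eq[OF clsD(1)[OF s] t]
      by (intro mnorm_tendsto_0_iff cont_fun_diff tsum_fun_cont[OF clsD(1)[OF s]] tsum_fun_cont[OF t])
    also have "\<dots> \<longleftrightarrow> t \<in> cls n f"
      using uniform_limit_diff_0_iff[OF clsD(2)[OF s]] t by (simp add: cls_def)
    finally show ?thesis .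
  qed
  moreover have "t m \<in> tsums X n" if "t \<in> cauchy_seqs (tsums X n) (tsum_dist X)" for t m
    using that by (auto simp: cauchy_seqs_def)
  ultimately show ?thesis
    using cls_cauchy_seqs[OF _ f] clsD(1) unfolding seq_class_def by blast
qed

lemma elementary_in_cls:
  assumes "f \<in> cont_fun"
  shows "(\<lambda>_. elementary n f) \<in> cls n f"
  using elementary_tsums[OF assms] by (auto simp: cls_def tsum_fun_elementary intro: uniform_limit_const)

text \<open>A Cauchy sequence of tensor sums gives a uniformly convergent sequence of continuous functions,
  and every continuous function already comes from an elementary tensor.\<close>

lemma carr_bpower: "carr (bpower N \<gamma> n) = cls n ` cont_fun"
proof -
  have "completion (tsums X n) (tsum_dist X) = cls n ` cont_fun"
  proof (intro equalityI subsetI)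
    fix P assume "P \<in> completion (tsums X n) (tsum_dist X)"
    then obtain s where s: "s \<in> cauchy_seqs (tsums X n) (tsum_dist X)" "P = tclass X n s"
      by (auto simp: completion_def)
    obtain f where f: "f \<in> cont_fun" "s \<in> cls n f" using cauchy_seqs_cls[OF s(1)] .
    show "P \<in> cls n ` cont_fun" using tclass_eq[OF f(2,1)] s f by blast
  next
    fix P assume "P \<in> cls n ` cont_fun"
    then obtain f where f: "f \<in> cont_fun" "P = cls n f" by blast
    show "P \<in> completion (tsums X n) (tsum_dist X)"
      unfolding completion_def f(2)
      by (rule image_eqI[where x = "\<lambda>_. elementary n f"])
         (simp_all add: tclass_eq[OF elementary_in_cls f(1)] cls_cauchy_seqs[OF elementary_in_cls f(1)] f(1))
  qed
  then show ?thesis by (simp add: tpower_def)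
qed

lemma cls_in_carr: "f \<in> cont_fun \<Longrightarrow> cls n f \<in> carr (bpower N \<gamma> n)"
  by (simp add: carr_bpower)

lemma cls_inj:
  assumes "cls n f = cls n g" "f \<in> cont_fun"
  shows "f = g"
proof -
  have "(\<lambda>_. elementary n f) \<in> cls n g" using elementary_in_cls[OF assms(2)] assms(1) by blast
  then have "uniform_limit UNIV (\<lambda>_::nat. f) g sequentially"
    using clsD(2)[of "\<lambda>_. elementary n f" n g] by (simp add: tsum_fun_elementary)
  then have "(\<lambda>_::nat. f p) \<longlonglongrightarrow> g p" for p by (rule tendsto_uniform_limitI) simp
  then show ?thesis by (metis LIMSEQ_const_iff ext)
qed

definition val :: "nat \<Rightarrow> 'k btensor \<Rightarrow> 'k \<Rightarrow> complex" where
  "val n P = (THE f. f \<in> cont_fun \<and> P = cls n f)"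

lemma val_cls [simp]: "f \<in> cont_fun \<Longrightarrow> val n (cls n f) = f"
  unfolding val_def using cls_inj by (intro the_equality) auto

lemma val_in_cont: "P \<in> carr (bpower N \<gamma> n) \<Longrightarrow> val n P \<in> cont_fun"
  by (auto simp: carr_bpower)

lemma cls_val: "P \<in> carr (bpower N \<gamma> n) \<Longrightarrow> cls n (val n P) = P"
  by (auto simp: carr_bpower)

lemma rep_cls: "f \<in> cont_fun \<Longrightarrow> rep (cls n f) \<in> cls n f"
  unfolding rep_def by (rule someI[of _ "\<lambda>_. elementary n f"]) (rule elementary_in_cls)

lemma uniform_limit_mult_fixed:
  fixes a :: "'k \<Rightarrow> complex"
  assumes "uniform_limit UNIV F f sequentially" "a \<in> cont_fun"
  shows "uniform_limit UNIV (\<lambda>m p. F m p * a p) (\<lambda>p. f p * a p) sequentially"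
proof (rule uniform_limitI)
  fix e :: real assume e: "e > 0"
  obtain b where b: "0 \<le> b" "\<And>p. norm (a p) \<le> b" using bounded_cont[OF cont_funD[OF assms(2)]] by blast
  have "\<forall>\<^sub>F m in sequentially. \<forall>p\<in>UNIV. dist (F m p) (f p) < e / (b + 1)"
    using assms(1) by (rule uniform_limitD) (use e b in simp)
  then show "\<forall>\<^sub>F m in sequentially. \<forall>p\<in>UNIV. dist (F m p * a p) (f p * a p) < e"
  proof eventually_elim
    case (elim m)
    show ?case
    proof
      fix p
      have "dist (F m p * a p) (f p * a p) = dist (F m p) (f p) * norm (a p)"
        by (simp add: dist_norm norm_mult flip: left_diff_distrib)
      also have "\<dots> \<le> dist (F m p) (f p) * (b + 1)"
        using b(2)[of p] by (intro mult_left_mono) auto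
      also have "\<dots> < e / (b + 1) * (b + 1)"
        using elim b by (intro mult_strict_right_mono) auto
      finally show "dist (F m p * a p) (f p * a p) < e" using b by simp
    qed
  qed
qed

context
  fixes n :: nat and f g :: "'k \<Rightarrow> complex"
  assumes f: "f \<in> cont_fun" and g: "g \<in> cont_fun"
begin

lemma add_cls: "add (bpower N \<gamma> n) (cls n f) (cls n g) = cls n (\<lambda>p. f p + g p)"
proof -
  have "(\<lambda>m. rep (cls n f) m @ rep (cls n g) m) \<in> cls n (\<lambda>p. f p + g p)"
    using rep_cls[OF f, of n] rep_cls[OF g, of n]
    unfolding cls_def
    by (auto intro!: tsums_append uniform_limit_add simp: tsum_fun_simps(3)[abs_def])
  then show ?thesis
    by (simp add: tpower_def tclass_eq cont_fun_add f g)
qed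

lemma scale_cls: "scale (bpower N \<gamma> n) c (cls n f) = cls n (\<lambda>p. c * f p)"
proof -
  have "uniform_limit UNIV (\<lambda>m p. tsum_fun (rep (cls n f) m) p * c) (\<lambda>p. f p * c) sequentially"
    by (rule uniform_limit_mult_fixed[OF clsD(2)[OF rep_cls[OF f]] cont_fun_const])
  then have "(\<lambda>m. tsum_scale c (rep (cls n f) m)) \<in> cls n (\<lambda>p. c * f p)"
    using clsD(1)[OF rep_cls[OF f, of n]]
    by (auto simp: cls_def tsum_fun_scale[abs_def] mult.commute intro!: tsums_scale)
  then show ?thesis
    by (simp add: tpower_def tclass_eq cont_fun_mult cont_fun_const f)
qed

lemma ract_cls: "ract (bpower N \<gamma> n) (cls n f) g = cls n (\<lambda>p. f p * g ((h ^^ n) p))"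
proof -
  have "uniform_limit UNIV (\<lambda>m p. tsum_fun (rep (cls n f) m) p * g ((h ^^ n) p))
      (\<lambda>p. f p * g ((h ^^ n) p)) sequentially"
    by (rule uniform_limit_mult_fixed[OF clsD(2)[OF rep_cls[OF f]] cont_fun_shift[OF g]])
  moreover have "tsum_fun (tsum_ract (rep (cls n f) m) g)
      = (\<lambda>p. tsum_fun (rep (cls n f) m) p * g ((h ^^ n) p))" for m
    using tsum_fun_ract[OF clsD(1)[OF rep_cls[OF f]]] by (rule ext)
  ultimately have "(\<lambda>m. tsum_ract (rep (cls n f) m) g) \<in> cls n (\<lambda>p. f p * g ((h ^^ n) p))"
    using clsD(1)[OF rep_cls[OF f, of n]]
    by (auto simp: cls_def intro!: tsums_ract g)
  then show ?thesis
    by (simp add: tpower_def tclass_eq cont_fun_mult cont_fun_shift f g)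
qed

lemma lact_cls: "lact (bpower N \<gamma> 0) g (cls 0 f) = cls 0 (\<lambda>p. g p * f p)"
proof -
  have "uniform_limit UNIV (\<lambda>m p. tsum_fun (rep (cls 0 f) m) p * g p) (\<lambda>p. f p * g p) sequentially"
    by (rule uniform_limit_mult_fixed[OF clsD(2)[OF rep_cls[OF f]] g])
  moreover have "tsum_fun (tsum_lact X g (rep (cls 0 f) m))
      = (\<lambda>p. tsum_fun (rep (cls 0 f) m) p * g p)" for m
    using tsum_fun_lact_0[OF clsD(1)[OF rep_cls[OF f]]] by (auto simp: mult.commute)
  ultimately have "(\<lambda>m. tsum_lact X g (rep (cls 0 f) m)) \<in> cls 0 (\<lambda>p. g p * f p)"
    using clsD(1)[OF rep_cls[OF f, of 0]]
    by (auto simp: cls_def mult.commute intro!: tsums_lact_0 g)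
  then show ?thesis
    by (simp add: tpower_def tclass_eq cont_fun_mult f g)
qed

lemma inner_cls: "inner_A (bpower N \<gamma> n) (cls n f) (cls n g) = ip n f g"
proof
  fix k
  let ?s = "\<lambda>m. tsum_fun (rep (cls n f) m)" and ?t = "\<lambda>m. tsum_fun (rep (cls n g) m)"
  have "(\<lambda>m. ?s m p) \<longlonglongrightarrow> f p" "(\<lambda>m. ?t m p) \<longlonglongrightarrow> g p" for p
    by (rule tendsto_uniform_limitI[OF clsD(2)[OF rep_cls[OF f]] UNIV_I]
          tendsto_uniform_limitI[OF clsD(2)[OF rep_cls[OF g]] UNIV_I])+
  then have "(\<lambda>m. ip n (?s m) (?t m) k) \<longlonglongrightarrow> ip n f g k"
    unfolding ip_def fibre_sum_def by (intro tendsto_intros)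
  then have "lim (\<lambda>m. ip n (?s m) (?t m) k) = ip n f g k" by (rule limI)
  then show "inner_A (bpower N \<gamma> n) (cls n f) (cls n g) k = ip n f g k"
    using tsum_inner_eq[OF clsD(1)[OF rep_cls[OF f]] clsD(1)[OF rep_cls[OF g]]]
    by (simp add: tpower_def)
qed

end

lemma hnorm_cls: "f \<in> cont_fun \<Longrightarrow> hnorm (bpower N \<gamma> n) (cls n f) = mnorm n f"
  unfolding hnorm_def mnorm_def by (simp add: inner_cls)

lemma tensor_right_cls:
  assumes f: "f \<in> cont_fun" and x: "x \<in> carr X"
  shows "tensor_right X n (cls n f) x = cls (Suc n) (\<lambda>p. f p * x ((h ^^ n) p, (h ^^ Suc n) p))"
proof -
  let ?x = "\<lambda>p. x ((h ^^ n) p, (h ^^ Suc n) p)"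
  have xC: "?x \<in> cont_fun"
    using cont_fun_shift[OF carr_bimodule_cont[OF x], of n] by simp
  have "uniform_limit UNIV (\<lambda>m p. tsum_fun (rep (cls n f) m) p * ?x p) (\<lambda>p. f p * ?x p) sequentially"
    by (rule uniform_limit_mult_fixed[OF clsD(2)[OF rep_cls[OF f]] xC])
  moreover have "tsum_fun (tsum_tensor_right (rep (cls n f) m) x)
      = (\<lambda>p. tsum_fun (rep (cls n f) m) p * ?x p)" for m
    using tsum_fun_tensor_right[OF clsD(1)[OF rep_cls[OF f]]] by (rule ext)
  ultimately have "(\<lambda>m. tsum_tensor_right (rep (cls n f) m) x) \<in> cls (Suc n) (\<lambda>p. f p * ?x p)"
    using clsD(1)[OF rep_cls[OF f, of n]]
    by (auto simp: cls_def simp del: funpow.simps intro!: tsums_tensor_right x)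
  then show ?thesis
    by (simp add: tensor_right_def tsum_tensor_right_def tclass_eq cont_fun_mult xC f del: funpow.simps)
qed


section \<open>Operators on the tensor powers\<close>

text \<open>\<open>op n\<close> and \<open>hat n\<close> translate between operators on \<open>C(K)\<close> and operators on the \<open>n\<close>-th tensor power.\<close>

definition op :: "nat \<Rightarrow> 'k fun_op \<Rightarrow> 'k bop" where
  "op n T = (\<lambda>P\<in>carr (bpower N \<gamma> n). cls n (T (val n P)))"

definition hat :: "nat \<Rightarrow> 'k bop \<Rightarrow> ('k \<Rightarrow> complex) \<Rightarrow> 'k \<Rightarrow> complex" where
  "hat n A = (\<lambda>f. val n (A (cls n f)))"

abbreviation L :: "nat \<Rightarrow> 'k bop cstar" where
  "L n \<equiv> adjointables (bpower N \<gamma> n)"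

lemma op_cls [simp]: "f \<in> cont_fun \<Longrightarrow> op n T (cls n f) = cls n (T f)"
  by (simp add: op_def cls_in_carr)

lemma op_extensional: "op n T \<in> extensional (carr (bpower N \<gamma> n))"
  by (simp add: op_def)

lemma op_eqI:
  assumes "A \<in> extensional (carr (bpower N \<gamma> n))" "\<And>f. f \<in> cont_fun \<Longrightarrow> A (cls n f) = cls n (T f)"
  shows "A = op n T"
  by (rule extensionalityI[OF assms(1) op_extensional]) (auto simp: carr_bpower assms(2))

lemma op_cong: "(\<And>f. f \<in> cont_fun \<Longrightarrow> T f = S f) \<Longrightarrow> op n T = op n S"
  by (rule op_eqI[OF op_extensional]) simp

lemma op_funcset: "(\<And>f. f \<in> cont_fun \<Longrightarrow> T f \<in> cont_fun) \<Longrightarrow>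
    op n T \<in> carr (bpower N \<gamma> n) \<rightarrow>\<^sub>E carr (bpower N \<gamma> n)"
  unfolding op_def by (rule restrict_PiE_iff[THEN iffD2]) (auto simp: carr_bpower)

lemma op_eqD:
  assumes "op n T = op n S" "f \<in> cont_fun" "T f \<in> cont_fun"
  shows "T f = S f"
  using assms by (metis cls_inj op_cls)

lemma hat_closed:
  assumes "A \<in> carr (bpower N \<gamma> n) \<rightarrow>\<^sub>E carr (bpower N \<gamma> n)" "f \<in> cont_fun"
  shows "hat n A f \<in> cont_fun"
  unfolding hat_def using assms by (intro val_in_cont) (auto simp: cls_in_carr)

lemma op_hat:
  assumes "A \<in> carr (bpower N \<gamma> n) \<rightarrow>\<^sub>E carr (bpower N \<gamma> n)"
  shows "op n (hat n A) = A"
proof (rule op_eqI[symmetric])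
  show "A \<in> extensional (carr (bpower N \<gamma> n))" using assms by (auto simp: PiE_def)
  show "A (cls n f) = cls n (hat n A f)" if "f \<in> cont_fun" for f
    unfolding hat_def using assms that by (intro cls_val[symmetric]) (auto simp: cls_in_carr)
qed

lemma hat_op: "f \<in> cont_fun \<Longrightarrow> T f \<in> cont_fun \<Longrightarrow> hat n (op n T) f = T f"
  by (simp add: hat_def)

lemma is_adjoint_op:
  assumes "\<And>f. f \<in> cont_fun \<Longrightarrow> T f \<in> cont_fun" "\<And>f. f \<in> cont_fun \<Longrightarrow> S f \<in> cont_fun"
  shows "is_adjoint (bpower N \<gamma> n) (op n T) (op n S) \<longleftrightarrow> adjoint_pair n T S"
  unfolding is_adjoint_def adjoint_pair_def
  using assms op_funcset[of S n] by (auto simp: carr_bpower inner_cls)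

lemma is_adjoint_opE:
  assumes "adjointable n T" "is_adjoint (bpower N \<gamma> n) (op n T) A"
  obtains S where "A = op n S" "adjoint_pair n T S"
proof -
  have A: "A \<in> carr (bpower N \<gamma> n) \<rightarrow>\<^sub>E carr (bpower N \<gamma> n)"
    using assms by (simp add: is_adjoint_def)
  have eq: "A = op n (hat n A)" by (simp add: op_hat[OF A])
  have "is_adjoint (bpower N \<gamma> n) (op n T) (op n (hat n A))" using assms(2) eq by simp
  then have "adjoint_pair n T (hat n A)"
    by (subst (asm) is_adjoint_op) (use adjointable_closed[OF assms(1)] hat_closed[OF A] in auto)
  with eq show ?thesis by (rule that)
qed

text \<open>Adjointability is a condition on inner products only, and these agree in both pictures.\<close>

lemma acarr_L: "acarr (L n) = op n ` {T. adjointable n T}"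
proof (intro equalityI subsetI)
  fix A assume "A \<in> acarr (L n)"
  then obtain S where A: "A \<in> carr (bpower N \<gamma> n) \<rightarrow>\<^sub>E carr (bpower N \<gamma> n)"
      and S: "is_adjoint (bpower N \<gamma> n) A S"
    by (auto simp: adjointables_def)
  have S': "S \<in> carr (bpower N \<gamma> n) \<rightarrow>\<^sub>E carr (bpower N \<gamma> n)"
    using S by (simp add: is_adjoint_def)
  have "is_adjoint (bpower N \<gamma> n) (op n (hat n A)) (op n (hat n S))"
    using S by (simp add: op_hat A S')
  then have "adjoint_pair n (hat n A) (hat n S)"
    by (subst (asm) is_adjoint_op) (use hat_closed[OF A] hat_closed[OF S'] in auto)
  then show "A \<in> op n ` {T. adjointable n T}"
    using op_hat[OF A] adjointableI by (metis image_eqI mem_Collect_eq)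
next
  fix A assume "A \<in> op n ` {T. adjointable n T}"
  then obtain T S where T: "A = op n T" "adjoint_pair n T S" by (auto simp: adjointable_def)
  then have "is_adjoint (bpower N \<gamma> n) A (op n S)"
    using is_adjoint_op[of T S n] adjoint_pair_closed[OF T(2)] by simp
  moreover have "A \<in> carr (bpower N \<gamma> n) \<rightarrow>\<^sub>E carr (bpower N \<gamma> n)"
    unfolding T(1) by (rule op_funcset) (rule adjoint_pair_closed(1)[OF T(2)])
  ultimately show "A \<in> acarr (L n)" by (auto simp: adjointables_def)
qed

lemma aadd_op:
  assumes "adjointable n S" "adjointable n T"
  shows "aadd (L n) (op n S) (op n T) = op n (\<lambda>f p. S f p + T f p)"
  by (rule op_eqI)
     (simp_all add: adjointables_def cls_in_carr add_cls adjointable_closed[OF assms(1)] adjointable_closed[OF assms(2)])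

lemma ascale_op:
  assumes "adjointable n T"
  shows "ascale (L n) c (op n T) = op n (\<lambda>f p. c * T f p)"
  by (rule op_eqI)
     (simp_all add: adjointables_def cls_in_carr scale_cls adjointable_closed[OF assms])

lemma amult_op:
  assumes "adjointable n T"
  shows "amult (L n) (op n S) (op n T) = op n (\<lambda>f. S (T f))"
  by (rule op_eqI)
     (simp_all add: adjointables_def cls_in_carr compose_def adjointable_closed[OF assms])

lemma astar_op:
  assumes "adjoint_pair n T S"
  shows "astar (L n) (op n T) = op n S"
proof -
  have "(THE A. is_adjoint (bpower N \<gamma> n) (op n T) A) = op n S"
  proof (rule the_equality)
    show "is_adjoint (bpower N \<gamma> n) (op n T) (op n S)"
      using is_adjoint_op[of T S n] adjoint_pair_closed[OF assms] assms by simp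
    fix A assume "is_adjoint (bpower N \<gamma> n) (op n T) A"
    then obtain S' where S': "A = op n S'" "adjoint_pair n T S'"
      using is_adjoint_opE[OF adjointableI[OF assms]] by blast
    show "A = op n S"
      unfolding S'(1) by (rule op_cong) (rule adjoint_unique[OF S'(2) assms refl])
  qed
  then show ?thesis by (simp add: adjointables_def)
qed

lemma anorm_op:
  assumes "adjointable n T"
  shows "anorm (L n) (op n T) = unorm T"
proof -
  have "{x \<in> carr (bpower N \<gamma> n). hnorm (bpower N \<gamma> n) x \<le> 1}
      = cls n ` {f \<in> cont_fun. mnorm n f \<le> 1}"
    by (auto simp: carr_bpower hnorm_cls)
  then have "anorm (L n) (op n T)
      = (SUP f\<in>{f \<in> cont_fun. mnorm n f \<le> 1}. hnorm (bpower N \<gamma> n) (op n T (cls n f)))"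
    by (simp add: adjointables_def image_image)
  also have "\<dots> = opnorm n T"
    unfolding opnorm_def by (rule SUP_cong) (simp_all add: hnorm_cls adjointable_closed[OF assms])
  finally show ?thesis by (simp add: opnorm_eq_unorm[OF assms])
qed

lemma adiff_op:
  assumes "adjointable n S" "adjointable n T"
  shows "adiff (L n) (op n S) (op n T) = op n (\<lambda>f p. S f p - T f p)"
  unfolding adiff_def ascale_op[OF assms(2)] aadd_op[OF assms(1) adjointable_cmult[OF assms(2)]]
  by (rule op_cong) simp

lemma anorm_adiff_op:
  assumes "adjointable n S" "adjointable n T"
  shows "anorm (L n) (adiff (L n) (op n S) (op n T)) = unorm (\<lambda>f p. S f p - T f p)"
  by (simp add: adiff_op[OF assms] anorm_op adjointable_minus[OF assms])

lemma theta_cls: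
  assumes "f \<in> cont_fun" "g \<in> cont_fun"
  shows "theta (bpower N \<gamma> n) (cls n f) (cls n g) = op n (rank1 n f g)"
  by (rule op_eqI) (simp_all add: theta_def cls_in_carr inner_cls ract_cls ip_cont rank1_def assms)

lemma left_op_0:
  assumes "a \<in> cont_fun"
  shows "left_op (bpower N \<gamma> 0) a = op 0 (\<lambda>f p. a p * f p)"
  by (rule op_eqI) (simp_all add: left_op_def cls_in_carr lact_cls assms)

lemma adjointable_left_mult:
  assumes "a \<in> cont_fun"
  shows "adjointable 0 (\<lambda>f p. a p * f p)"
proof -
  have "adjoint_pair 0 (\<lambda>f p. a p * f p) (\<lambda>f p. cnj (a p) * f p)"
    using assms by (auto simp: adjoint_pair_def ip_def fun_eq_iff ac_simps intro!: cont_fun_intros)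
  then show ?thesis by (rule adjointableI)
qed

text \<open>A tensor \<open>P \<otimes> x\<close> is represented by the function of \<open>P\<close> times a function of \<open>h ^^ n\<close>, and \<open>T\<close>
  commutes with multiplication by the latter. Uniqueness holds because the tensors \<open>P \<otimes> 1\<close> exhaust
  the next tensor power.\<close>

lemma tensor_id_op:
  assumes T: "adjointable n T"
  shows "tensor_id X n (op n T) = op (Suc n) T"
  unfolding tensor_id_def
proof (rule the_equality)
  have x: "\<exists>b\<in>cont_fun. \<forall>f\<in>cont_fun. tensor_right X n (cls n f) x = cls (Suc n) (\<lambda>p. f p * b ((h ^^ n) p))"
    if "x \<in> carr X" for x
    using carr_bimodule_cont[OF that] tensor_right_cls[OF _ that] by (intro bexI) auto
  have "op (Suc n) T (tensor_right X n P x) = tensor_right X n (op n T P) x"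
    if P: "P \<in> carr (bpower N \<gamma> n)" and xX: "x \<in> carr X" for P x
  proof -
    obtain f where f: "f \<in> cont_fun" "P = cls n f" using P unfolding carr_bpower by blast
    obtain b where b: "b \<in> cont_fun"
      "\<And>f. f \<in> cont_fun \<Longrightarrow> tensor_right X n (cls n f) x = cls (Suc n) (\<lambda>p. f p * b ((h ^^ n) p))"
      using x[OF xX] by blast
    have "(\<lambda>p. f p * b ((h ^^ n) p)) \<in> cont_fun" by (intro cont_fun_intros cont_fun_shift f(1) b(1))
    then show ?thesis
      by (simp add: f b(2) adjointable_closed[OF T] adjointable_shift[OF T f(1) b(1)])
  qed
  moreover have "op (Suc n) T \<in> acarr (L (Suc n))"
    using adjointable_mono[OF T, of "Suc n"] by (auto simp: acarr_L)
  ultimately show "op (Suc n) T \<in> acarr (L (Suc n)) \<and>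
      (\<forall>P\<in>carr (bpower N \<gamma> n). \<forall>x\<in>carr X.
         op (Suc n) T (tensor_right X n P x) = tensor_right X n (op n T P) x)"
    by blast
next
  fix S
  assume S: "S \<in> acarr (L (Suc n)) \<and> (\<forall>P\<in>carr (bpower N \<gamma> n). \<forall>x\<in>carr X.
         S (tensor_right X n P x) = tensor_right X n (op n T P) x)"
  have one: "tensor_right X n (cls n f) (indicator (cograph N \<gamma>)) = cls (Suc n) f" if "f \<in> cont_fun" for f
    using tensor_right_cls[OF that indicator_in_carr, of n] graph_in_cograph by simp
  show "S = op (Suc n) T"
  proof (rule op_eqI)
    show "S \<in> extensional (carr (bpower N \<gamma> (Suc n)))"
      using S by (auto simp: acarr_L op_extensional)
    fix f :: "'k \<Rightarrow> complex" assume f: "f \<in> cont_fun"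
    have "S (tensor_right X n (cls n f) (indicator (cograph N \<gamma>)))
        = tensor_right X n (op n T (cls n f)) (indicator (cograph N \<gamma>))"
      using S cls_in_carr[OF f] indicator_in_carr by blast
    then show "S (cls (Suc n) f) = cls (Suc n) (T f)"
      using f adjointable_closed[OF T f] by (simp add: one)
  qed
qed

lemma lift_by_op:
  assumes "adjointable n T"
  shows "lift_by (tensor_id X) n k (op n T) = op (n + k) T"
proof (induction k)
  case (Suc k)
  then show ?case using tensor_id_op[OF adjointable_mono[OF assms, of "n + k"]] by simp
qed simp


section \<open>Compact operators\<close>

inductive_set finite_rank :: "nat \<Rightarrow> 'k fun_op set" for n where
  zero: "(\<lambda>z p. 0) \<in> finite_rank n"
| add_rank1: "S \<in> finite_rank n \<Longrightarrow> f \<in> cont_fun \<Longrightarrow> g \<in> cont_fun \<Longrightarrow>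
     (\<lambda>z p. rank1 n f g z p + S z p) \<in> finite_rank n"

lemma finite_rank_adjoint:
  "S \<in> finite_rank n \<Longrightarrow> \<exists>S'\<in>finite_rank n. adjoint_pair n S S'"
proof (induction rule: finite_rank.induct)
  case zero
  then show ?case using adjoint_pair_zero finite_rank.zero by blast
next
  case (add_rank1 S f g)
  then obtain S' where S': "S' \<in> finite_rank n" "adjoint_pair n S S'" by blast
  then show ?case
    using adjoint_pair_add[OF adjoint_pair_rank1[OF add_rank1(2,3)] S'(2)] finite_rank.add_rank1[OF S'(1) add_rank1(3,2)]
    by blast
qed

lemma finite_rank_adjointable: "S \<in> finite_rank n \<Longrightarrow> adjointable n S"
  using finite_rank_adjoint adjointableI by blast

lemma finite_rank_add:
  "S \<in> finite_rank n \<Longrightarrow> T \<in> finite_rank n \<Longrightarrow> (\<lambda>z p. S z p + T z p) \<in> finite_rank n"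
proof (induction rule: finite_rank.induct)
  case (add_rank1 S f g)
  then have "(\<lambda>z p. rank1 n f g z p + (S z p + T z p)) \<in> finite_rank n"
    by (intro finite_rank.add_rank1) auto
  then show ?case by (simp add: add.assoc)
qed simp

lemma finite_rank_scale: "S \<in> finite_rank n \<Longrightarrow> (\<lambda>z p. c * S z p) \<in> finite_rank n"
proof (induction rule: finite_rank.induct)
  case (add_rank1 S f g)
  have "(\<lambda>z p. rank1 n (\<lambda>p. c * f p) g z p + c * S z p) \<in> finite_rank n"
    using add_rank1 by (intro finite_rank.add_rank1 cont_fun_intros) auto
  then show ?case by (simp add: rank1_def distrib_left mult.assoc)
qed (simp add: finite_rank.zero)

lemma rank1_in_finite_rank: "f \<in> cont_fun \<Longrightarrow> g \<in> cont_fun \<Longrightarrow> rank1 n f g \<in> finite_rank n"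
  using finite_rank.add_rank1[OF finite_rank.zero] by simp

lemma adjointable_rank1_comp:
  assumes "adjointable n T" "f \<in> cont_fun" "g \<in> cont_fun" "z \<in> cont_fun"
  shows "T (rank1 n f g z) = rank1 n (T f) g z"
  unfolding rank1_def using adjointable_shift[OF assms(1,2) ip_cont[OF assms(3,4)]] by simp

text \<open>This is \<open>T \<theta>\<^sub>f\<^sub>,\<^sub>g = \<theta>\<^sub>T\<^sub>f\<^sub>,\<^sub>g\<close> for each summand.\<close>

lemma finite_rank_comp:
  assumes T: "adjointable n T"
  shows "S \<in> finite_rank n \<Longrightarrow> \<exists>R\<in>finite_rank n. \<forall>z\<in>cont_fun. T (S z) = R z"
proof (induction rule: finite_rank.induct)
  case zero
  have "T (\<lambda>p. 0) = (\<lambda>p. 0)"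
    using adjointable_scale[OF T cont_fun_const[of 0], of 0] by simp
  then show ?case using finite_rank.zero by (intro bexI[of _ "\<lambda>z p. 0"]) auto
next
  case (add_rank1 S f g)
  then obtain R where R: "R \<in> finite_rank n" "\<And>z. z \<in> cont_fun \<Longrightarrow> T (S z) = R z" by blast
  have "T (\<lambda>p. rank1 n f g z p + S z p) = (\<lambda>p. rank1 n (T f) g z p + R z p)" if z: "z \<in> cont_fun" for z
  proof -
    have "T (\<lambda>p. rank1 n f g z p + S z p) = (\<lambda>p. T (rank1 n f g z) p + T (S z) p)"
      by (rule adjointable_add[OF T])
         (rule adjointable_closed[OF adjointable_rank1[OF add_rank1(2,3)] z]
               adjointable_closed[OF finite_rank_adjointable[OF add_rank1(1)] z])+
    then show ?thesis by (simp add: adjointable_rank1_comp[OF T add_rank1(2,3) z] R(2)[OF z])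
  qed
  then show ?case
    using finite_rank.add_rank1[OF R(1) adjointable_closed[OF T add_rank1(2)] add_rank1(3)]
    by (intro bexI) auto
qed

text \<open>The norm closure of the finite-rank operators, which turns out to contain the compact operators.\<close>

definition approximable :: "nat \<Rightarrow> 'k fun_op \<Rightarrow> bool" where
  "approximable n T \<longleftrightarrow> adjointable n T \<and>
     (\<forall>e>0. \<exists>S\<in>finite_rank n. unorm (\<lambda>f p. T f p - S f p) < e)"

lemma approximableD: "approximable n T \<Longrightarrow> adjointable n T"
  by (simp add: approximable_def)

lemma approximableE:
  assumes "approximable n T" "e > 0"
  obtains S where "S \<in> finite_rank n" "adjointable n S" "unorm (\<lambda>f p. T f p - S f p) < e"
  using assms finite_rank_adjointable unfolding approximable_def by blast

lemma finite_rank_approximable: "S \<in> finite_rank n \<Longrightarrow> approximable n S"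
  unfolding approximable_def using finite_rank_adjointable
  by (auto simp: unorm_zero intro!: bexI[of _ S])

lemma approximable_add:
  assumes "approximable n S" "approximable n T"
  shows "approximable n (\<lambda>f p. S f p + T f p)"
  unfolding approximable_def
proof (intro conjI allI impI)
  show "adjointable n (\<lambda>f p. S f p + T f p)"
    by (rule adjointable_plus) (rule assms[THEN approximableD])+
  fix e :: real assume "e > 0"
  then have e2: "e / 2 > 0" by simp
  obtain S' where S': "S' \<in> finite_rank n" "adjointable n S'" "unorm (\<lambda>f p. S f p - S' f p) < e / 2"
    using approximableE[OF assms(1) e2] .
  obtain T' where T': "T' \<in> finite_rank n" "adjointable n T'" "unorm (\<lambda>f p. T f p - T' f p) < e / 2"
    using approximableE[OF assms(2) e2] .
  have "unorm (\<lambda>f p. (S f p - S' f p) + (T f p - T' f p))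
      \<le> unorm (\<lambda>f p. S f p - S' f p) + unorm (\<lambda>f p. T f p - T' f p)"
    by (rule unorm_triangle)
       (rule adjointable_minus[OF approximableD[OF assms(1)] S'(2)]
             adjointable_minus[OF approximableD[OF assms(2)] T'(2)])+
  also have "\<dots> < e" using S' T' by simp
  finally have "unorm (\<lambda>f p. (S f p + T f p) - (S' f p + T' f p)) < e"
    by (simp add: algebra_simps)
  then show "\<exists>R\<in>finite_rank n. unorm (\<lambda>f p. S f p + T f p - R f p) < e"
    by (rule bexI[of _ "\<lambda>z p. S' z p + T' z p"]) (rule finite_rank_add[OF S'(1) T'(1)])
qed

lemma approximable_scale:
  assumes "approximable n T"
  shows "approximable n (\<lambda>f p. c * T f p)"
  unfolding approximable_def
proof (intro conjI allI impI)
  show "adjointable n (\<lambda>f p. c * T f p)"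
    by (rule adjointable_cmult) (rule assms[THEN approximableD])
  fix e :: real assume e: "e > 0"
  have c: "cmod c + 1 > 0" by (simp add: add_nonneg_pos)
  then have e2: "e / (cmod c + 1) > 0" using e by simp
  obtain S where S: "S \<in> finite_rank n" "adjointable n S" "unorm (\<lambda>f p. T f p - S f p) < e / (cmod c + 1)"
    using approximableE[OF assms(1) e2] .
  have D: "adjointable n (\<lambda>f p. T f p - S f p)"
    by (rule adjointable_minus[OF approximableD[OF assms] S(2)])
  have "unorm (\<lambda>f p. c * (T f p - S f p)) \<le> cmod c * unorm (\<lambda>f p. T f p - S f p)"
    by (rule unorm_cmult_le[OF D])
  also have "\<dots> \<le> (cmod c + 1) * unorm (\<lambda>f p. T f p - S f p)"
    using unorm_nonneg[OF D] by (intro mult_right_mono) auto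
  also have "\<dots> < e" using S c by (simp add: field_simps)
  finally have "unorm (\<lambda>f p. c * T f p - c * S f p) < e" by (simp add: algebra_simps)
  then show "\<exists>R\<in>finite_rank n. unorm (\<lambda>f p. c * T f p - R f p) < e"
    by (rule bexI[of _ "\<lambda>z p. c * S z p"]) (rule finite_rank_scale[OF S(1)])
qed

text \<open>It suffices to approximate the right factor, since the finite-rank operators are a left ideal.\<close>

lemma approximable_comp:
  assumes "approximable n S" "approximable n T"
  shows "approximable n (\<lambda>f. S (T f))"
  unfolding approximable_def
proof (intro conjI allI impI)
  note S = approximableD[OF assms(1)] and T = approximableD[OF assms(2)]
  show "adjointable n (\<lambda>f. S (T f))" by (rule adjointable_comp[OF S T])
  fix e :: real assume e: "e > 0"
  have c: "unorm S + 1 > 0" using unorm_nonneg[OF S] by linarith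
  then have e2: "e / (unorm S + 1) > 0" using e by simp
  obtain T' where T': "T' \<in> finite_rank n" "adjointable n T'"
      "unorm (\<lambda>f p. T f p - T' f p) < e / (unorm S + 1)"
    using approximableE[OF assms(2) e2] .
  obtain R where R: "R \<in> finite_rank n" "\<And>z. z \<in> cont_fun \<Longrightarrow> S (T' z) = R z"
    using finite_rank_comp[OF S T'(1)] by blast
  have D: "adjointable n (\<lambda>f p. T f p - T' f p)"
    by (rule adjointable_minus[OF T T'(2)])
  have "S (T f) = (\<lambda>p. S (\<lambda>p. T f p - T' f p) p + R f p)" if f: "f \<in> cont_fun" for f
    using adjointable_add[OF S adjointable_closed[OF D f] adjointable_closed[OF T'(2) f]]
    by (simp add: R(2)[OF f])
  then have "unorm (\<lambda>f p. S (T f) p - R f p) = unorm (\<lambda>f. S (\<lambda>p. T f p - T' f p))"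
    by (intro unorm_cong) simp
  also have "\<dots> \<le> unorm S * unorm (\<lambda>f p. T f p - T' f p)"
    by (rule unorm_comp[OF S D])
  also have "\<dots> \<le> (unorm S + 1) * unorm (\<lambda>f p. T f p - T' f p)"
    using unorm_nonneg[OF D] by (intro mult_right_mono) auto
  also have "\<dots> < e" using T' c by (simp add: field_simps)
  finally show "\<exists>R\<in>finite_rank n. unorm (\<lambda>f p. S (T f) p - R f p) < e"
    using R(1) by blast
qed

lemma adjoint_pair_minus:
  assumes "adjoint_pair n T S" "adjoint_pair n T' S'"
  shows "adjoint_pair n (\<lambda>f p. T f p - T' f p) (\<lambda>f p. S f p - S' f p)"
  using adjoint_pair_add[OF assms(1) adjoint_pair_scale[OF assms(2), of "-1"]] by simp

lemma approximable_adjoint: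
  assumes "approximable n T" "adjoint_pair n T T'"
  shows "approximable n T'"
  unfolding approximable_def
proof (intro conjI allI impI)
  show "adjointable n T'" using adjoint_pair_sym[OF assms(2)] by (rule adjointableI)
  fix e :: real assume e: "e > 0"
  obtain S where S: "S \<in> finite_rank n" "adjointable n S" "unorm (\<lambda>f p. T f p - S f p) < e"
    using approximableE[OF assms(1) e] .
  obtain S' where S': "S' \<in> finite_rank n" "adjoint_pair n S S'"
    using finite_rank_adjoint[OF S(1)] by blast
  have "unorm (\<lambda>f p. T' f p - S' f p) < e"
    using unorm_adjoint[OF adjoint_pair_minus[OF assms(2) S'(2)]] S(3) by simp
  then show "\<exists>R\<in>finite_rank n. unorm (\<lambda>f p. T' f p - R f p) < e" using S'(1) by blast
qed

lemma approximable_closed: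
  assumes T: "adjointable n T"
    and approx: "\<And>e. e > 0 \<Longrightarrow> \<exists>S. approximable n S \<and> unorm (\<lambda>f p. T f p - S f p) < e"
  shows "approximable n T"
  unfolding approximable_def
proof (intro conjI allI impI)
  fix e :: real assume e: "e > 0"
  then have e2: "e / 2 > 0" by simp
  obtain S where S: "approximable n S" "unorm (\<lambda>f p. T f p - S f p) < e / 2"
    using approx[OF e2] by blast
  obtain R where R: "R \<in> finite_rank n" "adjointable n R" "unorm (\<lambda>f p. S f p - R f p) < e / 2"
    using approximableE[OF S(1) e2] .
  note S' = approximableD[OF S(1)]
  have "unorm (\<lambda>f p. (T f p - S f p) + (S f p - R f p))
      \<le> unorm (\<lambda>f p. T f p - S f p) + unorm (\<lambda>f p. S f p - R f p)"
    by (rule unorm_triangle[OF adjointable_minus[OF T S'] adjointable_minus[OF S' R(2)]])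
  also have "\<dots> < e" using S(2) R(3) by simp
  finally show "\<exists>R\<in>finite_rank n. unorm (\<lambda>f p. T f p - R f p) < e" using R(1) by auto
qed (rule T)

lemma closed_star_subalgebra_approximable:
  "closed_star_subalgebra (L n) (op n ` {T. approximable n T})"
  unfolding closed_star_subalgebra_def
proof (intro conjI ballI allI impI)
  show "op n ` {T. approximable n T} \<subseteq> acarr (L n)"
    by (auto simp: acarr_L approximableD)
  show "op n ` {T. approximable n T} \<noteq> {}"
    using finite_rank_approximable[OF finite_rank.zero] by blast
next
  fix A B assume "A \<in> op n ` {T. approximable n T}" "B \<in> op n ` {T. approximable n T}"
  then obtain S T where S: "A = op n S" "approximable n S" and T: "B = op n T" "approximable n T"
    by blast
  show "aadd (L n) A B \<in> op n ` {T. approximable n T}"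
    unfolding S(1) T(1) aadd_op[OF approximableD[OF S(2)] approximableD[OF T(2)]]
    using approximable_add[OF S(2) T(2)] by blast
  show "amult (L n) A B \<in> op n ` {T. approximable n T}"
    unfolding S(1) T(1) amult_op[OF approximableD[OF T(2)]]
    using approximable_comp[OF S(2) T(2)] by blast
next
  fix c A assume "A \<in> op n ` {T. approximable n T}"
  then obtain S where S: "A = op n S" "approximable n S" by blast
  show "ascale (L n) c A \<in> op n ` {T. approximable n T}"
    unfolding S(1) ascale_op[OF approximableD[OF S(2)]]
    using approximable_scale[OF S(2)] by blast
next
  fix A assume "A \<in> op n ` {T. approximable n T}"
  then obtain S where S: "A = op n S" "approximable n S" by blast
  obtain S' where S': "adjoint_pair n S S'"
    using approximableD[OF S(2)] by (auto simp: adjointable_def)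
  show "astar (L n) A \<in> op n ` {T. approximable n T}"
    unfolding S(1) astar_op[OF S'] using approximable_adjoint[OF S(2) S'] by blast
next
  fix A assume A: "A \<in> acarr (L n)"
    and approx: "\<forall>e>0. \<exists>S\<in>op n ` {T. approximable n T}. anorm (L n) (adiff (L n) A S) < e"
  obtain T where T: "A = op n T" "adjointable n T" using A by (auto simp: acarr_L)
  have "approximable n T"
  proof (rule approximable_closed[OF T(2)])
    fix e :: real assume "e > 0"
    then obtain S where S: "approximable n S" "anorm (L n) (adiff (L n) A (op n S)) < e"
      using approx by blast
    then have "unorm (\<lambda>f p. T f p - S f p) < e"
      using anorm_adiff_op[OF T(2) approximableD[OF S(1)]] by (simp add: T(1))
    with S(1) show "\<exists>S. approximable n S \<and> unorm (\<lambda>f p. T f p - S f p) < e" by blast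
  qed
  then show "A \<in> op n ` {T. approximable n T}" using T(1) by blast
qed

lemma theta_in_compacts:
  assumes "f \<in> cont_fun" "g \<in> cont_fun"
  shows "op n (rank1 n f g) \<in> compacts (bpower N \<gamma> n)"
  unfolding compacts_def cstar_generated_def theta_cls[OF assms, symmetric]
  using cls_in_carr[OF assms(1)] cls_in_carr[OF assms(2)] by blast

text \<open>The approximable operators form a closed *-subalgebra that contains every \<open>\<theta>\<^sub>x\<^sub>,\<^sub>y\<close>, and the compact
  operators are the smallest one.\<close>

lemma compacts_approximable:
  assumes "A \<in> compacts (bpower N \<gamma> n)"
  obtains T where "A = op n T" "approximable n T"
proof -
  have "{theta (bpower N \<gamma> n) x y | x y. x \<in> carr (bpower N \<gamma> n) \<and> y \<in> carr (bpower N \<gamma> n)}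
      \<subseteq> op n ` {T. approximable n T}"
    using finite_rank_approximable[OF rank1_in_finite_rank]
    by (auto simp: carr_bpower theta_cls)
  then have "compacts (bpower N \<gamma> n) \<subseteq> op n ` {T. approximable n T}"
    unfolding compacts_def cstar_generated_def
    using closed_star_subalgebra_approximable[of n] by blast
  then show ?thesis using assms that by blast
qed

lemma compacts_add:
  "A \<in> compacts (bpower N \<gamma> n) \<Longrightarrow> B \<in> compacts (bpower N \<gamma> n) \<Longrightarrow>
    aadd (L n) A B \<in> compacts (bpower N \<gamma> n)"
  unfolding compacts_def cstar_generated_def closed_star_subalgebra_def by blast

lemma compacts_scale:
  "A \<in> compacts (bpower N \<gamma> n) \<Longrightarrow> ascale (L n) c A \<in> compacts (bpower N \<gamma> n)"
  unfolding compacts_def cstar_generated_def closed_star_subalgebra_def by blast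

definition compact_op :: "nat \<Rightarrow> 'k fun_op \<Rightarrow> bool" where
  "compact_op n T \<longleftrightarrow> adjointable n T \<and> op n T \<in> compacts (bpower N \<gamma> n)"

lemma compact_op_rank1: "f \<in> cont_fun \<Longrightarrow> g \<in> cont_fun \<Longrightarrow> compact_op n (rank1 n f g)"
  by (simp add: compact_op_def theta_in_compacts adjointable_rank1)

lemma compact_op_add:
  assumes "compact_op n S" "compact_op n T" 
  shows "compact_op n (\<lambda>f p. S f p + T f p)"
  using assms compacts_add[of "op n S" n "op n T"] adjointable_plus[of n S T]
  by (simp add: compact_op_def aadd_op)

lemma compact_op_scale:
  assumes "compact_op n T" 
  shows "compact_op n (\<lambda>f p. c * T f p)"
  using assms compacts_scale[of "op n T" n c] adjointable_cmult[of n T c]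
  by (simp add: compact_op_def ascale_op)

lemma compact_op_zero: "compact_op n (\<lambda>f p. 0)"
  using compact_op_scale[OF compact_op_rank1[OF cont_fun_const cont_fun_const], of n 0] by simp

lemma compact_op_approximable:
  assumes "compact_op n T"
  shows "approximable n T"
proof -
  obtain S where S: "op n T = op n S" "approximable n S"
    using assms compacts_approximable by (auto simp: compact_op_def)
  have T: "adjointable n T" using assms by (simp add: compact_op_def)
  have "T f = S f" if "f \<in> cont_fun" for f
    using op_eqD[OF S(1) that adjointable_closed[OF T that]] .
  then have "unorm (\<lambda>f p. T f p - R f p) = unorm (\<lambda>f p. S f p - R f p)" for R
    by (intro unorm_cong) simp
  then show ?thesis using S(2) T by (simp add: approximable_def)
qed


section \<open>The levels of the core\<close>

text \<open>The operators on \<open>C(K)\<close> that make up the \<open>n\<close>-th level of the core. Since \<open>T \<otimes> I\<close> acts as \<open>T\<close>, the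
  summands of different levels are simply added. Only the values at continuous functions matter.\<close>

definition core_op :: "nat \<Rightarrow> 'k fun_op \<Rightarrow> bool" where
  "core_op n T \<longleftrightarrow> (\<exists>a\<in>cont_fun. \<exists>F. (\<forall>i\<in>{1..n}. compact_op i (F i)) \<and>
     (\<forall>f\<in>cont_fun. T f = (\<lambda>p. a p * f p + (\<Sum>i=1..n. F i f p))))"

lemma core_opE:
  assumes "core_op n T"
  obtains a F where "a \<in> cont_fun" "\<And>i. i \<in> {1..n} \<Longrightarrow> compact_op i (F i)"
    "\<And>f. f \<in> cont_fun \<Longrightarrow> T f = (\<lambda>p. a p * f p + (\<Sum>i=1..n. F i f p))"
  using assms unfolding core_op_def by blast

lemma adjointable_sum:
  assumes "\<And>i. i \<in> I \<Longrightarrow> adjointable n (F i)"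
  shows "adjointable n (\<lambda>f p. \<Sum>i\<in>I. F i f p)"
  using assms
proof (induction I rule: infinite_finite_induct)
  case (insert i I)
  then show ?case using adjointable_plus[of n "F i"] by simp
qed (simp_all add: adjointable_zero)

lemma core_op_adjointable:
  assumes "core_op n T"
  shows "adjointable n T"
proof -
  obtain a F where a: "a \<in> cont_fun" and F: "\<And>i. i \<in> {1..n} \<Longrightarrow> compact_op i (F i)"
    and T: "\<And>f. f \<in> cont_fun \<Longrightarrow> T f = (\<lambda>p. a p * f p + (\<Sum>i=1..n. F i f p))"
    using core_opE[OF assms] by blast
  have "adjointable n (\<lambda>f p. \<Sum>i=1..n. F i f p)"
  proof (rule adjointable_sum)
    fix i assume "i \<in> {1..n}"
    then show "adjointable n (F i)"
      using F[of i] adjointable_mono[of i "F i" n] by (simp add: compact_op_def)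
  qed
  with adjointable_mono[OF adjointable_left_mult[OF a] le0]
  have "adjointable n (\<lambda>f p. a p * f p + (\<Sum>i=1..n. F i f p))"
    by (rule adjointable_plus)
  moreover have "adjointable n T \<longleftrightarrow> adjointable n (\<lambda>f p. a p * f p + (\<Sum>i=1..n. F i f p))"
    by (rule adjointable_cong) (rule T)
  ultimately show ?thesis by simp
qed

lemma asum_op:
  assumes "\<And>i. i \<le> n \<Longrightarrow> adjointable i (F i)" "\<And>i. i \<le> n \<Longrightarrow> A i = op i (F i)" "m \<le> n"
  shows "asum (L n) (\<lambda>i. lift_by (tensor_id X) i (n - i) (A i)) m = op n (\<lambda>f p. \<Sum>i\<le>m. F i f p)"
  using assms(3)
proof (induction m)
  case 0
  then show ?case using assms lift_by_op[OF assms(1)[of 0]] by simp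
next
  case (Suc m)
  have "adjointable n (\<lambda>f p. \<Sum>i\<le>m. F i f p)"
    using Suc.prems by (intro adjointable_sum adjointable_mono[OF assms(1)]) auto
  moreover have "adjointable n (F (Suc m))"
    using Suc.prems by (intro adjointable_mono[OF assms(1)]) auto
  moreover have "lift_by (tensor_id X) (Suc m) (n - Suc m) (A (Suc m)) = op n (F (Suc m))"
    using lift_by_op[OF assms(1)[OF Suc.prems]] assms(2)[OF Suc.prems] Suc.prems by simp
  ultimately show ?case
    using Suc by (simp add: aadd_op)
qed

lemma core_level_eq: "core_level N \<gamma> n = op n ` {T. core_op n T}"
proof (intro equalityI subsetI)
  fix A assume "A \<in> core_level N \<gamma> n"
  then obtain T where A: "A = asum (L n) (\<lambda>i. lift_by (tensor_id X) i (n - i) (T i)) n"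
    and T0: "T 0 \<in> left_op (bpower N \<gamma> 0) ` cont_fun"
    and T: "\<And>i. i \<in> {1..n} \<Longrightarrow> T i \<in> compacts (bpower N \<gamma> i)"
    by (auto simp: core_level_def)
  obtain a where a: "a \<in> cont_fun" "T 0 = op 0 (\<lambda>f p. a p * f p)"
    using T0 left_op_0 by auto
  have "\<exists>S. T i = op i S \<and> adjointable i S" if "i \<in> {1..n}" for i
    using compacts_approximable[OF T[OF that]] approximableD by metis
  then obtain S where S: "\<And>i. i \<in> {1..n} \<Longrightarrow> T i = op i (S i) \<and> adjointable i (S i)" by metis
  define F where "F i = (if i = 0 then (\<lambda>f p. a p * f p) else S i)" for i
  have adj: "adjointable i (F i)" and eq: "T i = op i (F i)" if "i \<le> n" for i
    using that S[of i] a adjointable_left_mult[OF a(1)] by (auto simp: F_def)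
  have "A = op n (\<lambda>f p. \<Sum>i\<le>n. F i f p)"
    unfolding A by (rule asum_op[OF adj eq]) auto
  moreover have "core_op n (\<lambda>f p. \<Sum>i\<le>n. F i f p)"
    unfolding core_op_def
  proof (rule bexI[OF _ a(1)], rule exI[of _ F], intro conjI ballI)
    show "compact_op i (F i)" if "i \<in> {1..n}" for i
      using adj[of i] eq[of i] T[OF that] that by (simp add: compact_op_def)
    show "(\<lambda>p. \<Sum>i\<le>n. F i f p) = (\<lambda>p. a p * f p + (\<Sum>i=1..n. F i f p))" for f
      by (simp add: sum_atMost_split) (simp add: F_def)
  qed
  ultimately show "A \<in> op n ` {T. core_op n T}" by blast
next
  fix A assume "A \<in> op n ` {T. core_op n T}"
  then obtain T where A: "A = op n T" and core_T: "core_op n T" by blast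
  obtain a F where a: "a \<in> cont_fun"
    and F: "\<And>i. i \<in> {1..n} \<Longrightarrow> compact_op i (F i)"
    and T: "\<And>f. f \<in> cont_fun \<Longrightarrow> T f = (\<lambda>p. a p * f p + (\<Sum>i=1..n. F i f p))"
    using core_opE[OF core_T] by blast
  define G where "G i = (if i = 0 then (\<lambda>f p. a p * f p) else F i)" for i
  have adj: "adjointable i (G i)" if "i \<le> n" for i
    using that F[of i] adjointable_left_mult[OF a(1)] by (auto simp: G_def compact_op_def)
  have "asum (L n) (\<lambda>i. lift_by (tensor_id X) i (n - i) (op i (G i))) n = op n (\<lambda>f p. \<Sum>i\<le>n. G i f p)"
    by (rule asum_op[OF adj refl]) auto
  also have "\<dots> = A"
    unfolding A by (rule op_cong) (simp add: T sum_atMost_split, simp add: G_def)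
  finally have "A = asum (L n) (\<lambda>i. lift_by (tensor_id X) i (n - i) (op i (G i))) n" ..
  moreover have "op 0 (G 0) \<in> left_op (bpower N \<gamma> 0) ` cont_fun"
    using a left_op_0[OF a] by (force simp: G_def)
  moreover have "\<forall>i\<in>{1..n}. op i (G i) \<in> compacts (bpower N \<gamma> i)"
    using F by (auto simp: G_def compact_op_def)
  ultimately show "A \<in> core_level N \<gamma> n" 
    unfolding core_level_def by (intro CollectI exI[of _ "\<lambda>i. op i (G i)"] conjI)
qed

lemma core_op_add:
  assumes "core_op n S" "core_op n T"
  shows "core_op n (\<lambda>f p. S f p + T f p)"
proof -
  obtain a F where a: "a \<in> cont_fun" and F: "\<And>i. i \<in> {1..n} \<Longrightarrow> compact_op i (F i)"
    and S: "\<And>f. f \<in> cont_fun \<Longrightarrow> S f = (\<lambda>p. a p * f p + (\<Sum>i=1..n. F i f p))"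
    using core_opE[OF assms(1)] by blast
  obtain b G where b: "b \<in> cont_fun" and G: "\<And>i. i \<in> {1..n} \<Longrightarrow> compact_op i (G i)"
    and T: "\<And>f. f \<in> cont_fun \<Longrightarrow> T f = (\<lambda>p. b p * f p + (\<Sum>i=1..n. G i f p))"
    using core_opE[OF assms(2)] by blast
  show ?thesis
    unfolding core_op_def
    by (rule bexI[of _ "\<lambda>p. a p + b p"], rule exI[of _ "\<lambda>i f p. F i f p + G i f p"])
       (auto simp: S T F G compact_op_add sum.distrib distrib_right intro: cont_fun_add[OF a b])
qed

lemma core_op_scale:
  assumes "core_op n T"
  shows "core_op n (\<lambda>f p. c * T f p)"
proof -
  obtain a F where a: "a \<in> cont_fun" and F: "\<And>i. i \<in> {1..n} \<Longrightarrow> compact_op i (F i)"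
    and S: "\<And>f. f \<in> cont_fun \<Longrightarrow> T f = (\<lambda>p. a p * f p + (\<Sum>i=1..n. F i f p))"
    using core_opE[OF assms(1)] by blast
  show ?thesis
    unfolding core_op_def
    by (rule bexI[of _ "\<lambda>p. c * a p"], rule exI[of _ "\<lambda>i f p. c * F i f p"])
       (auto simp: S F compact_op_scale sum_distrib_left distrib_left mult.assoc
         intro: cont_fun_mult[OF cont_fun_const a])
qed

lemma core_op_Suc:
  assumes "core_op n T"
  shows "core_op (Suc n) T"
proof -
  obtain a F where a: "a \<in> cont_fun" and F: "\<And>i. i \<in> {1..n} \<Longrightarrow> compact_op i (F i)"
    and S: "\<And>f. f \<in> cont_fun \<Longrightarrow> T f = (\<lambda>p. a p * f p + (\<Sum>i=1..n. F i f p))"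
    using core_opE[OF assms(1)] by blast
  show ?thesis
    unfolding core_op_def
    by (rule bexI[OF _ a], rule exI[of _ "\<lambda>i. if i = Suc n then (\<lambda>f p. 0) else F i"])
       (auto simp: S F compact_op_zero le_Suc_eq)
qed

lemma core_op_mono: "core_op n T \<Longrightarrow> n \<le> m \<Longrightarrow> core_op m T"
  by (rotate_tac, induction rule: dec_induct) (auto intro: core_op_Suc)

lemma core_op_left_mult: "a \<in> cont_fun \<Longrightarrow> core_op 0 (\<lambda>f p. a p * f p)"
  unfolding core_op_def by (intro bexI[of _ a]) auto

lemma core_op_compact:
  assumes "compact_op n T" "n \<ge> 1"
  shows "core_op n T"
  unfolding core_op_def
proof (rule bexI[of _ "\<lambda>_. 0"], rule exI[of _ "\<lambda>i. if i = n then T else (\<lambda>f p. 0)"], intro conjI ballI)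
  show "compact_op i (if i = n then T else (\<lambda>f p. 0))" for i
    using assms compact_op_zero by simp
  show "T f = (\<lambda>p. 0 * f p + (\<Sum>i=1..n. (if i = n then T else (\<lambda>f p. 0)) f p))" for f
  proof
    fix p
    have "(\<Sum>i=1..n. (if i = n then T else (\<lambda>f p. 0)) f p) = (\<Sum>i=1..n. if i = n then T f p else 0)"
      by (intro sum.cong) auto
    then show "T f p = 0 * f p + (\<Sum>i=1..n. (if i = n then T else (\<lambda>f p. 0)) f p)"
      using assms by (simp add: sum.delta)
  qed
qed (rule cont_fun_const)

lemma core_op_rank1:
  assumes "f \<in> cont_fun" "g \<in> cont_fun"
  shows "core_op n (rank1 n f g)"
proof (cases "n = 0")
  case True
  have "rank1 0 f g = (\<lambda>z p. (f p * cnj (g p)) * z p)"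
    by (auto simp: rank1_def ip_def fun_eq_iff)
  moreover have "core_op 0 (\<lambda>z p. (f p * cnj (g p)) * z p)"
    by (intro core_op_left_mult cont_fun_intros assms)
  ultimately show ?thesis using True by simp
next
  case False
  then show ?thesis using compact_op_rank1[OF assms] by (intro core_op_compact) auto
qed


section \<open>The core as a limit of operators on C(K)\<close>

text \<open>Sums, products and distances of two such operators are formed at a common level.\<close>

definition some_level :: "'k fun_op \<Rightarrow> bool" where
  "some_level T \<longleftrightarrow> (\<exists>n. adjointable n T)"

lemma some_levelI: "adjointable n T \<Longrightarrow> some_level T"
  by (auto simp: some_level_def)

lemma some_level_core_op: "core_op n T \<Longrightarrow> some_level T"
  using core_op_adjointable some_levelI by blast

lemma common_level:
  assumes "some_level S" "some_level T"
  obtains n where "adjointable n S" "adjointable n T"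
proof -
  obtain n m where "adjointable n S" "adjointable m T" using assms by (auto simp: some_level_def)
  then have "adjointable (max n m) S" "adjointable (max n m) T"
    using adjointable_mono by (meson max.cobounded1, meson max.cobounded2)
  then show ?thesis by (rule that)
qed

lemma common_level3:
  assumes "some_level R" "some_level S" "some_level T"
  obtains n where "adjointable n R" "adjointable n S" "adjointable n T"
proof -
  obtain n m where "adjointable n R" "adjointable n S" "adjointable m T"
    using common_level[OF assms(1,2)] assms(3) by (metis some_level_def)
  then have "adjointable (max n m) R" "adjointable (max n m) S" "adjointable (max n m) T"
    using adjointable_mono by (meson max.cobounded1, meson max.cobounded1, meson max.cobounded2)
  then show ?thesis by (rule that)
qed

definition opdist :: "'k fun_op \<Rightarrow> 'k fun_op \<Rightarrow> real" where
  "opdist S T = unorm (\<lambda>f p. S f p - T f p)"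

lemma opdist_nonneg: "some_level S \<Longrightarrow> some_level T \<Longrightarrow> 0 \<le> opdist S T"
  unfolding opdist_def by (metis common_level adjointable_minus unorm_nonneg)

lemma opdist_self [simp]: "opdist T T = 0"
  by (simp add: opdist_def unorm_zero)

lemma opdist_triangle:
  assumes "some_level R" "some_level S" "some_level T"
  shows "opdist R T \<le> opdist R S + opdist S T"
proof -
  obtain n where n: "adjointable n R" "adjointable n S" "adjointable n T"
    by (rule common_level3[OF assms])
  have "unorm (\<lambda>f p. (R f p - S f p) + (S f p - T f p))
     \<le> unorm (\<lambda>f p. R f p - S f p) + unorm (\<lambda>f p. S f p - T f p)"
    by (rule unorm_triangle[OF adjointable_minus[OF n(1,2)] adjointable_minus[OF n(2,3)]])
  then show ?thesis by (simp add: opdist_def)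
qed

lemma opdist_commute:
  assumes "some_level S" "some_level T"
  shows "opdist S T = opdist T S"
proof -
  have "opdist S T \<le> opdist T S" if ST: "some_level S" "some_level T" for S T
  proof -
    obtain n where n: "adjointable n S" "adjointable n T" by (rule common_level[OF ST])
    show ?thesis
      using unorm_cmult_le[OF adjointable_minus[OF n(2,1)], of "-1"] by (simp add: opdist_def)
  qed
  then show ?thesis using assms by (meson antisym)
qed

lemma unorm_le_opdist:
  assumes "some_level S" "some_level T"
  shows "unorm S \<le> unorm T + opdist S T"
proof -
  obtain n where n: "adjointable n S" "adjointable n T" by (rule common_level[OF assms])
  show ?thesis
    using unorm_triangle[OF n(2) adjointable_minus[OF n]] by (simp add: opdist_def)
qed

lemma opdist_cong:
  assumes "\<And>f. f \<in> cont_fun \<Longrightarrow> S f = S' f" "\<And>f. f \<in> cont_fun \<Longrightarrow> T f = T' f"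
  shows "opdist S T = opdist S' T'"
  unfolding opdist_def using assms by (intro unorm_cong) simp

lemma core_op_cong:
  assumes "core_op n T" "\<And>f. f \<in> cont_fun \<Longrightarrow> T f = T' f"
  shows "core_op n T'"
proof -
  obtain a F where a: "a \<in> cont_fun" and F: "\<And>i. i \<in> {1..n} \<Longrightarrow> compact_op i (F i)"
    and T: "\<And>f. f \<in> cont_fun \<Longrightarrow> T f = (\<lambda>p. a p * f p + (\<Sum>i=1..n. F i f p))"
    using core_opE[OF assms(1)] by blast
  show ?thesis
    unfolding core_op_def
    by (rule bexI[OF _ a], rule exI[of _ F]) (use F T assms(2) in simp)
qed

abbreviation level_alg :: "nat \<Rightarrow> 'k bop cstar" where
  "level_alg \<equiv> core_level_alg N \<gamma>"

abbreviation level_pairs :: "(nat \<times> 'k bop) set" where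
  "level_pairs \<equiv> SIGMA n:UNIV. acarr (level_alg n)"

abbreviation core_seqs :: "(nat \<Rightarrow> nat \<times> 'k bop) set" where
  "core_seqs \<equiv> cauchy_seqs level_pairs (level_dist level_alg (tensor_id X))"

lemma level_alg_simps [simp]:
  "acarr (level_alg n) = core_level N \<gamma> n" "aadd (level_alg n) = aadd (L n)" "ascale (level_alg n) = ascale (L n)"
  "amult (level_alg n) = amult (L n)" "astar (level_alg n) = astar (L n)" "anorm (level_alg n) = anorm (L n)"
  by (simp_all add: core_level_alg_def)

text \<open>The operator on \<open>C(K)\<close> behind an element of the union of the levels.\<close>

definition model :: "nat \<times> 'k bop \<Rightarrow> ('k \<Rightarrow> complex) \<Rightarrow> 'k \<Rightarrow> complex" where
  "model p = hat (fst p) (snd p)"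

lemma model_op: "core_op n T \<Longrightarrow> f \<in> cont_fun \<Longrightarrow> model (n, op n T) f = T f"
  by (simp add: model_def hat_op adjointable_closed[OF core_op_adjointable])

lemma level_pairs_model:
  assumes "p \<in> level_pairs"
  shows "core_op (fst p) (model p)" "p = (fst p, op (fst p) (model p))"
proof -
  obtain n T where p: "p = (n, op n T)" "core_op n T"
    using assms by (cases p) (auto simp: core_level_eq)
  show "core_op (fst p) (model p)"
    using core_op_cong[OF p(2), of "model p"] model_op[OF p(2)] p(1) by simp
  have "op n (model p) = op n T" using model_op[OF p(2)] p(1) by (intro op_cong) simp
  then show "p = (fst p, op (fst p) (model p))" using p(1) by simp
qed

lemma level_op_op:
  assumes "adjointable n S" "adjointable m T"
  shows "level_op (tensor_id X) F (n, op n S) (m, op m T)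
    = (max n m, F (max n m) (op (max n m) S) (op (max n m) T))"
  by (simp add: level_op_def Let_def lift_by_op assms)

text \<open>Once operators are seen on \<open>C(K)\<close>, the level is irrelevant for their distance.\<close>

lemma level_dist_op:
  assumes "adjointable n S" "adjointable m T"
  shows "level_dist level_alg (tensor_id X) (n, op n S) (m, op m T) = opdist S T"
proof -
  have "adjointable (max n m) S" "adjointable (max n m) T"
    using assms adjointable_mono by (meson max.cobounded1, meson max.cobounded2)
  moreover have "adiff (level_alg k) = adiff (L k)" for k
    by (auto simp: adiff_def fun_eq_iff)
  ultimately show ?thesis
    by (simp add: level_dist_def level_op_op[OF assms] anorm_adiff_op opdist_def)
qed

lemma level_dist_model:
  assumes "p \<in> level_pairs" "q \<in> level_pairs"
  shows "level_dist level_alg (tensor_id X) p q = opdist (model p) (model q)"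
proof -
  note p = level_pairs_model[OF assms(1)] and q = level_pairs_model[OF assms(2)]
  show ?thesis
    by (subst (1) p(2), subst (1) q(2))
       (rule level_dist_op[OF core_op_adjointable[OF p(1)] core_op_adjointable[OF q(1)]])
qed

text \<open>The element of the core that is the limit of a Cauchy sequence \<open>a\<close> of operators on \<open>C(K)\<close>. It is
  described by its representing sequences, whose members may come from any levels.\<close>

definition limit_elt :: "(nat \<Rightarrow> ('k \<Rightarrow> complex) \<Rightarrow> 'k \<Rightarrow> complex) \<Rightarrow> 'k core_elt" where
  "limit_elt a = {t \<in> core_seqs. (\<lambda>m. opdist (a m) (model (t m))) \<longlonglongrightarrow> 0}"

lemma core_seqs_level_pairs: "t \<in> core_seqs \<Longrightarrow> t m \<in> level_pairs"
  by (auto simp: cauchy_seqs_def simp del: level_alg_simps)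

lemma core_seqs_level: "t \<in> core_seqs \<Longrightarrow> some_level (model (t m))"
  using level_pairs_model(1)[OF core_seqs_level_pairs] some_level_core_op by blast

lemma limit_class_op:
  assumes "\<And>m. adjointable (n m) (a m)"
  shows "limit_class level_alg (tensor_id X) (\<lambda>m. (n m, op (n m) (a m))) = limit_elt a"
proof -
  have "level_dist level_alg (tensor_id X) (n m, op (n m) (a m)) (t m) = opdist (a m) (model (t m))"
    if "t \<in> core_seqs" for t m
  proof -
    note p = level_pairs_model[OF core_seqs_level_pairs[OF that, of m]]
    show ?thesis
      by (subst p(2)) (rule level_dist_op[OF assms core_op_adjointable[OF p(1)]])
  qed
  then show ?thesis unfolding seq_class_def limit_elt_def by (intro Collect_cong) auto
qed

lemma limit_elt_subset:
  assumes "\<And>m. some_level (a m)" "\<And>m. some_level (b m)" "(\<lambda>m. opdist (b m) (a m)) \<longlonglongrightarrow> 0"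
  shows "limit_elt a \<subseteq> limit_elt b"
proof
  fix t assume "t \<in> limit_elt a"
  then have t: "t \<in> core_seqs" "(\<lambda>m. opdist (a m) (model (t m))) \<longlonglongrightarrow> 0" by (auto simp: limit_elt_def)
  have "(\<lambda>m. opdist (b m) (model (t m))) \<longlonglongrightarrow> 0"
  proof (rule tendsto_0_upper)
    show "(\<lambda>m. opdist (b m) (a m) + opdist (a m) (model (t m))) \<longlonglongrightarrow> 0"
      using tendsto_add[OF assms(3) t(2)] by simp
  qed (rule opdist_nonneg[OF assms(2) core_seqs_level[OF t(1)]]
      opdist_triangle[OF assms(2,1) core_seqs_level[OF t(1)]])+
  then show "t \<in> limit_elt b" using t(1) by (simp add: limit_elt_def)
qed

text \<open>The class of a sequence depends only on its asymptotic behaviour. With this the operations of the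
  core, which act on arbitrarily chosen representatives, can be computed.\<close>

lemma limit_elt_eq:
  assumes "\<And>m. some_level (a m)" "\<And>m. some_level (b m)" "(\<lambda>m. opdist (a m) (b m)) \<longlonglongrightarrow> 0"
  shows "limit_elt a = limit_elt b"
proof (rule equalityI)
  show "limit_elt b \<subseteq> limit_elt a" by (rule limit_elt_subset[OF assms(2,1,3)])
  have "(\<lambda>m. opdist (b m) (a m)) \<longlonglongrightarrow> 0"
    using assms(3) opdist_commute[OF assms(1,2)] by simp
  then show "limit_elt a \<subseteq> limit_elt b" by (rule limit_elt_subset[OF assms(1,2)])
qed

lemma acarr_core: "acarr (core N \<gamma>) = completion level_pairs (level_dist level_alg (tensor_id X))"
  by (simp add: core_def cstar_limit_def)

lemma seq_class_limit_elt:
  assumes "s \<in> core_seqs"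
  shows "limit_class level_alg (tensor_id X) s = limit_elt (\<lambda>m. model (s m))"
proof -
  note p = level_pairs_model[OF core_seqs_level_pairs[OF assms]]
  have "limit_class level_alg (tensor_id X) (\<lambda>m. (fst (s m), op (fst (s m)) (model (s m)))) = limit_elt (\<lambda>m. model (s m))"
    by (rule limit_class_op) (rule core_op_adjointable[OF p(1)])
  moreover have "(\<lambda>m. (fst (s m), op (fst (s m)) (model (s m)))) = s"
    by (rule ext) (rule p(2)[symmetric])
  ultimately show ?thesis by simp
qed

text \<open>The sequence of operators behind the representative of \<open>P\<close> chosen by \<open>rep\<close>.\<close>

definition rep_op :: "'k core_elt \<Rightarrow> nat \<Rightarrow> ('k \<Rightarrow> complex) \<Rightarrow> 'k \<Rightarrow> complex" where
  "rep_op P m = model (rep P m)"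

lemma rep_core:
  assumes "P \<in> acarr (core N \<gamma>)"
  shows "rep P \<in> P" "rep P \<in> core_seqs"
proof -
  obtain s where s: "s \<in> core_seqs" "P = limit_elt (\<lambda>m. model (s m))"
    using assms seq_class_limit_elt by (auto simp: acarr_core completion_def simp del: level_alg_simps)
  have "s \<in> P" using s by (simp add: limit_elt_def)
  then show "rep P \<in> P" unfolding rep_def by (rule someI[of "\<lambda>s. s \<in> P"])
  then show "rep P \<in> core_seqs" using s(2) by (simp add: limit_elt_def)
qed

lemma rep_eq: "P \<in> acarr (core N \<gamma>) \<Longrightarrow> rep P m = (fst (rep P m), op (fst (rep P m)) (rep_op P m))"
  unfolding rep_op_def by (rule level_pairs_model(2)[OF core_seqs_level_pairs[OF rep_core(2)]])

lemma rep_op_core_op: "P \<in> acarr (core N \<gamma>) \<Longrightarrow> core_op (fst (rep P m)) (rep_op P m)"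
  unfolding rep_op_def by (rule level_pairs_model(1)[OF core_seqs_level_pairs[OF rep_core(2)]])

lemma rep_op_some_level: "P \<in> acarr (core N \<gamma>) \<Longrightarrow> some_level (rep_op P m)"
  using rep_op_core_op some_level_core_op by blast

lemma rep_op_tendsto:
  assumes "limit_elt a \<in> acarr (core N \<gamma>)"
  shows "(\<lambda>m. opdist (a m) (rep_op (limit_elt a) m)) \<longlonglongrightarrow> 0"
  using rep_core(1)[OF assms] by (simp add: limit_elt_def rep_op_def)

lemma rep_op_cauchy:
  assumes "P \<in> acarr (core N \<gamma>)" "e > 0"
  shows "\<exists>M. \<forall>m\<ge>M. \<forall>k\<ge>M. opdist (rep_op P m) (rep_op P k) < e"
proof -
  have "level_dist level_alg (tensor_id X) (rep P m) (rep P k) = opdist (rep_op P m) (rep_op P k)" for m k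
    unfolding rep_op_def by (rule level_dist_model) (rule core_seqs_level_pairs[OF rep_core(2)[OF assms(1)]])+
  then show ?thesis
    using rep_core(2)[OF assms(1)] assms(2) by (auto simp: cauchy_seqs_def)
qed

lemma limit_elt_in_core:
  assumes "\<And>m. core_op (n m) (a m)"
    and cauchy: "\<And>e. e > 0 \<Longrightarrow> \<exists>M. \<forall>m\<ge>M. \<forall>k\<ge>M. opdist (a m) (a k) < e"
  shows "limit_elt a \<in> acarr (core N \<gamma>)"
proof -
  let ?s = "\<lambda>m. (n m, op (n m) (a m))"
  have level_pairs: "?s m \<in> level_pairs" for m using assms(1) by (auto simp: core_level_eq)
  have "level_dist level_alg (tensor_id X) (?s m) (?s k) = opdist (a m) (a k)" for m k
    by (rule level_dist_op) (rule core_op_adjointable[OF assms(1)])+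
  then have s: "?s \<in> core_seqs"
    using level_pairs cauchy unfolding cauchy_seqs_def by auto
  moreover have "limit_class level_alg (tensor_id X) ?s = limit_elt a"
    by (rule limit_class_op) (rule core_op_adjointable[OF assms(1)])
  ultimately show ?thesis unfolding acarr_core completion_def by blast
qed

lemma aadd_core:
  assumes "P \<in> acarr (core N \<gamma>)" "Q \<in> acarr (core N \<gamma>)"
  shows "aadd (core N \<gamma>) P Q = limit_elt (\<lambda>m f p. rep_op P m f p + rep_op Q m f p)"
proof -
  let ?k = "\<lambda>m. max (fst (rep P m)) (fst (rep Q m))"
  have adj: "adjointable (?k m) (rep_op P m)" "adjointable (?k m) (rep_op Q m)" for m
    using adjointable_mono[OF core_op_adjointable[OF rep_op_core_op[OF assms(1)]]]
      adjointable_mono[OF core_op_adjointable[OF rep_op_core_op[OF assms(2)]]] by auto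
  have "level_op (tensor_id X) (\<lambda>k. aadd (level_alg k)) (rep P m) (rep Q m)
      = (?k m, op (?k m) (\<lambda>f p. rep_op P m f p + rep_op Q m f p))" for m
    by (subst rep_eq[OF assms(1)], subst rep_eq[OF assms(2)],
        subst level_op_op[OF core_op_adjointable[OF rep_op_core_op[OF assms(1)]]
          core_op_adjointable[OF rep_op_core_op[OF assms(2)]]])
       (simp add: aadd_op[OF adj])
  then have "aadd (core N \<gamma>) P Q = limit_class level_alg (tensor_id X) (\<lambda>m. (?k m, op (?k m) (\<lambda>f p. rep_op P m f p + rep_op Q m f p)))"
    by (simp add: core_def cstar_limit_def del: level_alg_simps)
  then show ?thesis
    by (subst (asm) limit_class_op) (rule adjointable_plus[OF adj])
qed

lemma amult_core:
  assumes "P \<in> acarr (core N \<gamma>)" "Q \<in> acarr (core N \<gamma>)"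
  shows "amult (core N \<gamma>) P Q = limit_elt (\<lambda>m f. rep_op P m (rep_op Q m f))"
proof -
  let ?k = "\<lambda>m. max (fst (rep P m)) (fst (rep Q m))"
  have adj: "adjointable (?k m) (rep_op P m)" "adjointable (?k m) (rep_op Q m)" for m
    using adjointable_mono[OF core_op_adjointable[OF rep_op_core_op[OF assms(1)]]]
      adjointable_mono[OF core_op_adjointable[OF rep_op_core_op[OF assms(2)]]] by auto
  have "level_op (tensor_id X) (\<lambda>k. amult (level_alg k)) (rep P m) (rep Q m)
      = (?k m, op (?k m) (\<lambda>f. rep_op P m (rep_op Q m f)))" for m
    by (subst rep_eq[OF assms(1)], subst rep_eq[OF assms(2)],
        subst level_op_op[OF core_op_adjointable[OF rep_op_core_op[OF assms(1)]]
          core_op_adjointable[OF rep_op_core_op[OF assms(2)]]])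
       (simp add: amult_op[OF adj(2)])
  then have "amult (core N \<gamma>) P Q = limit_class level_alg (tensor_id X) (\<lambda>m. (?k m, op (?k m) (\<lambda>f. rep_op P m (rep_op Q m f))))"
    by (simp add: core_def cstar_limit_def del: level_alg_simps)
  then show ?thesis
    by (subst (asm) limit_class_op) (rule adjointable_comp[OF adj])
qed

lemma ascale_core:
  assumes "P \<in> acarr (core N \<gamma>)"
  shows "ascale (core N \<gamma>) c P = limit_elt (\<lambda>m f p. c * rep_op P m f p)"
proof -
  let ?k = "\<lambda>m. fst (rep P m)"
  note adj = core_op_adjointable[OF rep_op_core_op[OF assms]]
  have "(fst (rep P m), ascale (level_alg (fst (rep P m))) c (snd (rep P m))) = (?k m, op (?k m) (\<lambda>f p. c * rep_op P m f p))" for m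
    using rep_eq[OF assms, of m] ascale_op[OF adj, of m c] by (metis level_alg_simps(3) snd_conv)
  then have "ascale (core N \<gamma>) c P = limit_class level_alg (tensor_id X) (\<lambda>m. (?k m, op (?k m) (\<lambda>f p. c * rep_op P m f p)))"
    by (simp add: core_def cstar_limit_def del: level_alg_simps)
  then show ?thesis
    by (subst (asm) limit_class_op) (rule adjointable_cmult[OF adj])
qed

lemma astar_core:
  assumes "P \<in> acarr (core N \<gamma>)" "\<And>m. adjoint_pair (fst (rep P m)) (rep_op P m) (S m)"
  shows "astar (core N \<gamma>) P = limit_elt S"
proof -
  let ?k = "\<lambda>m. fst (rep P m)"
  have "(fst (rep P m), astar (level_alg (fst (rep P m))) (snd (rep P m))) = (?k m, op (?k m) (S m))" for m
    using rep_eq[OF assms(1), of m] astar_op[OF assms(2), of m] by (metis level_alg_simps(5) snd_conv)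
  then have "astar (core N \<gamma>) P = limit_class level_alg (tensor_id X) (\<lambda>m. (?k m, op (?k m) (S m)))"
    by (simp add: core_def cstar_limit_def del: level_alg_simps)
  then show ?thesis
    by (subst (asm) limit_class_op) (rule adjointableI[OF adjoint_pair_sym[OF assms(2)]])
qed

lemma anorm_core:
  assumes "P \<in> acarr (core N \<gamma>)"
  shows "anorm (core N \<gamma>) P = lim (\<lambda>m. unorm (rep_op P m))"
proof -
  have "anorm (level_alg (fst (rep P m))) (snd (rep P m)) = unorm (rep_op P m)" for m
    using rep_eq[OF assms, of m] anorm_op[OF core_op_adjointable[OF rep_op_core_op[OF assms]], of m]
    by (metis level_alg_simps(6) snd_conv)
  then show ?thesis by (simp add: core_def cstar_limit_def del: level_alg_simps)
qed


subsection \<open>Operators as elements of the core\<close>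

text \<open>An operator on \<open>C(K)\<close> as an element of the core; by \<open>core_embed_op\<close> it is the same at all levels.\<close>

definition embed :: "'k fun_op \<Rightarrow> 'k core_elt" where
  "embed T = limit_elt (\<lambda>_. T)"

lemma embed_cong: "(\<And>f. f \<in> cont_fun \<Longrightarrow> T f = T' f) \<Longrightarrow> embed T = embed T'"
  unfolding embed_def limit_elt_def using opdist_cong[of T T'] by simp

lemma core_embed_op: "adjointable n T \<Longrightarrow> core_embed N \<gamma> n (op n T) = embed T"
  unfolding core_embed_def limit_embed_def embed_def by (rule limit_class_op)

lemma embed_in_core: "core_op n T \<Longrightarrow> embed T \<in> acarr (core N \<gamma>)"
  unfolding embed_def by (rule limit_elt_in_core) auto

lemma embed_rep_op: "core_op n T \<Longrightarrow> (\<lambda>m. opdist T (rep_op (embed T) m)) \<longlonglongrightarrow> 0"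
  using rep_op_tendsto[of "\<lambda>_. T"] embed_in_core by (simp add: embed_def)

lemma some_level_plus: "some_level S \<Longrightarrow> some_level T \<Longrightarrow> some_level (\<lambda>f p. S f p + T f p)"
  by (erule (1) common_level) (rule some_levelI[OF adjointable_plus])

lemma some_level_comp: "some_level S \<Longrightarrow> some_level T \<Longrightarrow> some_level (\<lambda>f. S (T f))"
  by (erule (1) common_level) (rule some_levelI[OF adjointable_comp])

lemma some_level_cmult: "some_level T \<Longrightarrow> some_level (\<lambda>f p. c * T f p)"
  using adjointable_cmult by (auto simp: some_level_def)

lemma opdist_plus:
  assumes "some_level S" "some_level S'" "some_level T" "some_level T'"
  shows "opdist (\<lambda>f p. S f p + T f p) (\<lambda>f p. S' f p + T' f p) \<le> opdist S S' + opdist T T'"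
proof -
  obtain n where "adjointable n S" "adjointable n S'" by (rule common_level[OF assms(1,2)])
  moreover obtain m where "adjointable m T" "adjointable m T'" by (rule common_level[OF assms(3,4)])
  ultimately have "adjointable (max n m) S" "adjointable (max n m) S'" "adjointable (max n m) T" "adjointable (max n m) T'"
    using adjointable_mono[of n _ "max n m"] adjointable_mono[of m _ "max n m"] by auto
  then show ?thesis
    using unorm_triangle[OF adjointable_minus[of "max n m" S S'] adjointable_minus[of "max n m" T T']]
    by (simp add: opdist_def algebra_simps)
qed

lemma opdist_cmult:
  assumes "some_level S" "some_level S'"
  shows "opdist (\<lambda>f p. c * S f p) (\<lambda>f p. c * S' f p) \<le> cmod c * opdist S S'"
proof -
  obtain n where n: "adjointable n S" "adjointable n S'" by (rule common_level[OF assms])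
  then show ?thesis
    using unorm_cmult_le[OF adjointable_minus[OF n], of c] by (simp add: opdist_def algebra_simps)
qed

lemma opdist_comp:
  assumes "some_level S" "some_level S'" "some_level T" "some_level T'"
  shows "opdist (\<lambda>f. S (T f)) (\<lambda>f. S' (T' f)) \<le> unorm S * opdist T T' + opdist S S' * unorm T'"
proof -
  obtain n where "adjointable n S" "adjointable n S'" by (rule common_level[OF assms(1,2)])
  moreover obtain m where "adjointable m T" "adjointable m T'" by (rule common_level[OF assms(3,4)])
  ultimately have A: "adjointable (max n m) S" "adjointable (max n m) S'" "adjointable (max n m) T" "adjointable (max n m) T'"
    using adjointable_mono[of n _ "max n m"] adjointable_mono[of m _ "max n m"] by auto
  have "S (T f) = (\<lambda>p. S (\<lambda>p. T f p - T' f p) p + S (T' f) p)" if f: "f \<in> cont_fun" for f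
    using adjointable_add[OF A(1) adjointable_closed[OF adjointable_minus[OF A(3,4)] f] adjointable_closed[OF A(4) f]]
    by simp
  then have "opdist (\<lambda>f. S (T f)) (\<lambda>f. S' (T' f))
      = unorm (\<lambda>f p. S (\<lambda>p. T f p - T' f p) p + (S (T' f) p - S' (T' f) p))"
    unfolding opdist_def by (intro unorm_cong) (simp add: algebra_simps)
  also have "\<dots> \<le> unorm (\<lambda>f. S (\<lambda>p. T f p - T' f p)) + unorm (\<lambda>f p. S (T' f) p - S' (T' f) p)"
    by (rule unorm_triangle[OF adjointable_comp[OF A(1) adjointable_minus[OF A(3,4)]]
          adjointable_comp[OF adjointable_minus[OF A(1,2)] A(4)]])
  also have "\<dots> \<le> unorm S * opdist T T' + opdist S S' * unorm T'"
    unfolding opdist_def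
    by (rule add_mono[OF unorm_comp[OF A(1) adjointable_minus[OF A(3,4)]]
          unorm_comp[OF adjointable_minus[OF A(1,2)] A(4)]])
  finally show ?thesis .
qed

lemma embed_add:
  assumes "core_op n S" "core_op n T"
  shows "aadd (core N \<gamma>) (embed S) (embed T) = embed (\<lambda>f p. S f p + T f p)"
proof -
  note P = embed_in_core[OF assms(1)] and Q = embed_in_core[OF assms(2)]
  note lev = some_level_core_op[OF assms(1)] some_level_core_op[OF assms(2)]
    rep_op_some_level[OF P] rep_op_some_level[OF Q]
  have "limit_elt (\<lambda>_ f p. S f p + T f p) = limit_elt (\<lambda>m f p. rep_op (embed S) m f p + rep_op (embed T) m f p)"
  proof (rule limit_elt_eq)
    show "(\<lambda>m. opdist (\<lambda>f p. S f p + T f p) (\<lambda>f p. rep_op (embed S) m f p + rep_op (embed T) m f p)) \<longlonglongrightarrow> 0"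
    proof (rule tendsto_0_upper)
      show "(\<lambda>m. opdist S (rep_op (embed S) m) + opdist T (rep_op (embed T) m)) \<longlonglongrightarrow> 0"
        using tendsto_add[OF embed_rep_op[OF assms(1)] embed_rep_op[OF assms(2)]] by simp
    qed (rule opdist_nonneg opdist_plus some_level_plus lev)+
  qed (rule some_level_plus lev)+
  then show ?thesis unfolding aadd_core[OF P Q] by (simp add: embed_def)
qed

lemma embed_scale:
  assumes "core_op n T"
  shows "ascale (core N \<gamma>) c (embed T) = embed (\<lambda>f p. c * T f p)"
proof -
  note P = embed_in_core[OF assms(1)]
  note lev = some_level_core_op[OF assms(1)] rep_op_some_level[OF P]
  have "limit_elt (\<lambda>_ f p. c * T f p) = limit_elt (\<lambda>m f p. c * rep_op (embed T) m f p)"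
  proof (rule limit_elt_eq)
    show "(\<lambda>m. opdist (\<lambda>f p. c * T f p) (\<lambda>f p. c * rep_op (embed T) m f p)) \<longlonglongrightarrow> 0"
    proof (rule tendsto_0_upper)
      show "(\<lambda>m. cmod c * opdist T (rep_op (embed T) m)) \<longlonglongrightarrow> 0"
        using tendsto_mult_right_zero[OF embed_rep_op[OF assms(1)]] by simp
    qed (rule opdist_nonneg opdist_cmult some_level_cmult lev)+
  qed (rule some_level_cmult lev)+
  then show ?thesis unfolding ascale_core[OF P] by (simp add: embed_def)
qed

text \<open>The representatives converge to \<open>S\<close> and \<open>T\<close> in norm, and a norm convergent sequence is bounded.\<close>

lemma embed_mult:
  assumes "core_op n S" "core_op n T"
  shows "amult (core N \<gamma>) (embed S) (embed T) = embed (\<lambda>f. S (T f))"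
proof -
  note P = embed_in_core[OF assms(1)] and Q = embed_in_core[OF assms(2)]
  note lev = some_level_core_op[OF assms(1)] some_level_core_op[OF assms(2)]
    rep_op_some_level[OF P] rep_op_some_level[OF Q]
  have un: "unorm (rep_op (embed T) m) \<le> unorm T + opdist T (rep_op (embed T) m)" for m
    using unorm_le_opdist[OF lev(4,2)] opdist_commute[OF lev(4,2)] by simp
  have "limit_elt (\<lambda>_ f. S (T f)) = limit_elt (\<lambda>m f. rep_op (embed S) m (rep_op (embed T) m f))"
  proof (rule limit_elt_eq)
    show "(\<lambda>m. opdist (\<lambda>f. S (T f)) (\<lambda>f. rep_op (embed S) m (rep_op (embed T) m f))) \<longlonglongrightarrow> 0"
    proof (rule tendsto_0_upper)
      show "opdist (\<lambda>f. S (T f)) (\<lambda>f. rep_op (embed S) m (rep_op (embed T) m f)) \<le>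
          unorm S * opdist T (rep_op (embed T) m)
          + opdist S (rep_op (embed S) m) * (unorm T + opdist T (rep_op (embed T) m))" for m
        by (rule order_trans[OF opdist_comp[OF lev(1,3,2,4)]])
           (intro add_left_mono mult_left_mono un opdist_nonneg lev)
      have "(\<lambda>m. unorm S * opdist T (rep_op (embed T) m)
          + opdist S (rep_op (embed S) m) * (unorm T + opdist T (rep_op (embed T) m)))
          \<longlonglongrightarrow> unorm S * 0 + 0 * (unorm T + 0)"
        by (intro tendsto_intros embed_rep_op[OF assms(1)] embed_rep_op[OF assms(2)])
      then show "(\<lambda>m. unorm S * opdist T (rep_op (embed T) m)
          + opdist S (rep_op (embed S) m) * (unorm T + opdist T (rep_op (embed T) m))) \<longlonglongrightarrow> 0" by simp
    qed (rule opdist_nonneg some_level_comp[OF lev(1,2)] some_level_comp[OF lev(3,4)])+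
  qed (rule some_level_comp[OF lev(1,2)] some_level_comp[OF lev(3,4)])+
  then show ?thesis unfolding amult_core[OF P Q] by (simp add: embed_def)
qed

text \<open>Taking adjoints is isometric, so adjoints of representatives represent the adjoint.\<close>

lemma embed_star:
  assumes "core_op n T" "adjoint_pair n T S"
  shows "astar (core N \<gamma>) (embed T) = embed S"
proof -
  note P = embed_in_core[OF assms(1)]
  have "\<exists>R. adjoint_pair (fst (rep (embed T) m)) (rep_op (embed T) m) R" for m
    using core_op_adjointable[OF rep_op_core_op[OF P]] by (auto simp: adjointable_def)
  then obtain R where R: "\<And>m. adjoint_pair (fst (rep (embed T) m)) (rep_op (embed T) m) (R m)" by metis
  have dist: "opdist S (R m) = opdist T (rep_op (embed T) m)" for m
  proof -
    let ?k = "max n (fst (rep (embed T) m))"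
    have "adjoint_pair ?k T S" "adjoint_pair ?k (rep_op (embed T) m) (R m)"
      using adjoint_pair_mono[OF assms(2)] adjoint_pair_mono[OF R] by auto
    from unorm_adjoint[OF adjoint_pair_minus[OF this]] show ?thesis by (simp add: opdist_def)
  qed
  have "limit_elt (\<lambda>_. S) = limit_elt R"
  proof (rule limit_elt_eq)
    show "some_level S" using adjointableI[OF adjoint_pair_sym[OF assms(2)]] by (rule some_levelI)
    show "some_level (R m)" for m using adjointableI[OF adjoint_pair_sym[OF R]] by (rule some_levelI)
    show "(\<lambda>m. opdist S (R m)) \<longlonglongrightarrow> 0" unfolding dist by (rule embed_rep_op[OF assms(1)])
  qed
  then show ?thesis unfolding astar_core[OF P R] by (simp add: embed_def)
qed

text \<open>The norms along a Cauchy sequence converge, and asymptotic sequences give the same limit.\<close>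

lemma anorm_limit_elt:
  assumes a: "\<And>m. core_op (n m) (a m)"
    and cauchy: "\<And>e. e > 0 \<Longrightarrow> \<exists>M. \<forall>m\<ge>M. \<forall>k\<ge>M. opdist (a m) (a k) < e"
  shows "(\<lambda>m. unorm (a m)) \<longlonglongrightarrow> anorm (core N \<gamma>) (limit_elt a)"
proof -
  note P = limit_elt_in_core[of n a, OF a cauchy]
  have lev: "some_level (a m)" for m using a some_level_core_op by blast
  have diff: "\<bar>unorm S - unorm T\<bar> \<le> opdist S T" if "some_level S" "some_level T" for S T
    using unorm_le_opdist[OF that] unorm_le_opdist[OF that(2,1)] opdist_commute[OF that] by linarith
  have "Cauchy (\<lambda>m. unorm (a m))"
  proof (rule CauchyI)
    fix e :: real assume "e > 0"
    then obtain M where M: "\<And>m k. m \<ge> M \<Longrightarrow> k \<ge> M \<Longrightarrow> opdist (a m) (a k) < e"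
      using cauchy by blast
    have "norm (unorm (a m) - unorm (a k)) < e" if "m \<ge> M" "k \<ge> M" for m k
      using M[OF that] diff[OF lev lev, of m k] by simp
    then show "\<exists>M. \<forall>m\<ge>M. \<forall>k\<ge>M. norm (unorm (a m) - unorm (a k)) < e" by blast
  qed
  then obtain l where l: "(\<lambda>m. unorm (a m)) \<longlonglongrightarrow> l"
    using Cauchy_convergent convergent_def by blast
  have "(\<lambda>m. \<bar>unorm (a m) - unorm (rep_op (limit_elt a) m)\<bar>) \<longlonglongrightarrow> 0"
    by (rule tendsto_0_upper[OF _ _ rep_op_tendsto[OF P]]) (use diff[OF lev rep_op_some_level[OF P]] in auto)
  then have "(\<lambda>m. unorm (a m) - unorm (rep_op (limit_elt a) m)) \<longlonglongrightarrow> 0"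
    by (rule tendsto_rabs_zero_cancel)
  from tendsto_diff[OF l this] have "(\<lambda>m. unorm (rep_op (limit_elt a) m)) \<longlonglongrightarrow> l" by simp
  then have "anorm (core N \<gamma>) (limit_elt a) = l" by (simp add: anorm_core[OF P] limI)
  then show ?thesis using l by simp
qed

lemma limit_elt_rep_op:
  assumes "P \<in> acarr (core N \<gamma>)"
  shows "limit_elt (rep_op P) = P"
proof -
  obtain s where s: "s \<in> core_seqs" "P = limit_elt (\<lambda>m. model (s m))"
    using assms seq_class_limit_elt by (auto simp: acarr_core completion_def simp del: level_alg_simps)
  have "(\<lambda>m. opdist (model (s m)) (rep_op P m)) \<longlonglongrightarrow> 0"
    using rep_op_tendsto[of "\<lambda>m. model (s m)"] assms s(2) by simp
  then have "limit_elt (\<lambda>m. model (s m)) = limit_elt (rep_op P)"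
    by (intro limit_elt_eq core_seqs_level[OF s(1)] rep_op_some_level[OF assms])
  then show ?thesis using s(2) by simp
qed

lemma anorm_nonneg:
  assumes "P \<in> acarr (core N \<gamma>)"
  shows "0 \<le> anorm (core N \<gamma>) P"
proof -
  have "(\<lambda>m. unorm (rep_op P m)) \<longlonglongrightarrow> anorm (core N \<gamma>) (limit_elt (rep_op P))"
    by (rule anorm_limit_elt[OF rep_op_core_op[OF assms] rep_op_cauchy[OF assms]])
  then show ?thesis
    unfolding limit_elt_rep_op[OF assms]
    by (rule LIMSEQ_le_const) (use unorm_nonneg[OF core_op_adjointable[OF rep_op_core_op[OF assms]]] in auto)
qed

lemma anorm_embed: "core_op n T \<Longrightarrow> anorm (core N \<gamma>) (embed T) = unorm T"
  unfolding embed_def by (rule LIMSEQ_unique[OF anorm_limit_elt[of "\<lambda>_. n" "\<lambda>_. T"] tendsto_const]) auto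

text \<open>Take for \<open>T\<close> a sufficiently late member of the representing sequence of \<open>P\<close>. The difference is
  written as a sum with a multiple by \<open>- 1\<close>, to which the linearity of a trace applies directly.\<close>

lemma core_dense:
  assumes P: "P \<in> acarr (core N \<gamma>)" and e: "e > 0"
  obtains n T where "core_op n T"
    "aadd (core N \<gamma>) P (ascale (core N \<gamma>) (- 1) (embed T)) \<in> acarr (core N \<gamma>)"
    "anorm (core N \<gamma>) (aadd (core N \<gamma>) P (ascale (core N \<gamma>) (- 1) (embed T))) \<le> e"
proof -
  obtain M where M: "\<And>m k. m \<ge> M \<Longrightarrow> k \<ge> M \<Longrightarrow> opdist (rep_op P m) (rep_op P k) < e"
    using rep_op_cauchy[OF P e] by blast
  define T where "T = rep_op P M"
  define S where "S = (\<lambda>f p. (- 1) * T f p)"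
  have T: "core_op (fst (rep P M)) T" unfolding T_def by (rule rep_op_core_op[OF P])
  have S: "core_op (fst (rep P M)) S" unfolding S_def by (rule core_op_scale[OF T])
  note Q = embed_in_core[OF S]
  define b where "b = (\<lambda>m f p. rep_op P m f p - T f p)"
  have b: "core_op (max (fst (rep P m)) (fst (rep P M))) (b m)" for m
    using core_op_add[OF core_op_mono[OF rep_op_core_op[OF P]] core_op_mono[OF S], of m "max (fst (rep P m)) (fst (rep P M))"]
    by (simp add: b_def S_def)
  have eq: "opdist (b m) (b k) = opdist (rep_op P m) (rep_op P k)" for m k
    by (simp add: b_def opdist_def)
  have "limit_elt (\<lambda>m f p. rep_op P m f p + rep_op (embed S) m f p) = limit_elt b"
  proof (rule limit_elt_eq)
    show "some_level (b m)" for m using b some_level_core_op by blast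
    show "some_level (\<lambda>f p. rep_op P m f p + rep_op (embed S) m f p)" for m
      by (intro some_level_plus rep_op_some_level P Q)
    have "opdist (\<lambda>f p. rep_op P m f p + rep_op (embed S) m f p) (\<lambda>f p. rep_op P m f p + S f p)
       \<le> opdist S (rep_op (embed S) m)" for m
      using opdist_plus[OF rep_op_some_level[OF P] rep_op_some_level[OF P] rep_op_some_level[OF Q] some_level_core_op[OF S], of m m m]
        opdist_commute[OF rep_op_some_level[OF Q] some_level_core_op[OF S], of m] by simp
    then have "opdist (\<lambda>f p. rep_op P m f p + rep_op (embed S) m f p) (b m) \<le> opdist S (rep_op (embed S) m)" for m
      by (simp add: b_def S_def)
    then show "(\<lambda>m. opdist (\<lambda>f p. rep_op P m f p + rep_op (embed S) m f p) (b m)) \<longlonglongrightarrow> 0"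
      using \<open>\<And>m. some_level (b m)\<close> \<open>\<And>m. some_level (\<lambda>f p. rep_op P m f p + rep_op (embed S) m f p)\<close>
      by (intro tendsto_0_upper[OF _ _ embed_rep_op[OF S]] opdist_nonneg) auto
  qed
  then have sum: "aadd (core N \<gamma>) P (ascale (core N \<gamma>) (- 1) (embed T)) = limit_elt b"
    unfolding embed_scale[OF T] S_def[symmetric] by (simp add: aadd_core[OF P Q])
  have cauchy: "\<exists>M. \<forall>m\<ge>M. \<forall>k\<ge>M. opdist (b m) (b k) < d" if "d > 0" for d
    unfolding eq by (rule rep_op_cauchy[OF P that])
  have "limit_elt b \<in> acarr (core N \<gamma>)" by (rule limit_elt_in_core[OF b cauchy])
  moreover have "anorm (core N \<gamma>) (limit_elt b) \<le> e"
  proof (rule LIMSEQ_le_const2[OF anorm_limit_elt[OF b cauchy]])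
    have "unorm (b m) \<le> e" if "m \<ge> M" for m
      using M[OF that order_refl] by (simp add: b_def T_def opdist_def)
    then show "\<exists>N. \<forall>m\<ge>N. unorm (b m) \<le> e" by blast
  qed
  ultimately show ?thesis using that T sum by simp
qed


section \<open>Finite traces on the core\<close>

context
  fixes \<tau> :: "'k core_elt \<Rightarrow> complex"
  assumes \<tau>: "finite_trace (core N \<gamma>) \<tau>"
begin

lemma trace_axioms:
  assumes "P \<in> acarr (core N \<gamma>)" "Q \<in> acarr (core N \<gamma>)"
  shows "\<tau> (aadd (core N \<gamma>) P Q) = \<tau> P + \<tau> Q" "\<tau> (ascale (core N \<gamma>) c P) = c * \<tau> P"
    "\<tau> (amult (core N \<gamma>) P Q) = \<tau> (amult (core N \<gamma>) Q P)"
    "\<tau> (amult (core N \<gamma>) (astar (core N \<gamma>) P) P) \<in> \<real>\<^sub>\<ge>\<^sub>0"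
  using \<tau> assms unfolding finite_trace_def by blast+

lemma trace_add:
  assumes "core_op n S" "core_op n T"
  shows "\<tau> (embed (\<lambda>f p. S f p + T f p)) = \<tau> (embed S) + \<tau> (embed T)"
  using trace_axioms(1)[OF embed_in_core[OF assms(1)] embed_in_core[OF assms(2)]] by (simp add: embed_add[OF assms])

lemma trace_scale:
  assumes "core_op n T"
  shows "\<tau> (embed (\<lambda>f p. c * T f p)) = c * \<tau> (embed T)"
  using trace_axioms(2)[OF embed_in_core[OF assms] embed_in_core[OF assms]] by (simp add: embed_scale[OF assms])

lemma trace_commute:
  assumes "core_op n S" "core_op n T"
  shows "\<tau> (embed (\<lambda>f. S (T f))) = \<tau> (embed (\<lambda>f. T (S f)))"
  using trace_axioms(3)[OF embed_in_core[OF assms(1)] embed_in_core[OF assms(2)]]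
  by (simp add: embed_mult[OF assms] embed_mult[OF assms(2,1)])

lemma trace_positive:
  assumes "core_op n T" "core_op n S" "adjoint_pair n T S"
  shows "\<tau> (embed (\<lambda>f. S (T f))) \<in> \<real>\<^sub>\<ge>\<^sub>0"
  using trace_axioms(4)[OF embed_in_core[OF assms(1)] embed_in_core[OF assms(1)]]
  by (simp add: embed_mult[OF assms(2,1)] embed_star[OF assms(1,3)])

lemma trace_bound:
  obtains M where "0 \<le> M" "\<And>n T. core_op n T \<Longrightarrow> cmod (\<tau> (embed T)) \<le> M * unorm T"
    "\<And>P. P \<in> acarr (core N \<gamma>) \<Longrightarrow> cmod (\<tau> P) \<le> M * \<bar>anorm (core N \<gamma>) P\<bar>"
proof -
  obtain M where M: "\<And>P. P \<in> acarr (core N \<gamma>) \<Longrightarrow> cmod (\<tau> P) \<le> M * anorm (core N \<gamma>) P"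
    using \<tau> unfolding finite_trace_def by blast
  have *: "cmod (\<tau> P) \<le> \<bar>M\<bar> * \<bar>anorm (core N \<gamma>) P\<bar>" if "P \<in> acarr (core N \<gamma>)" for P
    using order_trans[OF M[OF that] abs_ge_self] by (simp add: abs_mult)
  have "cmod (\<tau> (embed T)) \<le> \<bar>M\<bar> * unorm T" if "core_op n T" for n T
    using *[OF embed_in_core[OF that]] unorm_nonneg[OF core_op_adjointable[OF that]]
    by (simp add: anorm_embed[OF that])
  with * show ?thesis by (intro that[of "\<bar>M\<bar>"]) auto
qed

end

text \<open>Both traces are bounded, and the levels are dense in the core.\<close>

lemma trace_eqI_core_op:
  assumes \<tau>: "finite_trace (core N \<gamma>) \<tau>" and \<tau>': "finite_trace (core N \<gamma>) \<tau>'"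
    and eq: "\<And>n T. core_op n T \<Longrightarrow> \<tau> (embed T) = \<tau>' (embed T)"
  shows "\<tau> = \<tau>'"
proof (rule extensionalityI)
  show "\<tau> \<in> extensional (acarr (core N \<gamma>))" "\<tau>' \<in> extensional (acarr (core N \<gamma>))"
    using \<tau> \<tau>' by (auto simp: finite_trace_def)
  fix P assume P: "P \<in> acarr (core N \<gamma>)"
  obtain M where M: "0 \<le> M" "\<And>P. P \<in> acarr (core N \<gamma>) \<Longrightarrow> cmod (\<tau> P) \<le> M * \<bar>anorm (core N \<gamma>) P\<bar>"
    by (rule trace_bound[OF \<tau>], rule that, assumption+)
  obtain M' where M': "0 \<le> M'" "\<And>P. P \<in> acarr (core N \<gamma>) \<Longrightarrow> cmod (\<tau>' P) \<le> M' * \<bar>anorm (core N \<gamma>) P\<bar>"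
    by (rule trace_bound[OF \<tau>'], rule that, assumption+)
  have "cmod (\<tau> P - \<tau>' P) \<le> 0 + e" if e: "e > 0" for e
  proof -
    define d where "d = e / (M + M' + 1)"
    have d: "d > 0" using e M(1) M'(1) by (simp add: d_def)
    obtain n T where T: "core_op n T"
      and Q: "aadd (core N \<gamma>) P (ascale (core N \<gamma>) (- 1) (embed T)) \<in> acarr (core N \<gamma>)" (is "?Q \<in> _")
        "anorm (core N \<gamma>) (aadd (core N \<gamma>) P (ascale (core N \<gamma>) (- 1) (embed T))) \<le> d"
      by (rule core_dense[OF P d])
    have Q': "\<bar>anorm (core N \<gamma>) ?Q\<bar> \<le> d"
      using Q(2) anorm_nonneg[OF Q(1)] by simp
    have S: "core_op n (\<lambda>f p. - 1 * T f p)" by (rule core_op_scale[OF T])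
    have sc: "ascale (core N \<gamma>) (- 1) (embed T) \<in> acarr (core N \<gamma>)"
      unfolding embed_scale[OF T] by (rule embed_in_core[OF S])
    have split: "\<rho> ?Q = \<rho> P - \<rho> (embed T)" if "finite_trace (core N \<gamma>) \<rho>" for \<rho>
      using trace_axioms(1)[OF that P sc] trace_axioms(2)[OF that embed_in_core[OF T] P] by simp
    have "cmod (\<tau> P - \<tau>' P) = cmod (\<tau> ?Q - \<tau>' ?Q)"
      by (simp add: split[OF \<tau>] split[OF \<tau>'] eq[OF T])
    also have "\<dots> \<le> cmod (\<tau> ?Q) + cmod (\<tau>' ?Q)" by (rule norm_triangle_ineq4)
    also have "\<dots> \<le> M * d + M' * d"
      using M(2)[OF Q(1)] M'(2)[OF Q(1)] mult_left_mono[OF Q' M(1)] mult_left_mono[OF Q' M'(1)] by linarith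
    also have "\<dots> \<le> (M + M' + 1) * d" using d by (simp add: algebra_simps)
    also have "\<dots> = e" using M(1) M'(1) by (simp add: d_def)
    finally show ?thesis by simp
  qed
  then have "cmod (\<tau> P - \<tau>' P) \<le> 0" by (rule field_le_epsilon)
  then show "\<tau> P = \<tau>' P" by simp
qed

text \<open>Both traces are bounded, and the finite-rank operators are dense in the compact operators.\<close>

lemma trace_eq_compact:
  assumes \<tau>: "finite_trace (core N \<gamma>) \<tau>" and \<tau>': "finite_trace (core N \<gamma>) \<tau>'"
    and n: "n \<ge> 1"
    and eq: "\<And>f g. f \<in> cont_fun \<Longrightarrow> g \<in> cont_fun \<Longrightarrow> \<tau> (embed (rank1 n f g)) = \<tau>' (embed (rank1 n f g))"
    and T: "compact_op n T"
  shows "\<tau> (embed T) = \<tau>' (embed T)"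
proof -
  have trace_zero: "\<rho> (embed (\<lambda>z p. 0)) = 0" if "finite_trace (core N \<gamma>) \<rho>" for \<rho>
    using trace_scale[OF that core_op_compact[OF compact_op_zero n], of 0] by simp
  have fr_core: "core_op n S" if "S \<in> finite_rank n" for S
    using that
  proof (induction rule: finite_rank.induct)
    case zero
    show ?case by (rule core_op_compact[OF compact_op_zero n])
  next
    case (add_rank1 S f g)
    then show ?case by (intro core_op_add core_op_rank1)
  qed
  have fr: "\<tau> (embed S) = \<tau>' (embed S)" if "S \<in> finite_rank n" for S
    using that
  proof (induction rule: finite_rank.induct)
    case zero
    then show ?case by (simp add: trace_zero[OF \<tau>] trace_zero[OF \<tau>'])
  next
    case (add_rank1 S f g)
    then show ?case
      using trace_add[OF \<tau> core_op_rank1[OF add_rank1(2,3)] fr_core[OF add_rank1(1)]]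
        trace_add[OF \<tau>' core_op_rank1[OF add_rank1(2,3)] fr_core[OF add_rank1(1)]] by (simp add: eq)
  qed
  obtain M where M: "0 \<le> M" "\<And>n T. core_op n T \<Longrightarrow> cmod (\<tau> (embed T)) \<le> M * unorm T"
    by (rule trace_bound[OF \<tau>], rule that, assumption+)
  obtain M' where M': "0 \<le> M'" "\<And>n T. core_op n T \<Longrightarrow> cmod (\<tau>' (embed T)) \<le> M' * unorm T"
    by (rule trace_bound[OF \<tau>'], rule that, assumption+)
  note Tc = core_op_compact[OF T n]
  have "cmod (\<tau> (embed T) - \<tau>' (embed T)) \<le> 0 + e" if e: "e > 0" for e
  proof -
    define d where "d = e / (M + M' + 1)"
    have d: "d > 0" using e M(1) M'(1) by (simp add: d_def)
    obtain S where S: "S \<in> finite_rank n" "adjointable n S" "unorm (\<lambda>f p. T f p - S f p) < d"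
      using approximableE[OF compact_op_approximable[OF T] d] .
    define D where "D = (\<lambda>f p. T f p - S f p)"
    have D: "core_op n D"
      using core_op_add[OF Tc core_op_scale[OF fr_core[OF S(1)], of "-1"]] by (simp add: D_def)
    have T_eq: "T = (\<lambda>f p. D f p + S f p)" by (simp add: D_def)
    have split: "\<rho> (embed T) = \<rho> (embed D) + \<rho> (embed S)" if "finite_trace (core N \<gamma>) \<rho>" for \<rho>
      unfolding T_eq by (rule trace_add[OF that D fr_core[OF S(1)]])
    have un: "unorm D \<le> d" using S(3) by (simp add: D_def)
    have "cmod (\<tau> (embed T) - \<tau>' (embed T)) = cmod (\<tau> (embed D) - \<tau>' (embed D))"
      by (simp add: split[OF \<tau>] split[OF \<tau>'] fr[OF S(1)])
    also have "\<dots> \<le> cmod (\<tau> (embed D)) + cmod (\<tau>' (embed D))" by (rule norm_triangle_ineq4)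
    also have "\<dots> \<le> M * d + M' * d"
      using M(2)[OF D] M'(2)[OF D] mult_left_mono[OF un M(1)] mult_left_mono[OF un M'(1)] by linarith
    also have "\<dots> \<le> (M + M' + 1) * d" using d by (simp add: algebra_simps)
    also have "\<dots> = e" using M(1) M'(1) by (simp add: d_def)
    finally show ?thesis by simp
  qed
  then have "cmod (\<tau> (embed T) - \<tau>' (embed T)) \<le> 0" by (rule field_le_epsilon)
  then show ?thesis by simp
qed

lemma trace_eqI:
  assumes \<tau>: "finite_trace (core N \<gamma>) \<tau>" and \<tau>': "finite_trace (core N \<gamma>) \<tau>'"
    and mult: "\<And>a. a \<in> cont_fun \<Longrightarrow> \<tau> (embed (\<lambda>f p. a p * f p)) = \<tau>' (embed (\<lambda>f p. a p * f p))"
    and rank1: "\<And>n f g. n \<ge> 1 \<Longrightarrow> f \<in> cont_fun \<Longrightarrow> g \<in> cont_fun \<Longrightarrow>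
      \<tau> (embed (rank1 n f g)) = \<tau>' (embed (rank1 n f g))"
  shows "\<tau> = \<tau>'"
proof (rule trace_eqI_core_op[OF \<tau> \<tau>'])
  fix n T assume "core_op n T"
  then obtain a F where a: "a \<in> cont_fun" and F: "\<And>i. i \<in> {1..n} \<Longrightarrow> compact_op i (F i)"
    and T: "\<And>f. f \<in> cont_fun \<Longrightarrow> T f = (\<lambda>p. a p * f p + (\<Sum>i=1..n. F i f p))"
    using core_opE by blast
  have "core_op n (\<lambda>f p. a p * f p + (\<Sum>i=1..m. F i f p)) \<and>
      \<tau> (embed (\<lambda>f p. a p * f p + (\<Sum>i=1..m. F i f p))) = \<tau>' (embed (\<lambda>f p. a p * f p + (\<Sum>i=1..m. F i f p)))"
    if "m \<le> n" for m
    using that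
  proof (induction m)
    case 0
    then show ?case using mult[OF a] core_op_mono[OF core_op_left_mult[OF a], of n] by simp
  next
    case (Suc m)
    have c: "compact_op (Suc m) (F (Suc m))" using F Suc.prems by auto
    have c': "core_op n (F (Suc m))"
      by (rule core_op_mono[OF core_op_compact[OF c]]) (use Suc.prems in auto)
    have IH: "core_op n (\<lambda>f p. a p * f p + (\<Sum>i=1..m. F i f p))"
      "\<tau> (embed (\<lambda>f p. a p * f p + (\<Sum>i=1..m. F i f p))) = \<tau>' (embed (\<lambda>f p. a p * f p + (\<Sum>i=1..m. F i f p)))"
      using Suc by auto
    have "\<tau> (embed (F (Suc m))) = \<tau>' (embed (F (Suc m)))"
      by (rule trace_eq_compact[OF \<tau> \<tau>' _ rank1 c]) auto
    then show ?case
      using core_op_add[OF IH(1) c'] trace_add[OF \<tau> IH(1) c'] trace_add[OF \<tau>' IH(1) c'] IH(2)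
      by (simp add: add.assoc)
  qed
  then have "\<tau> (embed (\<lambda>f p. a p * f p + (\<Sum>i=1..n. F i f p))) = \<tau>' (embed (\<lambda>f p. a p * f p + (\<Sum>i=1..n. F i f p)))"
    by blast
  moreover have "embed T = embed (\<lambda>f p. a p * f p + (\<Sum>i=1..n. F i f p))"
    by (rule embed_cong) (rule T)
  ultimately show "\<tau> (embed T) = \<tau>' (embed T)" by simp
qed


section \<open>Separation of the branches off the branch set\<close>

text \<open>For each pair of branches the distance is a continuous function of \<open>y\<close>, positive on the compact set
  of those \<open>y\<close> with \<open>\<gamma> j y \<in> S\<close>, since a zero of it would be a branch point in \<open>S\<close>.\<close>

lemma branches_separated:
  assumes S: "closed S" "S \<inter> branch_set N \<gamma> = {}"
  obtains \<delta> where "\<delta> > 0"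
    "\<And>i j y. i \<in> {1..N} \<Longrightarrow> j \<in> {1..N} \<Longrightarrow> i \<noteq> j \<Longrightarrow> \<gamma> j y \<in> S \<Longrightarrow> \<delta> \<le> dist (\<gamma> j y) (\<gamma> i y)"
proof -
  have pair: "\<exists>d>0. \<forall>y. \<gamma> j y \<in> S \<longrightarrow> d \<le> dist (\<gamma> j y) (\<gamma> i y)"
    if ij: "i \<in> {1..N}" "j \<in> {1..N}" "i \<noteq> j" for i j
  proof -
    define Z where "Z = {y. \<gamma> j y \<in> S}"
    have "closed Z"
      using continuous_closed_vimage[OF S(1), of "\<gamma> j"] gamma_cont[OF ij(2)]
      by (simp add: Z_def vimage_def continuous_on_eq_continuous_at)
    then have Z: "compact Z" using compact_space by (metis compact_Int_closed inf_top_left)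
    have cont: "continuous_on Z (\<lambda>y. dist (\<gamma> j y) (\<gamma> i y))"
      using gamma_cont ij by (intro continuous_intros) (auto intro: continuous_on_subset)
    show ?thesis
    proof (cases "Z = {}")
      case True
      then show ?thesis by (intro exI[of _ 1]) (auto simp: Z_def)
    next
      case False
      then obtain y where y: "y \<in> Z" "\<And>y'. y' \<in> Z \<Longrightarrow> dist (\<gamma> j y) (\<gamma> i y) \<le> dist (\<gamma> j y') (\<gamma> i y')"
        using continuous_attains_inf[OF Z False cont] by blast
      have "\<gamma> j y \<noteq> \<gamma> i y"
      proof
        assume "\<gamma> j y = \<gamma> i y"
        then have "\<gamma> j y \<in> branch_set N \<gamma>" using ij unfolding branch_set_def by blast
        then show False using S(2) y(1) by (auto simp: Z_def)
      qed
      then show ?thesis using y(2) by (intro exI[of _ "dist (\<gamma> j y) (\<gamma> i y)"]) (auto simp: Z_def)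
    qed
  qed
  then obtain d where d: "\<And>i j. i \<in> {1..N} \<Longrightarrow> j \<in> {1..N} \<Longrightarrow> i \<noteq> j \<Longrightarrow>
      d i j > 0 \<and> (\<forall>y. \<gamma> j y \<in> S \<longrightarrow> d i j \<le> dist (\<gamma> j y) (\<gamma> i y))"
    by metis
  define D where "D = insert (1::real) ((\<lambda>(i, j). d i j) ` {(i, j). i \<in> {1..N} \<and> j \<in> {1..N} \<and> i \<noteq> j})"
  have "{(i, j). i \<in> {1..N} \<and> j \<in> {1..N} \<and> i \<noteq> j} \<subseteq> {1..N} \<times> {1..N}" by auto
  then have "finite {(i, j). i \<in> {1..N} \<and> j \<in> {1..N} \<and> i \<noteq> j}"
    by (rule finite_subset) simp
  then have fin: "finite D" unfolding D_def by (intro finite.insertI finite_imageI)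
  have "Min D > 0" using fin d by (subst Min_gr_iff) (auto simp: D_def)
  moreover have "Min D \<le> dist (\<gamma> j y) (\<gamma> i y)" if "i \<in> {1..N}" "j \<in> {1..N}" "i \<noteq> j" "\<gamma> j y \<in> S" for i j y
  proof -
    have "Min D \<le> d i j" using fin that by (intro Min_le) (auto simp: D_def)
    also have "\<dots> \<le> dist (\<gamma> j y) (\<gamma> i y)" using d[OF that(1-3)] that(4) by blast
    finally show ?thesis .
  qed
  ultimately show ?thesis by (rule that)
qed

text \<open>For a finite branch set this is \<open>1\<close> near it and tends to its indicator function as \<open>m\<close> grows. The
  product of the distances vanishes exactly on the branch set, even if that set is empty.\<close>

definition cutoff :: "nat \<Rightarrow> 'k \<Rightarrow> real" where
  "cutoff m p = max 0 (min 1 (2 - real m * (\<Prod>b\<in>branch_set N \<gamma>. dist p b)))"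

lemma cutoff_cont: "continuous_on UNIV (cutoff m)"
  unfolding cutoff_def by (intro continuous_intros)

lemma cutoff_bounds: "0 \<le> cutoff m p" "cutoff m p \<le> 1"
  by (auto simp: cutoff_def)


section \<open>The functionals induced by a trace on C(K)\<close>

text \<open>This is \<open>\<theta>\<^sub>f\<^sub>,\<^sub>g \<theta>\<^sub>f\<^sub>'\<^sub>,\<^sub>g\<^sub>' = \<theta>\<^sub>u\<^sub>,\<^sub>g\<^sub>'\<close> with \<open>u = f \<cdot> (g | f')\<close>.\<close>

lemma rank1_comp: "rank1 n f g (rank1 n f' g' z) = rank1 n (\<lambda>p. f p * ip n g f' ((h ^^ n) p)) g' z"
  by (simp add: rank1_def ip_shift_right mult.assoc)

lemma rank1_scale_left: "rank1 n (\<lambda>p. c * f p) g = (\<lambda>z p. c * rank1 n f g z p)"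
  by (simp add: rank1_def mult.assoc)

lemma rank1_add_left: "rank1 n (\<lambda>p. f p + f' p) g = (\<lambda>z p. rank1 n f g z p + rank1 n f' g z p)"
  by (simp add: rank1_def distrib_right)

lemma ip_1_1: "ip n (\<lambda>_. 1) (\<lambda>_. 1) y = of_nat (N ^ n)"
  by (simp add: ip_def fibre_sum_const)

lemma ip_diff_right: "ip n f (\<lambda>p. g p - g' p) y = ip n f g y - ip n f g' y"
  by (simp add: ip_def right_diff_distrib fibre_sum_def sum_subtractf)

lemma ip_1_shift: "ip n (\<lambda>_. 1) (\<lambda>p. u ((h ^^ n) p)) y = of_nat (N ^ n) * u y"
  using ip_shift_right[of n "\<lambda>_. 1" "\<lambda>_. 1" u y] by (simp add: ip_1_1)

lemma shift_Suc: "(h ^^ Suc n) p = h ((h ^^ n) p)"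
  by simp

context
  fixes \<sigma> :: "'k core_elt \<Rightarrow> complex"
  assumes \<sigma>: "finite_trace (core N \<gamma>) \<sigma>"
begin

text \<open>The functional \<open>\<psi>\<^sub>n\<close> with \<open>\<sigma> (\<theta>\<^sub>f\<^sub>,\<^sub>g) = \<psi>\<^sub>n (g | f)\<close>. The constant function \<open>1\<close> has inner product \<open>N ^ n\<close>
  with itself, whence the normalisation.\<close>

definition psi :: "nat \<Rightarrow> ('k \<Rightarrow> complex) \<Rightarrow> complex" where
  "psi n b = \<sigma> (embed (rank1 n (\<lambda>p. b ((h ^^ n) p)) (\<lambda>_. 1))) / of_nat (N ^ n)"

lemma N_pow_nonzero: "(of_nat (N ^ n) :: 'c::field_char_0) \<noteq> 0"
  using N_pos by simp

text \<open>The trace property applied to \<open>\<theta>\<^sub>f\<^sub>,\<^sub>1 \<theta>\<^sub>1\<^sub>,\<^sub>g = N\<^sup>n \<theta>\<^sub>f\<^sub>,\<^sub>g\<close> and to the product in the opposite order, which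
  is \<open>\<theta>\<^sub>u\<^sub>,\<^sub>1\<close> with \<open>u = 1 \<cdot> (g | f)\<close>.\<close>

lemma trace_rank1:
  assumes f: "f \<in> cont_fun" and g: "g \<in> cont_fun"
  shows "\<sigma> (embed (rank1 n f g)) = psi n (ip n g f)"
proof -
  note one = cont_fun_const[of "1 :: complex"]
  have "\<sigma> (embed (\<lambda>z. rank1 n f (\<lambda>_. 1) (rank1 n (\<lambda>_. 1) g z))) = \<sigma> (embed (\<lambda>z. rank1 n (\<lambda>_. 1) g (rank1 n f (\<lambda>_. 1) z)))"
    by (rule trace_commute[OF \<sigma> core_op_rank1[OF f one] core_op_rank1[OF one g]])
  moreover have "(\<lambda>z. rank1 n f (\<lambda>_. 1) (rank1 n (\<lambda>_. 1) g z)) = (\<lambda>z p. of_nat (N ^ n) * rank1 n f g z p)"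
    unfolding rank1_comp ip_1_1 by (simp add: rank1_def ac_simps)
  moreover have "(\<lambda>z. rank1 n (\<lambda>_. 1) g (rank1 n f (\<lambda>_. 1) z)) = rank1 n (\<lambda>p. ip n g f ((h ^^ n) p)) (\<lambda>_. 1)"
    unfolding rank1_comp by simp
  ultimately have "of_nat (N ^ n) * \<sigma> (embed (rank1 n f g)) = \<sigma> (embed (rank1 n (\<lambda>p. ip n g f ((h ^^ n) p)) (\<lambda>_. 1)))"
    by (simp add: trace_scale[OF \<sigma> core_op_rank1[OF f g]])
  then show ?thesis
    unfolding psi_def using N_pow_nonzero[where 'c = complex] by (simp add: field_simps)
qed

lemma psi_add:
  assumes "a \<in> cont_fun" "b \<in> cont_fun"
  shows "psi n (\<lambda>p. a p + b p) = psi n a + psi n b"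
  unfolding psi_def rank1_add_left
  by (subst trace_add[OF \<sigma> core_op_rank1[of _ _ n] core_op_rank1[of _ _ n]])
     (simp_all add: cont_fun_shift assms cont_fun_const add_divide_distrib)

lemma psi_scale:
  assumes "a \<in> cont_fun"
  shows "psi n (\<lambda>p. c * a p) = c * psi n a"
  unfolding psi_def rank1_scale_left
  by (subst trace_scale[OF \<sigma> core_op_rank1[of _ _ n]])
     (simp_all add: cont_fun_shift assms cont_fun_const)

lemma psi_diff:
  assumes "a \<in> cont_fun" "b \<in> cont_fun"
  shows "psi n (\<lambda>p. a p - b p) = psi n a - psi n b"
  using psi_add[OF assms(1) cont_fun_mult[OF cont_fun_const[of "-1"] assms(2)], of n]
  by (simp only: psi_scale[OF assms(2)]) simp

lemma psi_sum:
  assumes "finite I" "\<And>i. i \<in> I \<Longrightarrow> a i \<in> cont_fun"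
  shows "psi n (\<lambda>p. \<Sum>i\<in>I. a i p) = (\<Sum>i\<in>I. psi n (a i))"
  using assms
proof (induction I rule: finite_induct)
  case empty
  show ?case using psi_scale[OF cont_fun_const[of 0], of n 0] by simp
next
  case (insert i I)
  then show ?case
    using psi_add[of "a i" "\<lambda>p. \<Sum>i\<in>I. a i p" n] by (simp add: cont_fun_sum)
qed

lemma psi_0:
  assumes "a \<in> cont_fun"
  shows "psi 0 a = \<sigma> (core_fun N \<gamma> a)"
proof -
  have "rank1 0 a (\<lambda>_. 1) = (\<lambda>f p. a p * f p)" by (auto simp: rank1_def ip_def fun_eq_iff)
  then show ?thesis
    by (simp add: psi_def core_fun_def left_op_0[OF assms] core_embed_op[OF adjointable_left_mult[OF assms]])
qed

text \<open>The function \<open>\<rho>\<close> is the square root of \<open>b\<close>, viewed as a vector of the tensor power by composing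
  with \<open>h ^^ n\<close>.\<close>

lemma ip_sqrt:
  fixes n :: nat
  assumes "\<And>p. 0 \<le> b p"
  defines "\<rho> \<equiv> \<lambda>p. complex_of_real (sqrt (b ((h ^^ n) p)))"
  shows "ip n \<rho> \<rho> = (\<lambda>y. of_nat (N ^ n) * complex_of_real (b y))"
    and "ip (Suc n) \<rho> \<rho> = (\<lambda>y. of_nat (N ^ n) * complex_of_real (fibre_sum (Suc 0) b y))"
proof -
  have sq: "cnj (\<rho> p) * \<rho> p = complex_of_real (b ((h ^^ n) p))" for p
    using assms(1) by (simp add: \<rho>_def flip: of_real_mult)
  have 1: "ip n \<rho> \<rho> y = of_nat (N ^ n) * complex_of_real (b y)" for y
    using ip_1_shift[of n "\<lambda>p. complex_of_real (b p)" y] by (simp add: ip_def sq)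
  then show "ip n \<rho> \<rho> = (\<lambda>y. of_nat (N ^ n) * complex_of_real (b y))" ..
  show "ip (Suc n) \<rho> \<rho> = (\<lambda>y. of_nat (N ^ n) * complex_of_real (fibre_sum (Suc 0) b y))"
    by (rule ext) (simp add: ip_Suc 1 fibre_sum_1 sum_distrib_left)
qed

text \<open>With \<open>\<rho> = \<surd>b \<circ> h\<^sup>n\<close>, the positive operator \<open>\<theta>\<^sub>\<rho>\<^sub>,\<^sub>1 \<theta>\<^sub>1\<^sub>,\<^sub>\<rho>\<close> has trace \<open>N\<^sup>2\<^sup>n \<psi>\<^sub>n(b)\<close>.\<close>

lemma psi_nonneg:
  assumes b: "continuous_on UNIV b" "\<And>p. 0 \<le> b p"
  shows "psi n (\<lambda>p. complex_of_real (b p)) \<in> \<real>\<^sub>\<ge>\<^sub>0"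
proof -
  define \<rho> where "\<rho> = (\<lambda>p. complex_of_real (sqrt (b ((h ^^ n) p))))"
  have bC: "(\<lambda>p. complex_of_real (b p)) \<in> cont_fun" by (rule cont_fun_of_real[OF b(1)])
  have "(\<lambda>p. complex_of_real (sqrt (b p))) \<in> cont_fun"
    by (intro cont_fun_of_real continuous_intros b(1))
  then have \<rho>: "\<rho> \<in> cont_fun" unfolding \<rho>_def by (rule cont_fun_shift)
  note one = cont_fun_const[of "1 :: complex"]
  have "\<sigma> (embed (\<lambda>z. rank1 n \<rho> (\<lambda>_. 1) (rank1 n (\<lambda>_. 1) \<rho> z))) \<in> \<real>\<^sub>\<ge>\<^sub>0"
    by (rule trace_positive[OF \<sigma> core_op_rank1[OF one \<rho>] core_op_rank1[OF \<rho> one] adjoint_pair_rank1[OF one \<rho>]])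
  moreover have "(\<lambda>z. rank1 n \<rho> (\<lambda>_. 1) (rank1 n (\<lambda>_. 1) \<rho> z)) = (\<lambda>z p. of_nat (N ^ n) * rank1 n \<rho> \<rho> z p)"
    unfolding rank1_comp ip_1_1 by (simp add: rank1_def ac_simps)
  moreover have "\<sigma> (embed (rank1 n \<rho> \<rho>)) = of_nat (N ^ n) * psi n (\<lambda>p. complex_of_real (b p))"
    unfolding trace_rank1[OF \<rho> \<rho>] ip_sqrt(1)[of b n, OF b(2), folded \<rho>_def] by (rule psi_scale[OF bC])
  ultimately have "complex_of_real (real (N ^ n) * real (N ^ n)) * psi n (\<lambda>p. complex_of_real (b p)) \<in> \<real>\<^sub>\<ge>\<^sub>0"
    by (simp add: trace_scale[OF \<sigma> core_op_rank1[OF \<rho> \<rho>]] mult.assoc)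
  then show ?thesis by (rule nonneg_complex_cancel) (use N_pos in simp)
qed

text \<open>With \<open>\<rho> = \<surd>b \<circ> h\<^sup>n\<close>, let \<open>\<theta>\<close> be the operator \<open>\<theta>\<^sub>\<rho>\<^sub>,\<^sub>\<rho>\<close> of the \<open>n\<close>-th tensor power and \<open>\<theta>'\<close> the one of the
  next. The map \<open>R\<close> that sends \<open>x \<in> X\<close> to \<open>\<rho> \<otimes> x\<close> satisfies \<open>R R\<^sup>* = \<theta> \<otimes> I\<close> and \<open>R \<theta>\<^sub>1\<^sub>,\<^sub>1 R\<^sup>* = \<theta>'\<close>, and
  \<open>\<theta>\<^sub>1\<^sub>,\<^sub>1\<close> is \<open>N\<close> times a projection. So \<open>N (\<theta> \<otimes> I) - \<theta>'\<close> is positive; its trace is \<open>N\<^sup>n\<close> times the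
  expression below.\<close>

lemma psi_Suc_le:
  assumes b: "continuous_on UNIV b" "\<And>p. 0 \<le> b p"
  shows "of_nat N * psi n (\<lambda>p. complex_of_real (b p))
    - psi (Suc n) (\<lambda>p. complex_of_real (fibre_sum (Suc 0) b p)) \<in> \<real>\<^sub>\<ge>\<^sub>0"
proof -
  define \<rho> where "\<rho> = (\<lambda>p. complex_of_real (sqrt (b ((h ^^ n) p))))"
  have bC: "(\<lambda>p. complex_of_real (b p)) \<in> cont_fun" by (rule cont_fun_of_real[OF b(1)])
  have LbC: "(\<lambda>p. complex_of_real (fibre_sum (Suc 0) b p)) \<in> cont_fun"
    by (rule cont_fun_of_real[OF fibre_sum_cont[OF b(1)]])
  have "(\<lambda>p. complex_of_real (sqrt (b p))) \<in> cont_fun"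
    by (intro cont_fun_of_real continuous_intros b(1))
  then have \<rho>: "\<rho> \<in> cont_fun" unfolding \<rho>_def by (rule cont_fun_shift)
  note one = cont_fun_const[of "1 :: complex"]
  \<comment> \<open>The product \<open>S T\<close> is \<open>N ^ (n + 1)\<close> times \<open>N (\<theta> \<otimes> I) - \<theta>'\<close>.\<close>
  define T where "T = (\<lambda>z p. of_nat N * rank1 n (\<lambda>_. 1) \<rho> z p - rank1 (Suc n) (\<lambda>_. 1) \<rho> z p)"
  define S where "S = (\<lambda>z p. of_nat N * rank1 n \<rho> (\<lambda>_. 1) z p - rank1 (Suc n) \<rho> (\<lambda>_. 1) z p)"
  have diff: "core_op (Suc n) (\<lambda>z p. of_nat N * U z p - U' z p)" if "core_op n U" "core_op (Suc n) U'" for U U'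
    using core_op_add[OF core_op_scale[OF core_op_Suc[OF that(1)], of "of_nat N"] core_op_scale[OF that(2), of "-1"]]
    by simp
  have "core_op (Suc n) T" "core_op (Suc n) S"
    unfolding T_def S_def by (intro diff core_op_rank1 one \<rho>)+
  moreover have "adjoint_pair (Suc n) T S"
    unfolding T_def S_def
    using adjoint_pair_minus[OF adjoint_pair_scale[OF adjoint_pair_Suc[OF adjoint_pair_rank1[OF one \<rho>, of n]], where c = "of_nat N"]
      adjoint_pair_rank1[OF one \<rho>, of "Suc n"]] by simp
  ultimately have pos: "\<sigma> (embed (\<lambda>z. S (T z))) \<in> \<real>\<^sub>\<ge>\<^sub>0"
    by (rule trace_positive[OF \<sigma>])
  let ?c = "of_nat (N ^ n) :: complex"
  have S_lin: "S (\<lambda>p. of_nat N * u p - v p) = (\<lambda>p. of_nat N * S u p - S v p)" for u v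
    by (auto simp: S_def rank1_def ip_diff_right ip_scale_right fun_eq_iff algebra_simps)
  have u: "S (rank1 n (\<lambda>_. 1) \<rho> z) = (\<lambda>p. ?c * (of_nat N * rank1 n \<rho> \<rho> z p - rank1 (Suc n) \<rho> \<rho> z p))" for z
  proof -
    have "ip (Suc n) (\<lambda>_. 1) (\<lambda>p. ip n \<rho> z ((h ^^ n) p)) y = ?c * ip (Suc n) \<rho> z y" for y
      by (simp add: ip_Suc ip_1_shift sum_distrib_left)
    then show ?thesis
      by (auto simp: S_def rank1_def ip_1_shift fun_eq_iff algebra_simps simp del: funpow.simps)
  qed
  \<comment> \<open>Both terms of \<open>S\<close> map a function \<open>u\<close> of \<open>h ^^ (n + 1)\<close> to \<open>N ^ (n + 1)\<close> times \<open>\<rho> u\<close>.\<close>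
  have v: "S (rank1 (Suc n) (\<lambda>_. 1) \<rho> z) = (\<lambda>p. 0)" for z
  proof -
    have "ip n (\<lambda>_. 1) (\<lambda>p. ip (Suc n) \<rho> z ((h ^^ Suc n) p)) y = ?c * ip (Suc n) \<rho> z (h y)" for y
      unfolding shift_Suc using ip_1_shift[of n "\<lambda>q. ip (Suc n) \<rho> z (h q)" y] .
    moreover have "ip (Suc n) (\<lambda>_. 1) (\<lambda>p. ip (Suc n) \<rho> z ((h ^^ Suc n) p)) y = of_nat N * ?c * ip (Suc n) \<rho> z y" for y
      using ip_1_shift[of "Suc n" "ip (Suc n) \<rho> z" y] by simp
    ultimately show ?thesis
      by (simp add: S_def rank1_def fun_eq_iff algebra_simps)
  qed
  have ST: "(\<lambda>z. S (T z)) = (\<lambda>z p. (of_nat N * ?c) * (of_nat N * rank1 n \<rho> \<rho> z p + (- 1) * rank1 (Suc n) \<rho> \<rho> z p))"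
    unfolding T_def S_lin u v by (simp add: algebra_simps)
  have "\<sigma> (embed (\<lambda>z. S (T z))) = (of_nat N * ?c) * (of_nat N * \<sigma> (embed (rank1 n \<rho> \<rho>)) - \<sigma> (embed (rank1 (Suc n) \<rho> \<rho>)))"
  proof -
    note c = core_op_scale[OF core_op_Suc[OF core_op_rank1[OF \<rho> \<rho>, of n]], where c = "of_nat N"]
      core_op_scale[OF core_op_rank1[OF \<rho> \<rho>, of "Suc n"], where c = "- 1"]
    show ?thesis
      unfolding ST trace_scale[OF \<sigma> core_op_add[OF c]] trace_add[OF \<sigma> c]
        trace_scale[OF \<sigma> core_op_rank1[OF \<rho> \<rho>]] by simp
  qed
  also have "\<dots> = (of_nat N * ?c * ?c) * (of_nat N * psi n (\<lambda>p. complex_of_real (b p))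
      - psi (Suc n) (\<lambda>p. complex_of_real (fibre_sum (Suc 0) b p)))"
  proof -
    have "\<sigma> (embed (rank1 n \<rho> \<rho>)) = ?c * psi n (\<lambda>p. complex_of_real (b p))"
      unfolding trace_rank1[OF \<rho> \<rho>] ip_sqrt(1)[of b n, OF b(2), folded \<rho>_def] by (rule psi_scale[OF bC])
    moreover have "\<sigma> (embed (rank1 (Suc n) \<rho> \<rho>)) = ?c * psi (Suc n) (\<lambda>p. complex_of_real (fibre_sum (Suc 0) b p))"
      unfolding trace_rank1[OF \<rho> \<rho>] ip_sqrt(2)[of b n, OF b(2), folded \<rho>_def] by (rule psi_scale[OF LbC])
    ultimately show ?thesis by (simp only:) (simp only: right_diff_distrib ac_simps)
  qed
  finally have "\<sigma> (embed (\<lambda>z. S (T z))) = complex_of_real (real N * real (N ^ n) * real (N ^ n)) *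
      (of_nat N * psi n (\<lambda>p. complex_of_real (b p)) - psi (Suc n) (\<lambda>p. complex_of_real (fibre_sum (Suc 0) b p)))"
    by simp
  from pos[unfolded this] show ?thesis
    by (rule nonneg_complex_cancel) (use N_pos in simp)
qed

text \<open>The restriction of \<open>\<psi>\<^sub>n\<close> to real functions, where it takes real values (\<open>psi_real\<close>).\<close>

definition rpsi :: "nat \<Rightarrow> ('k \<Rightarrow> real) \<Rightarrow> real" where
  "rpsi n b = Re (psi n (\<lambda>p. complex_of_real (b p)))"

lemma psi_real:
  assumes b: "continuous_on UNIV b"
  shows "psi n (\<lambda>p. complex_of_real (b p)) = complex_of_real (rpsi n b)"
proof -
  obtain c where c: "0 \<le> c" "\<And>p. norm (b p) \<le> c" using bounded_cont[OF b] by blast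
  have "0 \<le> b p + c" for p using c(2)[of p] by (simp add: abs_le_iff)
  then have "psi n (\<lambda>p. complex_of_real (b p + c)) \<in> \<real>\<^sub>\<ge>\<^sub>0"
    by (intro psi_nonneg continuous_intros b)
  moreover have "psi n (\<lambda>p. complex_of_real c) \<in> \<real>\<^sub>\<ge>\<^sub>0"
    using c(1) by (intro psi_nonneg continuous_intros)
  moreover have "psi n (\<lambda>p. complex_of_real (b p + c)) = psi n (\<lambda>p. complex_of_real (b p)) + psi n (\<lambda>p. complex_of_real c)"
    using psi_add[OF cont_fun_of_real[OF b] cont_fun_const[of "complex_of_real c"]] by simp
  ultimately have "Im (psi n (\<lambda>p. complex_of_real (b p))) = 0"
    by (simp add: complex_nonneg_Reals_iff)
  then show ?thesis by (simp add: rpsi_def complex_eq_iff)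
qed

lemma rpsi_diff:
  assumes "continuous_on UNIV a" "continuous_on UNIV b"
  shows "rpsi n (\<lambda>p. a p - b p) = rpsi n a - rpsi n b"
  using psi_diff[OF cont_fun_of_real[OF assms(1)] cont_fun_of_real[OF assms(2)], of n]
  by (simp add: rpsi_def)

lemma rpsi_scale:
  assumes "continuous_on UNIV a"
  shows "rpsi n (\<lambda>p. c * a p) = c * rpsi n a"
  using psi_scale[OF cont_fun_of_real[OF assms(1)], of n "complex_of_real c"]
  by (simp add: rpsi_def)

lemma rpsi_nonneg: "continuous_on UNIV b \<Longrightarrow> (\<And>p. 0 \<le> b p) \<Longrightarrow> 0 \<le> rpsi n b"
  using psi_nonneg[of b n] by (simp add: rpsi_def complex_nonneg_Reals_iff)

lemma rpsi_mono:
  assumes "continuous_on UNIV a" "continuous_on UNIV b" "\<And>p. a p \<le> b p"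
  shows "rpsi n a \<le> rpsi n b"
  using rpsi_nonneg[of "\<lambda>p. b p - a p" n] rpsi_diff[OF assms(2,1), of n] assms
  by (simp add: continuous_on_diff)

lemma rpsi_Suc_le:
  assumes "continuous_on UNIV b" "\<And>p. 0 \<le> b p"
  shows "rpsi (Suc n) (fibre_sum (Suc 0) b) \<le> real N * rpsi n b"
  using psi_Suc_le[OF assms, of n] by (simp add: rpsi_def complex_nonneg_Reals_iff)

text \<open>Apply \<open>rpsi_Suc_le\<close> to \<open>b \<circ> h\<close>, whose image under the transfer operator is \<open>N b\<close>, and iterate.\<close>

lemma rpsi_shift_le:
  assumes "continuous_on UNIV b" "\<And>p. 0 \<le> b p"
  shows "rpsi n b \<le> rpsi 0 (\<lambda>p. b ((h ^^ n) p))"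
  using assms
proof (induction n arbitrary: b)
  case (Suc n)
  have bh: "continuous_on UNIV (\<lambda>p. b (h p))"
    using continuous_on_compose2[OF Suc.prems(1) h_cont] by simp
  have "fibre_sum (Suc 0) (\<lambda>p. b (h p)) = (\<lambda>y. real N * b y)"
    by (auto simp: fun_eq_iff fibre_sum_1 h_inverse)
  then have "real N * rpsi (Suc n) b \<le> real N * rpsi n (\<lambda>p. b (h p))"
    using rpsi_Suc_le[OF bh, of n] Suc.prems(2) rpsi_scale[OF Suc.prems(1), of "Suc n" "real N"] by simp
  then have "rpsi (Suc n) b \<le> rpsi n (\<lambda>p. b (h p))" using N_pos by simp
  also have "\<dots> \<le> rpsi 0 (\<lambda>p. b (h ((h ^^ n) p)))" using bh Suc.prems(2) by (intro Suc.IH) auto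
  finally show ?case by simp
qed simp

lemma psi_bound:
  assumes u: "u \<in> cont_fun" and r: "continuous_on UNIV r" and le: "\<And>p. cmod (u p) \<le> r p"
  shows "cmod (psi n u) \<le> 2 * rpsi n r"
proof -
  have real: "\<bar>rpsi n v\<bar> \<le> rpsi n r" if v: "continuous_on UNIV v" "\<And>p. \<bar>v p\<bar> \<le> r p" for v
  proof -
    have "rpsi n v \<le> rpsi n r" using v r by (intro rpsi_mono) (auto simp: abs_le_iff)
    moreover have "rpsi n (\<lambda>p. (-1) * v p) \<le> rpsi n r"
      using v r by (intro rpsi_mono continuous_intros) (auto simp: abs_le_iff)
    ultimately show ?thesis using rpsi_scale[OF v(1), of n "-1"] by (simp add: abs_le_iff)
  qed
  have Re: "continuous_on UNIV (\<lambda>p. Re (u p))" and Im: "continuous_on UNIV (\<lambda>p. Im (u p))"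
    using cont_funD[OF u] by (auto intro: continuous_intros)
  have "u = (\<lambda>p. complex_of_real (Re (u p)) + \<i> * complex_of_real (Im (u p)))"
    by (rule ext) (rule complex_eq)
  then have "psi n u = psi n (\<lambda>p. complex_of_real (Re (u p)) + \<i> * complex_of_real (Im (u p)))" by simp
  also have "\<dots> = psi n (\<lambda>p. complex_of_real (Re (u p))) + psi n (\<lambda>p. \<i> * complex_of_real (Im (u p)))"
    by (rule psi_add) (intro cont_fun_intros Re Im)+
  also have "\<dots> = complex_of_real (rpsi n (\<lambda>p. Re (u p))) + \<i> * complex_of_real (rpsi n (\<lambda>p. Im (u p)))"
    by (simp only: psi_scale[OF cont_fun_of_real[OF Im]] psi_real[OF Re] psi_real[OF Im])
  finally have "cmod (psi n u) \<le> \<bar>rpsi n (\<lambda>p. Re (u p))\<bar> + \<bar>rpsi n (\<lambda>p. Im (u p))\<bar>"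
    using norm_triangle_ineq[of "complex_of_real (rpsi n (\<lambda>p. Re (u p)))"
        "\<i> * complex_of_real (rpsi n (\<lambda>p. Im (u p)))"] by (simp add: norm_mult)
  also have "\<dots> \<le> rpsi n r + rpsi n r"
    by (intro add_mono real Re Im) (metis abs_Re_le_cmod abs_Im_le_cmod le order_trans)+
  finally show ?thesis by simp
qed


subsection \<open>Functions vanishing near the branch set\<close>

text \<open>The last hypothesis says that multiplication by \<open>a\<close> on \<open>X\<close> is the sum of the operators \<open>\<theta>\<^sub>x\<^sub>,\<^sub>y\<close> with
  \<open>x = a v\<^sub>i\<close> and \<open>y = v\<^sub>i\<close>. Inserting this in the last factor writes a rank-one operator of level \<open>n\<close>
  as a sum of rank-one operators of level \<open>n + 1\<close>, whose traces are added up.\<close>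

lemma psi_Suc_local:
  assumes a: "a \<in> cont_fun" and I: "finite I" and v: "\<And>i. i \<in> I \<Longrightarrow> continuous_on UNIV (v i)"
    and square: "\<And>p. (\<Sum>i\<in>I. (v i p)\<^sup>2) = 1"
    and local: "\<And>p (w :: 'k \<Rightarrow> complex). (\<Sum>i\<in>I. a p * of_real (v i p) *
      (\<Sum>j=1..N. of_real (v i (\<gamma> j (h p))) * w (\<gamma> j (h p)))) = a p * w p"
  shows "psi n a = psi (Suc n) (fibre_sum (Suc 0) a)"
proof -
  define V where "V i = (\<lambda>p. complex_of_real (v i p))" for i
  have V: "V i \<in> cont_fun" if "i \<in> I" for i unfolding V_def by (rule cont_fun_of_real[OF v[OF that]])
  define x where "x i = (\<lambda>p. a ((h ^^ n) p) * V i ((h ^^ n) p))" for i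
  define y where "y i = (\<lambda>p. V i ((h ^^ n) p))" for i
  have x: "x i \<in> cont_fun" and y: "y i \<in> cont_fun" if "i \<in> I" for i
    unfolding x_def y_def using V[OF that] by (intro cont_fun_intros cont_fun_shift a; simp)+
  note one = cont_fun_const[of "1 :: complex"]
  have op: "rank1 n (\<lambda>p. a ((h ^^ n) p)) (\<lambda>_. 1) = (\<lambda>z p. \<Sum>i\<in>I. rank1 (Suc n) (x i) (y i) z p)"
  proof (intro ext)
    fix z p
    have "ip n (y i) z q = V i q * ip n (\<lambda>_. 1) z q" for i q
      using ip_shift_left[of n "\<lambda>_. 1" "V i" z q] by (simp add: y_def V_def mult.commute)
    then have "ip (Suc n) (y i) z q = (\<Sum>j=1..N. V i (\<gamma> j q) * ip n (\<lambda>_. 1) z (\<gamma> j q))" for i q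
      by (simp add: ip_Suc)
    then show "rank1 n (\<lambda>p. a ((h ^^ n) p)) (\<lambda>_. 1) z p = (\<Sum>i\<in>I. rank1 (Suc n) (x i) (y i) z p)"
      using local[of "(h ^^ n) p" "ip n (\<lambda>_. 1) z"] by (simp add: rank1_def x_def V_def)
  qed
  have sum: "\<sigma> (embed (\<lambda>z p. \<Sum>i\<in>J. rank1 (Suc n) (x i) (y i) z p)) = (\<Sum>i\<in>J. \<sigma> (embed (rank1 (Suc n) (x i) (y i))))
      \<and> core_op (Suc n) (\<lambda>z p. \<Sum>i\<in>J. rank1 (Suc n) (x i) (y i) z p)" if "finite J" "J \<subseteq> I" for J
    using that
  proof (induction J rule: finite_induct)
    case empty
    have "core_op (Suc n) (\<lambda>z p. 0 * rank1 (Suc n) (\<lambda>_. 1) (\<lambda>_. 1) z p)"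
      by (intro core_op_scale core_op_rank1 one)
    then show ?case
      using trace_scale[OF \<sigma> core_op_rank1[OF one one, of "Suc n"], of 0] by simp
  next
    case (insert i J)
    then have c: "core_op (Suc n) (rank1 (Suc n) (x i) (y i))" by (intro core_op_rank1 x y) auto
    show ?case
      using insert trace_add[OF \<sigma> c, of "\<lambda>z p. \<Sum>i\<in>J. rank1 (Suc n) (x i) (y i) z p"]
        core_op_add[OF c, of "\<lambda>z p. \<Sum>i\<in>J. rank1 (Suc n) (x i) (y i) z p"] by simp
  qed
  let ?c = "of_nat (N ^ n) :: complex"
  have term_eq: "\<sigma> (embed (rank1 (Suc n) (x i) (y i)))
      = ?c * psi (Suc n) (fibre_sum (Suc 0) (\<lambda>p. a p * of_real ((v i p)\<^sup>2)))" if i: "i \<in> I" for i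
  proof -
    have "ip n (y i) (x i) q = ?c * (a q * of_real ((v i q)\<^sup>2))" for q
      using ip_1_shift[of n "\<lambda>q. a q * of_real ((v i q)\<^sup>2)" q]
      by (simp add: ip_def x_def y_def V_def power2_eq_square ac_simps)
    then have "ip (Suc n) (y i) (x i) = (\<lambda>q. ?c * fibre_sum (Suc 0) (\<lambda>p. a p * of_real ((v i p)\<^sup>2)) q)"
      by (auto simp: ip_Suc fibre_sum_1 sum_distrib_left)
    moreover have "fibre_sum (Suc 0) (\<lambda>p. a p * of_real ((v i p)\<^sup>2)) \<in> cont_fun"
      using v[OF i] cont_funD[OF a] by (intro cont_funI fibre_sum_cont continuous_intros)
    ultimately show ?thesis
      unfolding trace_rank1[OF x[OF i] y[OF i]] by (simp add: psi_scale)
  qed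
  have "?c * psi n a = \<sigma> (embed (rank1 n (\<lambda>p. a ((h ^^ n) p)) (\<lambda>_. 1)))"
    using N_pow_nonzero[where 'c = complex] by (simp add: psi_def)
  also have "\<dots> = (\<Sum>i\<in>I. ?c * psi (Suc n) (fibre_sum (Suc 0) (\<lambda>p. a p * of_real ((v i p)\<^sup>2))))"
    unfolding op using sum[OF I order_refl] term_eq by simp
  also have "\<dots> = ?c * psi (Suc n) (\<lambda>q. \<Sum>i\<in>I. fibre_sum (Suc 0) (\<lambda>p. a p * of_real ((v i p)\<^sup>2)) q)"
  proof -
    have "fibre_sum (Suc 0) (\<lambda>p. a p * of_real ((v i p)\<^sup>2)) \<in> cont_fun" if "i \<in> I" for i
      using v[OF that] cont_funD[OF a] by (intro cont_funI fibre_sum_cont continuous_intros)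
    then show ?thesis by (simp add: psi_sum[OF I] sum_distrib_left)
  qed
  also have "(\<lambda>q. \<Sum>i\<in>I. fibre_sum (Suc 0) (\<lambda>p. a p * of_real ((v i p)\<^sup>2)) q) = fibre_sum (Suc 0) a"
  proof
    fix q
    have "(\<Sum>i\<in>I. a p * of_real ((v i p)\<^sup>2)) = a p" for p
      using arg_cong[OF square[of p], of complex_of_real] by (simp flip: sum_distrib_left)
    then show "(\<Sum>i\<in>I. fibre_sum (Suc 0) (\<lambda>p. a p * of_real ((v i p)\<^sup>2)) q) = fibre_sum (Suc 0) a q"
      by (simp flip: fibre_sum_sum)
  qed
  finally show ?thesis using N_pos by simp
qed

text \<open>Take a partition of unity into pieces smaller than the distance between different branches over
  the support of \<open>a\<close>. On that support a piece then sees only one point of each fibre, and this point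
  is reached by a single branch, so the last hypothesis of \<open>psi_Suc_local\<close> holds.\<close>

lemma psi_Suc_off_branch:
  assumes a: "a \<in> cont_fun" and S: "closed S" "S \<inter> branch_set N \<gamma> = {}"
    and off: "\<And>p. p \<notin> S \<Longrightarrow> a p = 0"
  shows "psi n a = psi (Suc n) (fibre_sum (Suc 0) a)"
proof -
  obtain \<delta> where \<delta>: "\<delta> > 0"
    "\<And>i j y. i \<in> {1..N} \<Longrightarrow> j \<in> {1..N} \<Longrightarrow> i \<noteq> j \<Longrightarrow> \<gamma> j y \<in> S \<Longrightarrow> \<delta> \<le> dist (\<gamma> j y) (\<gamma> i y)"
    using branches_separated[OF S] by blast
  obtain F :: "'k set" and v :: "'k \<Rightarrow> 'k \<Rightarrow> real" where F: "finite F"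
    "\<And>i. continuous_on UNIV (v i)" "\<And>p. (\<Sum>i\<in>F. (v i p)\<^sup>2) = 1"
    "\<And>i p q. dist p q \<ge> \<delta> \<Longrightarrow> v i p * v i q = 0"
    using square_partition_of_unity[OF compact_space \<delta>(1)] by blast
  show ?thesis
  proof (rule psi_Suc_local[OF a F(1) F(2) F(3)])
    fix p and w :: "'k \<Rightarrow> complex"
    show "(\<Sum>i\<in>F. a p * of_real (v i p) * (\<Sum>j=1..N. of_real (v i (\<gamma> j (h p))) * w (\<gamma> j (h p)))) = a p * w p"
    proof (cases "p \<in> S")
      case False
      then show ?thesis by (simp add: off)
    next
      case True
      obtain j\<^sub>0 where j0: "j\<^sub>0 \<in> {1..N}" "p = \<gamma> j\<^sub>0 (h p)" using cover by blast
      have "of_real (v i p) * (\<Sum>j=1..N. of_real (v i (\<gamma> j (h p))) * w (\<gamma> j (h p)))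
          = of_real ((v i p)\<^sup>2) * w p" for i
      proof -
        have "v i p * v i (\<gamma> j (h p)) = 0" if "j \<in> {1..N}" "j \<noteq> j\<^sub>0" for j
          using \<delta>(2)[of j j\<^sub>0 "h p"] that j0 True by (intro F(4)) auto
        then have "(\<Sum>j=1..N. of_real (v i p * v i (\<gamma> j (h p))) * w (\<gamma> j (h p)))
            = (\<Sum>j=1..N. if j = j\<^sub>0 then of_real ((v i p)\<^sup>2) * w p else 0)"
          using j0 by (intro sum.cong) (auto simp: power2_eq_square simp flip: of_real_mult)
        also have "\<dots> = of_real ((v i p)\<^sup>2) * w p" using j0(1) by simp
        finally show ?thesis by (simp add: sum_distrib_left mult.assoc)
      qed
      then have "(\<Sum>i\<in>F. a p * of_real (v i p) * (\<Sum>j=1..N. of_real (v i (\<gamma> j (h p))) * w (\<gamma> j (h p))))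
          = (\<Sum>i\<in>F. of_real ((v i p)\<^sup>2)) * (a p * w p)"
        by (simp only: mult.assoc sum_distrib_right) (simp only: ac_simps)
      also have "(\<Sum>i\<in>F. complex_of_real ((v i p)\<^sup>2)) = 1"
        using F(3)[of p] by (metis of_real_1 of_real_sum)
      finally show ?thesis by simp
    qed
  qed
qed


subsection \<open>Functionals that are small near the branch set\<close>

text \<open>Split \<open>a\<close> into a part that vanishes near the branch set and a part that is dominated by a multiple
  of a cutoff function; both sides of the equation are small for the second part.\<close>

lemma psi_Suc:
  assumes fin: "finite (branch_set N \<gamma>)"
    and small: "\<And>e. e > 0 \<Longrightarrow> \<exists>m. rpsi n (cutoff m) < e"
    and a: "a \<in> cont_fun"
  shows "psi n a = psi (Suc n) (fibre_sum (Suc 0) a)"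
proof -
  obtain c where c: "0 \<le> c" "\<And>p. norm (a p) \<le> c" using bounded_cont[OF cont_funD[OF a]] by blast
  have "cmod (psi n a - psi (Suc n) (fibre_sum (Suc 0) a)) \<le> 0 + e" if e: "e > 0" for e
  proof -
    \<comment> \<open>The summand \<open>1\<close> keeps the denominator positive when \<open>a\<close> is zero.\<close>
    define d where "d = e / (2 * c * (1 + real N) + 1)"
    have D: "2 * c * (1 + real N) + 1 > 0" using c(1) by (simp add: add_nonneg_pos)
    then have "d > 0" using e by (simp add: d_def)
    then obtain m where m: "rpsi n (cutoff m) < d" using small by blast
    note cut = cutoff_cont[of m] cutoff_bounds[of m]
    define u where "u p = a p * of_real (cutoff m p)" for p
    define w where "w p = a p * of_real (1 - cutoff m p)" for p
    have u: "u \<in> cont_fun" and w: "w \<in> cont_fun"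
      unfolding u_def w_def using cut(1) by (auto intro!: cont_fun_intros a continuous_intros)
    have a_eq: "a = (\<lambda>p. u p + w p)" by (auto simp: u_def w_def algebra_simps)
    define S where "S = {p. 1 \<le> real m * (\<Prod>b\<in>branch_set N \<gamma>. dist p b)}"
    have "psi n w = psi (Suc n) (fibre_sum (Suc 0) w)"
    proof (rule psi_Suc_off_branch[OF w])
      show "closed S" unfolding S_def by (intro closed_Collect_le continuous_intros)
      show "S \<inter> branch_set N \<gamma> = {}"
      proof -
        have "(\<Prod>b\<in>branch_set N \<gamma>. dist p b) = 0" if "p \<in> branch_set N \<gamma>" for p
          using fin that by auto
        then show ?thesis unfolding S_def by force
      qed
      show "w p = 0" if "p \<notin> S" for p
        using that by (auto simp: S_def w_def cutoff_def)
    qed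
    moreover have Lu: "fibre_sum (Suc 0) u \<in> cont_fun" "fibre_sum (Suc 0) w \<in> cont_fun"
      using cont_funD[OF u] cont_funD[OF w] by (auto intro!: cont_funI fibre_sum_cont)
    moreover have "fibre_sum (Suc 0) a = (\<lambda>p. fibre_sum (Suc 0) u p + fibre_sum (Suc 0) w p)"
      by (subst a_eq) (rule ext, rule fibre_sum_add)
    moreover have "psi n a = psi n u + psi n w"
      by (subst a_eq) (rule psi_add[OF u w])
    ultimately have "psi n a - psi (Suc n) (fibre_sum (Suc 0) a) = psi n u - psi (Suc n) (fibre_sum (Suc 0) u)"
      by (simp add: psi_add)
    also have "cmod \<dots> \<le> cmod (psi n u) + cmod (psi (Suc n) (fibre_sum (Suc 0) u))"
      by (rule norm_triangle_ineq4)
    also have "\<dots> \<le> 2 * (c * rpsi n (cutoff m)) + 2 * (c * (real N * rpsi n (cutoff m)))"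
    proof (intro add_mono)
      have u_le: "cmod (u p) \<le> c * cutoff m p" for p
        using c cut by (simp add: u_def norm_mult mult_right_mono)
      have cc: "continuous_on UNIV (\<lambda>p. c * cutoff m p)" by (intro continuous_intros cut)
      show "cmod (psi n u) \<le> 2 * (c * rpsi n (cutoff m))"
        using psi_bound[OF u cc u_le, of n] by (simp add: rpsi_scale cut)
      have Lcc: "continuous_on UNIV (fibre_sum (Suc 0) (\<lambda>p. c * cutoff m p))"
        by (rule fibre_sum_cont[OF cc])
      have "cmod (fibre_sum (Suc 0) u p) \<le> fibre_sum (Suc 0) (\<lambda>p. c * cutoff m p) p" for p
        unfolding fibre_sum_1 using u_le by (intro order_trans[OF norm_sum] sum_mono)
      from psi_bound[OF Lu(1) Lcc this, of "Suc n"]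
      have "cmod (psi (Suc n) (fibre_sum (Suc 0) u)) \<le> 2 * rpsi (Suc n) (fibre_sum (Suc 0) (\<lambda>p. c * cutoff m p))" .
      also have "\<dots> \<le> 2 * (real N * rpsi n (\<lambda>p. c * cutoff m p))"
        using rpsi_Suc_le[OF cc, of n] c cut by simp
      also have "\<dots> = 2 * (c * (real N * rpsi n (cutoff m)))"
        by (simp add: rpsi_scale cut)
      finally show "cmod (psi (Suc n) (fibre_sum (Suc 0) u)) \<le> 2 * (c * (real N * rpsi n (cutoff m)))" .
    qed
    also have "\<dots> = 2 * c * (1 + real N) * rpsi n (cutoff m)" by (simp add: algebra_simps)
    also have "\<dots> \<le> 2 * c * (1 + real N) * d" using m c by (intro mult_left_mono) auto
    also have "\<dots> \<le> (2 * c * (1 + real N) + 1) * d" using \<open>d > 0\<close> by (simp add: algebra_simps)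
    also have "\<dots> = e" using D by (simp add: d_def)
    finally show ?thesis by simp
  qed
  then have "cmod (psi n a - psi (Suc n) (fibre_sum (Suc 0) a)) \<le> 0" by (rule field_le_epsilon)
  then show ?thesis by simp
qed

end

end


section \<open>Measures determined by continuous functions\<close>

lemma infdist_bump_tendsto:
  fixes C :: "'a::metric_space set"
  assumes "closed C" "C \<noteq> {}"
  shows "(\<lambda>m. max 0 (1 - real m * infdist x C)) \<longlonglongrightarrow> indicator C x"
proof (cases "x \<in> C")
  case True
  then show ?thesis by simp
next
  case False
  then have pos: "infdist x C > 0" using assms infdist_pos_not_in_closed by blast
  obtain M :: nat where M: "1 / infdist x C < real M" using reals_Archimedean2 by blast
  have "max 0 (1 - real m * infdist x C) = 0" if "m \<ge> M" for m
  proof -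
    have "1 < real M * infdist x C" using M pos by (simp add: field_simps)
    also have "\<dots> \<le> real m * infdist x C" using that pos by (intro mult_right_mono) auto
    finally show ?thesis by simp
  qed
  then have "\<forall>\<^sub>F m in sequentially. max 0 (1 - real m * infdist x C) = 0"
    by (auto simp: eventually_sequentially)
  then have "(\<lambda>m. max 0 (1 - real m * infdist x C)) \<longlonglongrightarrow> 0" by (rule tendsto_eventually)
  then show ?thesis using False by simp
qed

text \<open>The indicator function of a closed set is a limit of continuous functions with values in \<open>[0, 1]\<close>,
  and the closed sets generate the Borel sets.\<close>

lemma finite_measure_eqI_continuous:
  fixes \<mu> \<nu> :: "'a::metric_space measure"
  assumes \<mu>: "sets \<mu> = sets borel" "finite_measure \<mu>" and \<nu>: "sets \<nu> = sets borel" "finite_measure \<nu>"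
    and eq: "\<And>f :: 'a \<Rightarrow> real. continuous_on UNIV f \<Longrightarrow> (\<And>x. 0 \<le> f x \<and> f x \<le> 1) \<Longrightarrow>
      (\<integral>x. f x \<partial>\<mu>) = (\<integral>x. f x \<partial>\<nu>)"
  shows "\<mu> = \<nu>"
proof -
  have lim: "(\<lambda>m. \<integral>x. max 0 (1 - real m * infdist x C) \<partial>M) \<longlonglongrightarrow> measure M C"
    if C: "closed C" "C \<noteq> {}" and M: "sets M = sets borel" "finite_measure M" for C and M :: "'a measure"
  proof -
    interpret finite_measure M by (rule M(2))
    have [measurable]: "C \<in> sets M" using C M(1) by simp
    have "(\<lambda>m. \<integral>x. max 0 (1 - real m * infdist x C) \<partial>M) \<longlonglongrightarrow> (\<integral>x. indicator C x \<partial>M)"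
    proof (rule integral_dominated_convergence[where w = "\<lambda>_. 1"])
      show "(indicator C :: 'a \<Rightarrow> real) \<in> borel_measurable M" by simp
      have "(\<lambda>x. max 0 (1 - real m * infdist x C)) \<in> borel_measurable borel" for m
        by (intro borel_measurable_continuous_onI continuous_intros)
      then show "(\<lambda>x. max 0 (1 - real m * infdist x C)) \<in> borel_measurable M" for m
        using measurable_cong_sets[OF M(1) refl] by blast
      show "AE x in M. (\<lambda>m. max 0 (1 - real m * infdist x C)) \<longlonglongrightarrow> indicator C x"
        using infdist_bump_tendsto[OF C] by simp
      show "AE x in M. norm (max 0 (1 - real m * infdist x C)) \<le> 1" for m
        by (simp add: infdist_nonneg)
    qed simp
    then show ?thesis by simp
  qed
  show ?thesis
  proof (rule measure_eqI_generator_eq[where E = "Collect closed" and \<Omega> = UNIV and A = "\<lambda>_. UNIV"])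
    show "Int_stable (Collect closed)" by (auto simp: Int_stable_def)
    show "sets \<mu> = sigma_sets UNIV (Collect closed)" "sets \<nu> = sigma_sets UNIV (Collect closed)"
      unfolding \<mu>(1) \<nu>(1) borel_eq_closed by simp_all
    show "emeasure \<mu> UNIV \<noteq> \<infinity>" for i :: nat
      using finite_measure.emeasure_finite[OF \<mu>(2)] by simp
    fix C :: "'a set" assume "C \<in> Collect closed"
    then have C: "closed C" by simp
    show "emeasure \<mu> C = emeasure \<nu> C"
    proof (cases "C = {}")
      case False
      have "(\<integral>x. max 0 (1 - real m * infdist x C) \<partial>\<mu>) = (\<integral>x. max 0 (1 - real m * infdist x C) \<partial>\<nu>)" for m
        by (intro eq continuous_intros) (auto simp: infdist_nonneg)
      then have "measure \<mu> C = measure \<nu> C"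
        using LIMSEQ_unique[OF lim[OF C False \<mu>]] lim[OF C False \<nu>] by simp
      then show ?thesis
        using finite_measure.emeasure_eq_measure[OF \<mu>(2)] finite_measure.emeasure_eq_measure[OF \<nu>(2)] by simp
    qed simp
  qed auto
qed


section \<open>Equidistribution and the Hutchinson measure\<close>

context self_similar_system
begin

lemma uniform_contraction:
  obtains c where "0 \<le> c" "c < 1" "\<And>j x y. j \<in> {1..N} \<Longrightarrow> dist (\<gamma> j x) (\<gamma> j y) \<le> c * dist x y"
proof -
  have "\<exists>c. 0 < c \<and> c < 1 \<and> (\<forall>x y. dist (\<gamma> j x) (\<gamma> j y) \<le> c * dist x y)" if "j \<in> {1..N}" for j
    using gamma_contraction[OF that] by metis
  then obtain d where d: "\<And>j. j \<in> {1..N} \<Longrightarrow> 0 < d j \<and> d j < 1 \<and> (\<forall>x y. dist (\<gamma> j x) (\<gamma> j y) \<le> d j * dist x y)"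
    by metis
  define c where "c = Max (insert 0 (d ` {1..N}))"
  have "0 \<le> c" unfolding c_def by (intro Max_ge) auto
  moreover have "c < 1" unfolding c_def using d by (subst Max_less_iff) auto
  moreover have "dist (\<gamma> j x) (\<gamma> j y) \<le> c * dist x y" if j: "j \<in> {1..N}" for j x y
  proof -
    have "dist (\<gamma> j x) (\<gamma> j y) \<le> d j * dist x y" using d[OF j] by blast
    also have "\<dots> \<le> c * dist x y" unfolding c_def using j by (intro mult_right_mono Max_ge) auto
    finally show ?thesis .
  qed
  ultimately show ?thesis by (rule that)
qed

text \<open>Points \<open>foldr \<gamma> w y\<close> and \<open>foldr \<gamma> w y'\<close> with a long word \<open>w\<close> are close together, uniformly in \<open>w\<close>, and
  \<open>a\<close> is uniformly continuous.\<close>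

lemma fibre_sum_oscillation:
  assumes a: "a \<in> cont_fun" and e: "e > 0"
  obtains k where "\<And>y y'. cmod (fibre_sum k a y - fibre_sum k a y') \<le> real (N ^ k) * e"
proof -
  obtain c where c: "0 \<le> c" "c < 1" "\<And>j x y. j \<in> {1..N} \<Longrightarrow> dist (\<gamma> j x) (\<gamma> j y) \<le> c * dist x y"
    using uniform_contraction by blast
  have contr: "dist (foldr \<gamma> w x) (foldr \<gamma> w y) \<le> c ^ k * dist x y" if "w \<in> words k" for w k x y
    using that
  proof (induction k arbitrary: w)
    case (Suc k)
    then obtain j v where w: "w = j # v" "j \<in> {1..N}" "v \<in> words k" by (auto simp: words_Suc)
    have "dist (foldr \<gamma> w x) (foldr \<gamma> w y) \<le> c * dist (foldr \<gamma> v x) (foldr \<gamma> v y)"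
      using c(3)[OF w(2)] by (simp add: w(1))
    also have "\<dots> \<le> c * (c ^ k * dist x y)" using Suc.IH[OF w(3)] c(1) by (intro mult_left_mono)
    finally show ?case by (simp add: mult.assoc)
  qed simp
  have "uniformly_continuous_on UNIV a"
    using compact_uniformly_continuous[OF cont_funD[OF a] compact_space] .
  then obtain d where d: "d > 0" "\<And>x y. dist x y < d \<Longrightarrow> dist (a x) (a y) < e"
    using e unfolding uniformly_continuous_on_def by (metis UNIV_I)
  obtain D where D: "\<And>x y :: 'k. dist x y \<le> D"
    using compact_imp_bounded[OF compact_space] unfolding bounded_two_points by auto
  have "(\<lambda>k. c ^ k * D) \<longlonglongrightarrow> 0 * D"
    using c by (intro tendsto_intros LIMSEQ_power_zero) auto
  then have "\<forall>\<^sub>F k in sequentially. c ^ k * D < d" using d(1) by (intro order_tendstoD(2)) auto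
  then obtain k where k: "c ^ k * D < d" by (auto simp: eventually_sequentially)
  have "cmod (fibre_sum k a y - fibre_sum k a y') \<le> real (N ^ k) * e" for y y'
  proof -
    have "cmod (a (foldr \<gamma> w y) - a (foldr \<gamma> w y')) \<le> e" if "w \<in> words k" for w
    proof -
      have "dist (foldr \<gamma> w y) (foldr \<gamma> w y') \<le> c ^ k * dist y y'" by (rule contr[OF that])
      also have "\<dots> \<le> c ^ k * D" using c(1) D by (intro mult_left_mono) auto
      also have "\<dots> < d" by (rule k)
      finally have "dist (a (foldr \<gamma> w y)) (a (foldr \<gamma> w y')) < e" by (rule d(2))
      then show ?thesis by (simp add: dist_norm)
    qed
    then have "cmod (\<Sum>w\<in>words k. a (foldr \<gamma> w y) - a (foldr \<gamma> w y')) \<le> (\<Sum>w\<in>words k. e)"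
      by (intro order_trans[OF norm_sum] sum_mono)
    then show ?thesis by (simp add: fibre_sum_def sum_subtractf card_words)
  qed
  then show ?thesis by (rule that)
qed

lemma integrable_cont:
  fixes a :: "'k \<Rightarrow> 'b::{banach, second_countable_topology}"
  assumes \<mu>: "sets \<mu> = sets borel" "finite_measure \<mu>" and a: "continuous_on UNIV a"
  shows "integrable \<mu> a"
proof -
  interpret finite_measure \<mu> by (rule \<mu>(2))
  obtain c where c: "\<And>p. norm (a p) \<le> c" using bounded_cont[OF a] by blast
  have "a \<in> borel_measurable borel" by (rule borel_measurable_continuous_onI[OF a])
  then have "a \<in> borel_measurable \<mu>" using measurable_cong_sets[OF \<mu>(1) refl] by blast
  then show ?thesis using c by (intro integrable_const_bound[where B = c]) auto
qed

lemma hutchinson_fibre_sum: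
  assumes \<mu>: "is_hutchinson_measure N \<gamma> \<mu>" and a: "a \<in> cont_fun"
  shows "of_nat (N ^ k) * (\<integral>x. a x \<partial>\<mu>) = (\<integral>x. fibre_sum k a x \<partial>\<mu>)"
proof (induction k)
  case (Suc k)
  have fin: "finite_measure \<mu>" and sets: "sets \<mu> = sets borel"
    using \<mu> by (auto simp: is_hutchinson_measure_def intro!: finite_measureI)
  have F: "continuous_on UNIV (fibre_sum k a)" by (rule fibre_sum_cont[OF cont_funD[OF a]])
  have Fj: "continuous_on UNIV (\<lambda>x. fibre_sum k a (\<gamma> j x))" if "j \<in> {1..N}" for j
    by (rule continuous_on_compose2[OF F gamma_cont[OF that]]) simp
  have "(\<integral>x. fibre_sum (Suc k) a x \<partial>\<mu>) = (\<Sum>j=1..N. \<integral>x. fibre_sum k a (\<gamma> j x) \<partial>\<mu>)"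
    unfolding fibre_sum_Suc_apply
    by (rule Bochner_Integration.integral_sum) (rule integrable_cont[OF sets fin Fj])
  also have "\<dots> = of_nat N * (\<integral>x. fibre_sum k a x \<partial>\<mu>)"
    using \<mu> cont_funI[OF F] N_pos by (simp add: is_hutchinson_measure_def)
  finally show ?case by (simp add: Suc[symmetric] mult.assoc)
qed simp

text \<open>The integral of \<open>a\<close> equals that of \<open>N\<^sup>-\<^sup>k\<close> times its fibre sum, which is almost constant, so that the
  integrals against both measures are close to the same number.\<close>

lemma hutchinson_integral_unique:
  assumes \<mu>: "is_hutchinson_measure N \<gamma> \<mu>" and \<nu>: "is_hutchinson_measure N \<gamma> \<nu>" and a: "a \<in> cont_fun"
  shows "(\<integral>x. a x \<partial>\<mu>) = (\<integral>x. a x \<partial>\<nu>)"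
proof -
  fix y\<^sub>0 :: 'k
  have "cmod ((\<integral>x. a x \<partial>\<mu>) - (\<integral>x. a x \<partial>\<nu>)) \<le> 0 + e" if e: "e > 0" for e
  proof -
    obtain k where k: "\<And>y y'. cmod (fibre_sum k a y - fibre_sum k a y') \<le> real (N ^ k) * (e / 2)"
      using fibre_sum_oscillation[OF a, of "e / 2"] e by (metis half_gt_zero)
    define c where "c = fibre_sum k a y\<^sub>0"
    have near: "cmod (of_nat (N ^ k) * (\<integral>x. a x \<partial>\<rho>) - c) \<le> real (N ^ k) * (e / 2)"
      if \<rho>: "is_hutchinson_measure N \<gamma> \<rho>" for \<rho>
    proof -
      have one: "emeasure \<rho> (space \<rho>) = 1" and sets: "sets \<rho> = sets borel"
        using \<rho> by (auto simp: is_hutchinson_measure_def)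
      have fin: "finite_measure \<rho>" using one by (intro finite_measureI) auto
      have F: "integrable \<rho> (fibre_sum k a)"
        by (rule integrable_cont[OF sets fin fibre_sum_cont[OF cont_funD[OF a]]])
      have m1: "measure \<rho> (space \<rho>) = 1" using one by (simp add: measure_def)
      have "of_nat (N ^ k) * (\<integral>x. a x \<partial>\<rho>) - c = (\<integral>x. fibre_sum k a x - c \<partial>\<rho>)"
        using F finite_measure.integrable_const[OF fin, of c] m1
        by (simp only: hutchinson_fibre_sum[OF \<rho> a] Bochner_Integration.integral_diff) simp
      also have "cmod \<dots> \<le> (\<integral>x. cmod (fibre_sum k a x - c) \<partial>\<rho>)" by (rule integral_norm_bound)
      also have "\<dots> \<le> (\<integral>x. real (N ^ k) * (e / 2) \<partial>\<rho>)"
        unfolding c_def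
        by (intro integral_mono integrable_norm Bochner_Integration.integrable_diff F k
            finite_measure.integrable_const[OF fin])
      also have "\<dots> = real (N ^ k) * (e / 2)" using m1 by simp
      finally show ?thesis .
    qed
    have "real (N ^ k) * cmod ((\<integral>x. a x \<partial>\<mu>) - (\<integral>x. a x \<partial>\<nu>))
      = cmod ((of_nat (N ^ k) * (\<integral>x. a x \<partial>\<mu>) - c) - (of_nat (N ^ k) * (\<integral>x. a x \<partial>\<nu>) - c))"
      by (simp add: norm_mult norm_power flip: right_diff_distrib)
    also have "\<dots> \<le> real (N ^ k) * (e / 2) + real (N ^ k) * (e / 2)"
      by (rule order_trans[OF norm_triangle_ineq4 add_mono[OF near[OF \<mu>] near[OF \<nu>]]])
    also have "\<dots> = real (N ^ k) * e" by (simp add: field_simps)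
    finally show ?thesis using N_pos by simp
  qed
  then have "cmod ((\<integral>x. a x \<partial>\<mu>) - (\<integral>x. a x \<partial>\<nu>)) \<le> 0" by (rule field_le_epsilon)
  then show ?thesis by simp
qed

lemma hutchinson_measure_unique:
  assumes \<mu>: "is_hutchinson_measure N \<gamma> \<mu>" and \<nu>: "is_hutchinson_measure N \<gamma> \<nu>"
  shows "\<mu> = \<nu>"
proof (rule finite_measure_eqI_continuous)
  show s: "sets \<mu> = sets borel" "finite_measure \<mu>" "sets \<nu> = sets borel" "finite_measure \<nu>"
    using \<mu> \<nu> by (auto simp: is_hutchinson_measure_def intro!: finite_measureI)
  fix f :: "'k \<Rightarrow> real" assume f: "continuous_on UNIV f"
  have "complex_of_real (\<integral>x. f x \<partial>\<mu>) = complex_of_real (\<integral>x. f x \<partial>\<nu>)"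
    using hutchinson_integral_unique[OF \<mu> \<nu> cont_fun_of_real[OF f]] by simp
  then show "(\<integral>x. f x \<partial>\<mu>) = (\<integral>x. f x \<partial>\<nu>)" by (simp only: of_real_eq_iff)
qed


section \<open>Traces without point masses\<close>

context
  fixes \<sigma> :: "'k core_elt \<Rightarrow> complex" and \<mu> :: "'k measure"
  assumes state: "tracial_state_on_core N \<gamma> \<sigma>"
    and restriction: "restriction_measure N \<gamma> \<sigma> \<mu>"
    and no_atoms: "\<And>x. emeasure \<mu> {x} = 0"
    and finite_branch: "finite (branch_set N \<gamma>)"
begin

lemma trace: "finite_trace (core N \<gamma>) \<sigma>"
  using state by (simp add: tracial_state_on_core_def)

lemma sets_\<mu>: "sets \<mu> = sets borel" and finite_\<mu>: "finite_measure \<mu>"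
  using restriction by (auto simp: restriction_measure_def)

lemma psi_0_integral: "a \<in> cont_fun \<Longrightarrow> psi \<sigma> 0 a = (\<integral>x. a x \<partial>\<mu>)"
  using restriction by (simp add: psi_0[OF trace] restriction_measure_def)

lemma rpsi_0_integral:
  assumes "continuous_on UNIV b"
  shows "rpsi \<sigma> 0 b = (\<integral>x. b x \<partial>\<mu>)"
  by (simp add: rpsi_def[OF trace] psi_0_integral[OF cont_fun_of_real[OF assms]])

lemma finite_null:
  assumes "finite A"
  shows "A \<in> null_sets \<mu>"
proof -
  have "{x} \<in> null_sets \<mu>" for x by (rule null_setsI[OF no_atoms]) (simp add: sets_\<mu>)
  then have "(\<Union>x\<in>A. {x}) \<in> null_sets \<mu>"
    using assms by (intro null_sets_UN' countable_finite)
  then show ?thesis by simp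
qed

text \<open>Only finitely many points are mapped into the branch set by \<open>h ^^ n\<close>, and the cutoff functions tend
  to \<open>0\<close> at all other points. This is where the absence of point masses enters.\<close>

lemma cutoff_small:
  assumes e: "e > 0"
  shows "\<exists>m. rpsi \<sigma> n (cutoff m) < e"
proof -
  define d where "d p = (\<Prod>b\<in>branch_set N \<gamma>. dist p b)" for p
  have "{p. (h ^^ n) p \<in> branch_set N \<gamma>} \<subseteq> (\<Union>b\<in>branch_set N \<gamma>. (\<lambda>w. foldr \<gamma> w b) ` words n)"
  proof
    fix p assume p: "p \<in> {p. (h ^^ n) p \<in> branch_set N \<gamma>}"
    obtain w where "w \<in> words n" "foldr \<gamma> w ((h ^^ n) p) = p" using shift_word by blast
    with p show "p \<in> (\<Union>b\<in>branch_set N \<gamma>. (\<lambda>w. foldr \<gamma> w b) ` words n)"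
      by (intro UN_I[of "(h ^^ n) p"] image_eqI[of _ _ w]) simp_all
  qed
  then have "finite {p. (h ^^ n) p \<in> branch_set N \<gamma>}"
    by (rule finite_subset) (use finite_branch in auto)
  from AE_not_in[OF finite_null[OF this]]
  have AE: "AE p in \<mu>. (\<lambda>m. cutoff m ((h ^^ n) p)) \<longlonglongrightarrow> 0"
  proof (rule AE_mp[OF _ AE_I2[OF impI]])
    fix p assume p: "p \<notin> {p. (h ^^ n) p \<in> branch_set N \<gamma>}"
    let ?q = "(h ^^ n) p"
    have "d ?q > 0" unfolding d_def using p by (intro prod_pos) auto
    moreover obtain M :: nat where M: "2 / d ?q < real M" using reals_Archimedean2 by blast
    ultimately have "2 < real M * d ?q" by (simp add: field_simps)
    then have "cutoff m ?q = 0" if "m \<ge> M" for m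
    proof -
      have "real M * d ?q \<le> real m * d ?q" using that \<open>d ?q > 0\<close> by (intro mult_right_mono) auto
      with \<open>2 < real M * d ?q\<close> have "2 - real m * d ?q \<le> 0" by linarith
      then show ?thesis unfolding cutoff_def d_def[symmetric] by linarith
    qed
    then have "\<forall>\<^sub>F m in sequentially. cutoff m ?q = 0" by (auto simp: eventually_sequentially)
    then show "(\<lambda>m. cutoff m ?q) \<longlonglongrightarrow> 0" by (rule tendsto_eventually)
  qed
  have cont: "continuous_on UNIV (\<lambda>p. cutoff m ((h ^^ n) p))" for m
    by (rule continuous_on_compose2[OF cutoff_cont shift_cont]) simp
  have "(\<lambda>m. \<integral>p. cutoff m ((h ^^ n) p) \<partial>\<mu>) \<longlonglongrightarrow> (\<integral>p. 0 \<partial>\<mu>)"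
  proof (rule integral_dominated_convergence[where w = "\<lambda>_. 1"])
    show "(\<lambda>p. cutoff m ((h ^^ n) p)) \<in> borel_measurable \<mu>" for m
      using integrable_cont[OF sets_\<mu> finite_\<mu> cont] by (rule borel_measurable_integrable)
    show "integrable \<mu> (\<lambda>_. 1 :: real)"
      using finite_measure.integrable_const[OF finite_\<mu>] .
    show "AE p in \<mu>. norm (cutoff m ((h ^^ n) p)) \<le> 1" for m
      using cutoff_bounds by simp
  qed (use AE in auto)
  then have "\<forall>\<^sub>F m in sequentially. (\<integral>p. cutoff m ((h ^^ n) p) \<partial>\<mu>) < e"
    using e by (intro order_tendstoD(2)) auto
  then obtain m where "(\<integral>p. cutoff m ((h ^^ n) p) \<partial>\<mu>) < e" by (auto simp: eventually_sequentially)
  moreover have "rpsi \<sigma> n (cutoff m) \<le> rpsi \<sigma> 0 (\<lambda>p. cutoff m ((h ^^ n) p))"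
    by (rule rpsi_shift_le[OF trace cutoff_cont cutoff_bounds(1)])
  ultimately have "rpsi \<sigma> n (cutoff m) < e" by (simp add: rpsi_0_integral[OF cont])
  then show ?thesis ..
qed

lemma psi_fibre_sum:
  assumes a: "a \<in> cont_fun"
  shows "psi \<sigma> n a = psi \<sigma> (n + k) (fibre_sum k a)"
proof (induction k)
  case (Suc k)
  have "fibre_sum k a \<in> cont_fun" by (rule cont_funI[OF fibre_sum_cont[OF cont_funD[OF a]]])
  from psi_Suc[OF trace finite_branch cutoff_small this, of "n + k"]
  show ?case using Suc fibre_sum_Suc2[of k a] by simp
qed simp

lemma psi_1: "psi \<sigma> n (\<lambda>_. 1) = 1 / of_nat (N ^ n)"
proof -
  have "psi \<sigma> 0 (\<lambda>_. 1) = psi \<sigma> n (\<lambda>_. of_nat (N ^ n) * 1)"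
    using psi_fibre_sum[OF cont_fun_const[of 1], of 0 n] by (simp add: fibre_sum_const[abs_def])
  also have "\<dots> = of_nat (N ^ n) * psi \<sigma> n (\<lambda>_. 1)"
    by (rule psi_scale[OF trace cont_fun_const])
  moreover have "psi \<sigma> 0 (\<lambda>_. 1) = 1"
    using state by (simp add: psi_0[OF trace cont_fun_const] tracial_state_on_core_def)
  ultimately show ?thesis using N_pos by (simp add: field_simps)
qed

text \<open>Replace \<open>a\<close> at level \<open>n\<close> by its \<open>k\<close>-fold fibre sum at level \<open>n + k\<close>, which is almost constant. So
  \<open>N\<^sup>n \<psi>\<^sub>n(a)\<close> is close to a number \<open>m\<close> that does not depend on \<open>n\<close>, and for \<open>n = 0\<close> it is the integral.\<close>

lemma psi_eq_integral:
  assumes a: "a \<in> cont_fun"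
  shows "psi \<sigma> n a = (\<integral>x. a x \<partial>\<mu>) / of_nat (N ^ n)"
proof -
  fix y\<^sub>0 :: 'k
  have "cmod (of_nat (N ^ n) * psi \<sigma> n a - psi \<sigma> 0 a) \<le> 0 + e" if e: "e > 0" for e
  proof -
    obtain k where k: "\<And>y y'. cmod (fibre_sum k a y - fibre_sum k a y') \<le> real (N ^ k) * (e / 4)"
      using fibre_sum_oscillation[OF a, of "e / 4"] e by auto
    define F where "F = fibre_sum k a"
    have F: "F \<in> cont_fun" unfolding F_def by (rule cont_funI[OF fibre_sum_cont[OF cont_funD[OF a]]])
    define m where "m = F y\<^sub>0 / of_nat (N ^ k)"
    have near: "cmod (of_nat (N ^ i) * psi \<sigma> i a - m) \<le> e / 2" for i
    proof -
      have "psi \<sigma> (i + k) (\<lambda>y. F y - F y\<^sub>0) = psi \<sigma> i a - F y\<^sub>0 * (1 / of_nat (N ^ (i + k)))"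
        using psi_diff[OF trace F cont_fun_const[of "F y\<^sub>0"], of "i + k"] psi_fibre_sum[OF a, of i k]
          psi_scale[OF trace cont_fun_const[of 1], of "i + k" "F y\<^sub>0"]
        by (simp add: psi_1 F_def)
      then have eq: "of_nat (N ^ i) * psi \<sigma> i a - m = of_nat (N ^ i) * psi \<sigma> (i + k) (\<lambda>y. F y - F y\<^sub>0)"
        using N_pos by (simp add: m_def power_add field_simps)
      have "cmod (psi \<sigma> (i + k) (\<lambda>y. F y - F y\<^sub>0)) \<le> 2 * rpsi \<sigma> (i + k) (\<lambda>_. real (N ^ k) * (e / 4))"
        by (rule psi_bound[OF trace]) (use k in \<open>auto simp: F_def[symmetric] intro!: cont_fun_intros F\<close>)
      also have "rpsi \<sigma> (i + k) (\<lambda>_. real (N ^ k) * (e / 4)) = real (N ^ k) * (e / 4) / real (N ^ (i + k))"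
        using psi_scale[OF trace cont_fun_const[of 1], of "i + k" "of_real (real (N ^ k) * (e / 4))"]
        by (simp add: rpsi_def[OF trace] psi_1)
      finally have "real (N ^ i) * cmod (psi \<sigma> (i + k) (\<lambda>y. F y - F y\<^sub>0)) \<le> e / 2"
        using N_pos by (simp add: power_add field_simps)
      then show ?thesis unfolding eq by (simp add: norm_mult norm_power)
    qed
    have "of_nat (N ^ n) * psi \<sigma> n a - psi \<sigma> 0 a
        = (of_nat (N ^ n) * psi \<sigma> n a - m) - (of_nat (N ^ 0) * psi \<sigma> 0 a - m)" by simp
    also have "cmod \<dots> \<le> e / 2 + e / 2"
      by (rule order_trans[OF norm_triangle_ineq4 add_mono[OF near near]])
    finally show ?thesis by simp
  qed
  then have "cmod (of_nat (N ^ n) * psi \<sigma> n a - psi \<sigma> 0 a) \<le> 0" by (rule field_le_epsilon)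
  then show ?thesis using N_pos by (simp add: psi_0_integral[OF a] field_simps)
qed

text \<open>The relation \<open>\<psi>\<^sub>0(a) = \<psi>\<^sub>1(L a)\<close> with \<open>\<psi>\<^sub>1 = N\<^sup>-\<^sup>1 \<psi>\<^sub>0\<close> is the self-similarity of the measure.\<close>

lemma restriction_is_hutchinson: "is_hutchinson_measure N \<gamma> \<mu>"
  unfolding is_hutchinson_measure_def
proof (intro conjI ballI)
  show "sets \<mu> = sets borel" by (rule sets_\<mu>)
  have "(\<integral>x. 1 \<partial>\<mu>) = (1 :: complex)"
    using psi_0_integral[OF cont_fun_const[of 1]] psi_1[of 0] by simp
  then have "measure \<mu> (space \<mu>) = 1" by (simp add: scaleR_conv_of_real)
  then show "emeasure \<mu> (space \<mu>) = 1"
    using finite_measure.emeasure_eq_measure[OF finite_\<mu>, of "space \<mu>"] by simp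
  fix a :: "'k \<Rightarrow> complex" assume a: "a \<in> cont_fun"
  have aj: "continuous_on UNIV (\<lambda>x. a (\<gamma> j x))" if "j \<in> {1..N}" for j
    by (rule continuous_on_compose2[OF cont_funD[OF a] gamma_cont[OF that]]) simp
  have La: "fibre_sum (Suc 0) a \<in> cont_fun" by (rule cont_funI[OF fibre_sum_cont[OF cont_funD[OF a]]])
  have "(\<integral>x. a x \<partial>\<mu>) = psi \<sigma> (0 + Suc 0) (fibre_sum (Suc 0) a)"
    unfolding psi_fibre_sum[OF a, symmetric] by (rule psi_0_integral[OF a, symmetric])
  also have "\<dots> = (1 / of_nat N) * (\<integral>x. fibre_sum (Suc 0) a x \<partial>\<mu>)"
    using psi_eq_integral[OF La, of "Suc 0"] by simp
  also have "(\<integral>x. fibre_sum (Suc 0) a x \<partial>\<mu>) = (\<Sum>j=1..N. \<integral>x. a (\<gamma> j x) \<partial>\<mu>)"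
    unfolding fibre_sum_1
    by (rule Bochner_Integration.integral_sum) (rule integrable_cont[OF sets_\<mu> finite_\<mu> aj])
  finally show "(\<integral>x. a x \<partial>\<mu>) = (1 / of_nat N) * (\<Sum>j=1..N. \<integral>x. a (\<gamma> j x) \<partial>\<mu>)" .
qed

lemma hutchinson_measure_eq: "hutchinson_measure N \<gamma> = \<mu>"
  unfolding hutchinson_measure_def
  using restriction_is_hutchinson hutchinson_measure_unique by (intro the_equality) 

lemma trace_theta:
  assumes "x \<in> carr (bpower N \<gamma> i)" "y \<in> carr (bpower N \<gamma> i)"
  shows "\<sigma> (core_embed N \<gamma> i (theta (bpower N \<gamma> i) x y)) =
    (1 / of_nat N ^ i) * (\<integral>k. inner_A (bpower N \<gamma> i) y x k \<partial>\<mu>)"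
proof -
  obtain f g where f: "f \<in> cont_fun" "x = cls i f" and g: "g \<in> cont_fun" "y = cls i g"
    using assms unfolding carr_bpower by blast
  have "core_embed N \<gamma> i (theta (bpower N \<gamma> i) x y) = embed (rank1 i f g)"
    by (simp add: f(2) g(2) theta_cls[OF f(1) g(1)] core_embed_op[OF adjointable_rank1[OF f(1) g(1)]])
  then show ?thesis
    by (simp add: trace_rank1[OF trace f(1) g(1)] psi_eq_integral[OF ip_cont[OF g(1) f(1)]]
        f(2) g(2) inner_cls[OF g(1) f(1)])
qed

lemma trace_eq_tau_infinity: "\<sigma> = tau_infinity N \<gamma>"
  unfolding tau_infinity_def hutchinson_measure_eq
proof (rule the_equality[symmetric])
  have core_fun: "\<sigma> (core_fun N \<gamma> a) = (\<integral>k. a k \<partial>\<mu>)" if "a \<in> cont_fun" for a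
    using restriction that by (simp add: restriction_measure_def)
  show "finite_trace (core N \<gamma>) \<sigma> \<and>
      (\<forall>a\<in>cont_fun. \<sigma> (core_fun N \<gamma> a) = (\<integral>k. a k \<partial>\<mu>)) \<and>
      (\<forall>i\<ge>1. \<forall>x\<in>carr (bpower N \<gamma> i). \<forall>y\<in>carr (bpower N \<gamma> i).
         \<sigma> (core_embed N \<gamma> i (theta (bpower N \<gamma> i) x y)) =
           (1 / of_nat N ^ i) * (\<integral>k. inner_A (bpower N \<gamma> i) y x k \<partial>\<mu>))"
    using trace core_fun trace_theta by blast
  fix \<tau>
  assume \<tau>: "finite_trace (core N \<gamma>) \<tau> \<and>
      (\<forall>a\<in>cont_fun. \<tau> (core_fun N \<gamma> a) = (\<integral>k. a k \<partial>\<mu>)) \<and>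
      (\<forall>i\<ge>1. \<forall>x\<in>carr (bpower N \<gamma> i). \<forall>y\<in>carr (bpower N \<gamma> i).
         \<tau> (core_embed N \<gamma> i (theta (bpower N \<gamma> i) x y)) =
           (1 / of_nat N ^ i) * (\<integral>k. inner_A (bpower N \<gamma> i) y x k \<partial>\<mu>))"
  show "\<tau> = \<sigma>"
  proof (rule trace_eqI[OF _ trace])
    show "finite_trace (core N \<gamma>) \<tau>" using \<tau> by blast
    fix a :: "'k \<Rightarrow> complex" assume a: "a \<in> cont_fun"
    have "embed (\<lambda>f p. a p * f p) = core_fun N \<gamma> a"
      by (simp add: core_fun_def left_op_0[OF a] core_embed_op[OF adjointable_left_mult[OF a]])
    then show "\<tau> (embed (\<lambda>f p. a p * f p)) = \<sigma> (embed (\<lambda>f p. a p * f p))"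
      using \<tau> a core_fun[OF a] by simp
  next
    fix n :: nat and f g :: "'k \<Rightarrow> complex"
    assume n: "n \<ge> 1" and f: "f \<in> cont_fun" and g: "g \<in> cont_fun"
    have "embed (rank1 n f g) = core_embed N \<gamma> n (theta (bpower N \<gamma> n) (cls n f) (cls n g))"
      by (simp add: theta_cls[OF f g] core_embed_op[OF adjointable_rank1[OF f g]])
    then show "\<tau> (embed (rank1 n f g)) = \<sigma> (embed (rank1 n f g))"
      using \<tau> n trace_theta[OF cls_in_carr[OF f] cls_in_carr[OF g], of n]
        cls_in_carr[OF f, of n] cls_in_carr[OF g, of n] by simp
  qed
qed

end

end

theorem proposition7p7:
  fixes \<gamma> :: "nat \<Rightarrow> 'k::metric_space \<Rightarrow> 'k"
    and N :: nat
    and \<sigma> :: "'k core_elt \<Rightarrow> complex"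
    and \<mu>\<^sub>0 :: "'k measure"
  assumes "compact (UNIV :: 'k set)"
    and "N \<ge> 2"
    and "self_similar_map N \<gamma>"
    and "assumption_A N \<gamma>"
    and "tracial_state_on_core N \<gamma> \<sigma>"
    and "restriction_measure N \<gamma> \<sigma> \<mu>\<^sub>0"
    and "\<And>x. emeasure \<mu>\<^sub>0 {x} = 0"
  shows "\<sigma> = tau_infinity N \<gamma>"
proof -
  obtain h where h: "continuous_on UNIV h" "\<forall>y. \<forall>j\<in>{1..N}. h (\<gamma> j y) = y"
    using assms(4) unfolding assumption_A_def by (elim conjE exE)
  interpret self_similar_system N \<gamma> h
    by (rule self_similar_system.intro[OF assms(1,3) h(1)]) (use h(2) in blast)
  have "finite (branch_set N \<gamma>)"
    using assms(4) by (simp add: assumption_A_def)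
  then show ?thesis
    by (rule trace_eq_tau_infinity[OF assms(5-7)])
qed

end
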